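(* For every $n\ge2$, the set $\mathcal A^s_n$ of signed arc permutations, endowed with the map $w\mapsto\mathrm{sDes}(w)$, is a fine set for the $B_n$-character induced from the $B_{n-1}$-representation on the exterior algebra $\bigwedge V_{n-1}$. Equivalently, $$\sum_{w\in\mathcal A^s_n}F_{\mathrm{sDes}(w)}(x,y)=\mathrm{ch}\Big(\sum_{k=0}^{n-1}\chi^{(k),(1^{n-k-1})}\big\uparrow^{B_n}_{B_{n-1}}\Big).$$
   Context: $B_n$: signed permutations $w=(w(1),\dots,w(n))$; $|a|$ denotes the absolute value (bar removed). $w\in B_n$ is a signed arc permutation if for each $i\in\{2,\dots,n-1\}$: the set $\{|w(1)|,\dots,|w(i-1)|\}$ is an interval in $\mathbb Z_n$ (cyclically consecutive residues, $n$ identified with $0$), and $w(i)$ is unbarred if $|w(i)|-1\in\{|w(1)|,\dots,|w(i-1)|\}$ and barred if $|w(i)|+1\in\{|w(1)|,\dots,|w(i-1)|\}$ (arithmetic in $\mathbb Z_n$). $V_{n-1}$ is an $(n-1)$-dimensional complex vector space on which $B_{n-1}$ acts by permuting coordinates and switching their signs; $B_{n-1}\le B_n$ is the subgroup fixing $n$; $\uparrow^{B_n}_{B_{n-1}}$ is induction. $\chi^{\lambda,\mu}$ is the irreducible $B_{n-1}$-character with Frobenius characteristic $s_\lambda(x)s_\mu(y)$; $\mathrm{ch}(\chi)=\frac{1}{2^nn!}\sum_w\chi(w)p^+_\alpha p^-_\beta$ with $(\alpha,\beta)$ the signed cycle type of $w$ (lengths of positive cycles — pairs of disjoint cycles $c,\bar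 c$ on $\{1,\dots,n,\bar1,\dots,\bar n\}$ — and negative cycles $c=\bar c$, counted with half length), $p^\pm_j=\sum_i(x_i^j\pm y_i^j)$. $\mathrm{sDes}(w)=(S,\varepsilon)$: with $\bar1<_r\cdots<_r\bar n<_r1<_r\cdots<_rn$, $S$ consists of $n$ and all $s\in[n-1]$ with $w(s)>_rw(s+1)$ or with $w(s)$ barred and $w(s+1)$ unbarred; $\varepsilon(s)=-$ iff $w(s)$ barred. For $\sigma=(S,\varepsilon)$ with $S=\{s_1<\dots<s_m=n\}$, $s_0=0$: sign vector $\tilde\varepsilon(j)=\varepsilon(s_i)$ for $s_{i-1}<j\le s_i$; ${\rm wDes}(\sigma)$ the set of $s_i$, $i<m$, with $\varepsilon(s_i)=\varepsilon(s_{i+1})$ or ($\varepsilon(s_i)=+$, $\varepsilon(s_{i+1})=-$); $F_\sigma(x,y)=\sum z_{i_1}\cdots z_{i_n}$ over $i_1\le\dots\le i_n$ with $i_j<i_{j+1}$ for $j\in{\rm wDes}(\sigma)$, $z_{i_j}=x_{i_j}$ if $\tilde\varepsilon(j)=+$, else $y_{i_j}$. Fine sets: for a signed composition $\gamma=(\gamma_1,\dots,\gamma_m)$ of $n$ (some parts barred), partial sums $r_i$, $r_0=0$, $S(\gamma)=\{r_1,\dots,r_m\}$, blocks $I_i=\{r_{i-1}+1,\dots,r_i\}$: $\mathrm{wt}_\gamma(\sigma)=0$ if for some $i$, $S\cap\{r_{i-1}+1,\dots,r_i-1\}$ is not an initial segment of $\{r_{i-1}+1,\dots,r_i-1\}$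 or $\tilde\varepsilon$ is not constant on $I_i$; else $(-1)^{|S\setminus S(\gamma)|+n_\gamma(\sigma)}$, $n_\gamma(\sigma)$ the number of $i$ with $\tilde\varepsilon=-$ on $I_i$ and $\gamma_i$ barred. A finite set $\mathcal B$ with map $\mathrm{sDes}$ is fine for a class function $\chi$ of $B_n$ if $\chi(\gamma)=\sum_{b\in\mathcal B}\mathrm{wt}_\gamma(\mathrm{sDes}(b))$ for all $\gamma$, $\chi(\gamma)$ being the value at elements of signed cycle type (sorted unbarred parts; sorted barred parts of $\gamma$). *)

theory Defs
  imports
    "HOL-Library.Multiset"
    "HOL-Library.FuncSet"
    "HOL-Number_Theory.Cong"
    "HOL-Combinatorics.Permutations"
    "HOL-Combinatorics.Orbits"
    "Jordan_Normal_Form.Matrix"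
begin

section \<open>Formal power series in an arbitrary set of variables\<close>

text \<open>A monomial is the finite multiset of its variables; a series is its coefficient function.\<close>

typedef 'v mseries = "UNIV :: ('v multiset \<Rightarrow> complex) set"
  morphisms mcoeff Abs_mseries
  by simp

setup_lifting type_definition_mseries

lemma mseries_eqI: "(\<And>M. mcoeff f M = mcoeff g M) \<Longrightarrow> f = g"
  by transfer auto

instantiation mseries :: (type) comm_ring_1
begin

lift_definition zero_mseries :: "'a mseries" is "\<lambda>_. 0" .
lift_definition one_mseries :: "'a mseries" is "\<lambda>M. if M = {#} then 1 else 0" .
lift_definition plus_mseries :: "'a mseries \<Rightarrow> 'a mseries \<Rightarrow> 'a mseries"
  is "\<lambda>f g M. f M + g M" .
lift_definition uminus_mseries :: "'a mseries \<Rightarrow> 'a mseries" is "\<lambda>f M. - f M" .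
lift_definition minus_mseries :: "'a mseries \<Rightarrow> 'a mseries \<Rightarrow> 'a mseries"
  is "\<lambda>f g M. f M - g M" .
lift_definition times_mseries :: "'a mseries \<Rightarrow> 'a mseries \<Rightarrow> 'a mseries"
  is "\<lambda>f g M. \<Sum>A | A \<subseteq># M. f A * g (M - A)" .

instance
proof
  have fin: "finite {A. A \<subseteq># M}" for M :: "'a multiset"
  proof -
    have "{A. A \<subseteq># M} \<subseteq> mset ` {xs. set xs \<subseteq> set_mset M \<and> length xs \<le> size M}"
    proof
      fix A assume "A \<in> {A. A \<subseteq># M}"
      then have A: "A \<subseteq># M" by simp
      obtain xs where xs: "mset xs = A" using ex_mset by blast
      have "set xs \<subseteq> set_mset M" using A xs by (metis set_mset_mono set_mset_mset)
      moreover have "length xs \<le> size M" using A xs by (metis size_mset size_mset_mono)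
      ultimately show "A \<in> mset ` {xs. set xs \<subseteq> set_mset M \<and> length xs \<le> size M}"
        using xs by blast
    qed
    moreover have "finite (mset ` {xs. set xs \<subseteq> set_mset M \<and> length xs \<le> size M})"
      by (intro finite_imageI finite_lists_length_le finite_set_mset)
    ultimately show ?thesis by (rule finite_subset)
  qed
  fix a b c :: "'a mseries"
  show "a * b * c = a * (b * c)"
  proof (transfer, rule ext)
    fix f g h :: "'a multiset \<Rightarrow> complex" and M
    have "(\<Sum>A | A \<subseteq># M. (\<Sum>B | B \<subseteq># A. f B * g (A - B)) * h (M - A))
      = (\<Sum>(A, B) \<in> (SIGMA A:{A. A \<subseteq># M}. {B. B \<subseteq># A}). f B * g (A - B) * h (M - A))"
      by (subst sum.Sigma[symmetric]) (auto simp: fin sum_distrib_right)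
    also have "\<dots> = (\<Sum>(B, C) \<in> (SIGMA B:{B. B \<subseteq># M}. {C. C \<subseteq># M - B}).
        f B * g C * h (M - B - C))"
    proof (rule sum.reindex_bij_witness[of _ "\<lambda>(B, C). (B + C, B)" "\<lambda>(A, B). (B, A - B)"], goal_cases)
      case (1 p)
      then show ?case by (cases p) (simp add: subset_mset.add_diff_inverse)
    next
      case (2 p)
      then obtain A B where p: "p = (A, B)" "A \<subseteq># M" "B \<subseteq># A" by (cases p) simp
      then have "B \<subseteq># M" by (meson subset_mset.order_trans)
      moreover have "A - B \<subseteq># M - B"
        using p(2) by (simp add: subseteq_mset_def diff_le_mono)
      ultimately show ?case using p(1) by simp
    next
      case (3 p)
      then show ?case by (cases p) simp
    next
      case (4 p)
      then obtain B C where p: "p = (B, C)" "B \<subseteq># M" "C \<subseteq># M - B" by (cases p) simp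
      have "B + C \<subseteq># M"
      proof (rule mset_subset_eqI)
        fix a
        have "count B a \<le> count M a" "count C a \<le> count M a - count B a"
          using p(2,3) by (simp_all add: subseteq_mset_def)
        then show "count (B + C) a \<le> count M a" by simp
      qed
      then show ?case using p(1) by simp
    next
      case (5 p)
      then obtain A B where p: "p = (A, B)" "A \<subseteq># M" "B \<subseteq># A" by (cases p) simp
      have "M - B - (A - B) = M - A"
        using p(3) by (simp add: subset_mset.add_diff_inverse)
      then show ?case using p(1) by simp
    qed
    also have "\<dots> = (\<Sum>A | A \<subseteq># M. f A * (\<Sum>B | B \<subseteq># M - A. g B * h (M - A - B)))"
      by (subst sum.Sigma[symmetric]) (auto simp: fin sum_distrib_left mult.assoc)
    finally show "(\<Sum>A | A \<subseteq># M. (\<Sum>B | B \<subseteq># A. f B * g (A - B)) * h (M - A))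
      = (\<Sum>A | A \<subseteq># M. f A * (\<Sum>B | B \<subseteq># M - A. g B * h (M - A - B)))" .
  qed
  show "a * b = b * a"
  proof (transfer, rule ext)
    fix f g :: "'a multiset \<Rightarrow> complex" and M
    show "(\<Sum>A | A \<subseteq># M. f A * g (M - A)) = (\<Sum>A | A \<subseteq># M. g A * f (M - A))"
    proof (rule sum.reindex_bij_witness[of _ "\<lambda>A. M - A" "\<lambda>A. M - A"], goal_cases)
      case (3 A)
      then have "M - (M - A) = A" by (simp add: multiset_eq_iff subseteq_mset_def)
      then show ?case by simp
    next
      case (5 A)
      then have "M - (M - A) = A" by (simp add: multiset_eq_iff subseteq_mset_def)
      then show ?case by (simp add: mult.commute)
    qed (simp_all add: multiset_eq_iff subseteq_mset_def)
  qed
  show "1 * a = a"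
  proof (transfer, rule ext)
    fix f :: "'a multiset \<Rightarrow> complex" and M
    have "(\<Sum>A | A \<subseteq># M. (if A = {#} then 1 else 0) * f (M - A))
      = (\<Sum>A \<in> {{#}}. (if A = {#} then 1 else 0) * f (M - A))"
      by (rule sum.mono_neutral_right) (auto simp: fin)
    then show "(\<Sum>A | A \<subseteq># M. (if A = {#} then 1 else 0) * f (M - A)) = f M" by simp
  qed
  show "a + b + c = a + (b + c)" by transfer (simp add: add.assoc)
  show "a + b = b + a" by transfer (simp add: add.commute)
  show "0 + a = a" by transfer simp
  show "- a + a = 0" by transfer simp
  show "a - b = a + - b" by transfer simp
  show "(a + b) * c = a * c + b * c"
    by transfer (simp add: distrib_right sum.distrib)
  show "(0 :: 'a mseries) \<noteq> 1" by transfer (metis zero_neq_one)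
qed

end

lift_definition mconst :: "complex \<Rightarrow> 'v mseries" is "\<lambda>c M. if M = {#} then c else 0" .

datatype var = X nat | Y nat

lift_definition power_sum :: "(nat \<Rightarrow> var) \<Rightarrow> nat \<Rightarrow> var mseries"
  is "\<lambda>z j M. if \<exists>i. M = replicate_mset j (z i) then 1 else 0" .

definition p_plus :: "nat \<Rightarrow> var mseries" where
  "p_plus j = power_sum X j + power_sum Y j"

definition p_minus :: "nat \<Rightarrow> var mseries" where
  "p_minus j = power_sum X j - power_sum Y j"

text \<open>Rows and columns are numbered from 0; a partition may have trailing zeros, so that
  \<open>[0]\<close> is the empty partition.\<close>

definition young_diagram :: "nat list \<Rightarrow> (nat \<times> nat) set" where
  "young_diagram lam = {(i, j). i < length lam \<and> j < lam ! i}"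

definition ssyt :: "nat list \<Rightarrow> (nat \<times> nat \<Rightarrow> nat) set" where
  "ssyt lam = {T \<in> young_diagram lam \<rightarrow>\<^sub>E UNIV.
     (\<forall>i j. (i, Suc j) \<in> young_diagram lam \<longrightarrow> T (i, j) \<le> T (i, Suc j)) \<and>
     (\<forall>i j. (Suc i, j) \<in> young_diagram lam \<longrightarrow> T (i, j) < T (Suc i, j))}"

lift_definition schur :: "(nat \<Rightarrow> var) \<Rightarrow> nat list \<Rightarrow> var mseries"
  is "\<lambda>z lam M. of_nat (card {T \<in> ssyt lam.
        image_mset (\<lambda>c. z (T c)) (mset_set (young_diagram lam)) = M})" .


section \<open>Signed permutations\<close>

text \<open>The barred letter \<open>i\<close> is \<open>- i\<close>. Elements of all the groups are functions on the integers,
  so the subgroup of \<open>signed_perms n\<close> fixing \<open>n\<close> is literally \<open>signed_perms (n - 1)\<close>.\<close>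

definition signed_perms :: "nat \<Rightarrow> (int \<Rightarrow> int) set" where
  "signed_perms n = {w. w permutes ({- int n..int n} - {0}) \<and> (\<forall>i. w (- i) = - w i)}"

definition cycles :: "nat \<Rightarrow> (int \<Rightarrow> int) \<Rightarrow> int set set" where
  "cycles n w = orbit w ` ({- int n..int n} - {0})"

text \<open>A positive pair of cycles is represented by the union of the two cycles, so that half of the
  cardinality is the length for both kinds.\<close>

definition pos_cycles :: "nat \<Rightarrow> (int \<Rightarrow> int) \<Rightarrow> int set set" where
  "pos_cycles n w = {c \<union> uminus ` c | c. c \<in> cycles n w \<and> uminus ` c \<noteq> c}"

definition neg_cycles :: "nat \<Rightarrow> (int \<Rightarrow> int) \<Rightarrow> int set set" where
  "neg_cycles n w = {c \<in> cycles n w. uminus ` c = c}"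

definition signed_cycle_type :: "nat \<Rightarrow> (int \<Rightarrow> int) \<Rightarrow> nat multiset \<times> nat multiset" where
  "signed_cycle_type n w =
     (image_mset (\<lambda>c. card c div 2) (mset_set (pos_cycles n w)),
      image_mset (\<lambda>c. card c div 2) (mset_set (neg_cycles n w)))"

definition cyclic_interval :: "nat \<Rightarrow> int set \<Rightarrow> bool" where
  "cyclic_interval n A \<longleftrightarrow>
     (\<exists>a::int. \<exists>k::nat. (\<lambda>x. x mod int n) ` A = (\<lambda>j. (a + int j) mod int n) ` {..<k})"

definition signed_arc_perms :: "nat \<Rightarrow> (int \<Rightarrow> int) set" where
  "signed_arc_perms n = {w \<in> signed_perms n. \<forall>i \<in> {2..int n - 1}.
     (let A = (\<lambda>j. \<bar>w j\<bar>) ` {1..i - 1} in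
        cyclic_interval n A \<and>
        ((\<exists>a\<in>A. [\<bar>w i\<bar> - 1 = a] (mod int n)) \<longrightarrow> w i > 0) \<and>
        ((\<exists>a\<in>A. [\<bar>w i\<bar> + 1 = a] (mod int n)) \<longrightarrow> w i < 0))}"


section \<open>Signed descent sets, quasisymmetric functions and fine sets\<close>

definition less_r :: "int \<Rightarrow> int \<Rightarrow> bool" where
  "less_r a b \<longleftrightarrow> (a < 0 \<and> b < 0 \<and> \<bar>a\<bar> < \<bar>b\<bar>) \<or> (a < 0 \<and> 0 < b) \<or> (0 < a \<and> 0 < b \<and> a < b)"

text \<open>A signed set is a pair of a set and a sign function with values \<open>1\<close> and \<open>-1\<close>;
  only the values on the set are ever used.\<close>

type_synonym signed_set = "nat set \<times> (nat \<Rightarrow> int)"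

definition sDes :: "nat \<Rightarrow> (int \<Rightarrow> int) \<Rightarrow> signed_set" where
  "sDes n w =
     ({n} \<union> {s \<in> {1..n - 1}. less_r (w (int s + 1)) (w (int s)) \<or>
                              (w (int s) < 0 \<and> w (int s + 1) > 0)},
      \<lambda>s. if w (int s) < 0 then - 1 else 1)"

definition sign_vector :: "signed_set \<Rightarrow> nat \<Rightarrow> int" where
  "sign_vector \<sigma> j = snd \<sigma> (LEAST s. s \<in> fst \<sigma> \<and> j \<le> s)"

definition wDes :: "signed_set \<Rightarrow> nat set" where
  "wDes \<sigma> = {s \<in> fst \<sigma>. (\<exists>t \<in> fst \<sigma>. s < t) \<and>
     (let t = (LEAST t. t \<in> fst \<sigma> \<and> s < t) in
        snd \<sigma> s = snd \<sigma> t \<or> (snd \<sigma> s = 1 \<and> snd \<sigma> t = - 1))}"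

text \<open>The set of sequences counted here is finite, since the monomial bounds the indices.\<close>

lift_definition F_fun :: "nat \<Rightarrow> signed_set \<Rightarrow> var mseries"
  is "\<lambda>n \<sigma> M. of_nat (card {i \<in> {1..n} \<rightarrow>\<^sub>E (UNIV :: nat set).
        (\<forall>j \<in> {1..<n}. i j \<le> i (j + 1)) \<and>
        (\<forall>j \<in> wDes \<sigma>. i j < i (j + 1)) \<and>
        image_mset (\<lambda>j. if sign_vector \<sigma> j = 1 then X (i j) else Y (i j)) (mset_set {1..n}) = M})" .

text \<open>Barred parts are negative.\<close>

definition signed_compositions :: "nat \<Rightarrow> int list set" where
  "signed_compositions n = {\<gamma>. 0 \<notin> set \<gamma> \<and> (\<Sum>c\<leftarrow>\<gamma>. \<bar>c\<bar>) = int n}"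

definition composition_type :: "int list \<Rightarrow> nat multiset \<times> nat multiset" where
  "composition_type \<gamma> =
     (mset (map nat (filter (\<lambda>c. c > 0) \<gamma>)), mset (map (\<lambda>c. nat \<bar>c\<bar>) (filter (\<lambda>c. c < 0) \<gamma>)))"

text \<open>In the following, blocks are numbered from 0: the block \<open>i\<close> is
  \<open>{partial_sum \<gamma> i + 1..partial_sum \<gamma> (i + 1)}\<close>.\<close>

definition partial_sum :: "int list \<Rightarrow> nat \<Rightarrow> nat" where
  "partial_sum \<gamma> i = (\<Sum>c\<leftarrow>take i \<gamma>. nat \<bar>c\<bar>)"

definition block :: "int list \<Rightarrow> nat \<Rightarrow> nat set" where
  "block \<gamma> i = {partial_sum \<gamma> i + 1..partial_sum \<gamma> (i + 1)}"

definition initial_segment :: "nat set \<Rightarrow> nat set \<Rightarrow> bool" where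
  "initial_segment A B \<longleftrightarrow> A \<subseteq> B \<and> (\<forall>a \<in> A. \<forall>b \<in> B. b < a \<longrightarrow> b \<in> A)"

definition wt :: "int list \<Rightarrow> signed_set \<Rightarrow> int" where
  "wt \<gamma> \<sigma> =
     (if \<exists>i < length \<gamma>.
           (let J = {partial_sum \<gamma> i + 1..<partial_sum \<gamma> (i + 1)} in
             \<not> initial_segment (fst \<sigma> \<inter> J) J) \<or>
           \<not> (\<exists>e. \<forall>j \<in> block \<gamma> i. sign_vector \<sigma> j = e)
      then 0
      else (- 1) ^ (card (fst \<sigma> - partial_sum \<gamma> ` {1..length \<gamma>}) +
             card {i. i < length \<gamma> \<and> (\<forall>j \<in> block \<gamma> i. sign_vector \<sigma> j = - 1) \<and> \<gamma> ! i < 0}))"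

definition fine_set :: "nat \<Rightarrow> 'b set \<Rightarrow> ('b \<Rightarrow> signed_set) \<Rightarrow> ((int \<Rightarrow> int) \<Rightarrow> complex) \<Rightarrow> bool" where
  "fine_set n \<B> D \<chi> \<longleftrightarrow> finite \<B> \<and>
     (\<forall>\<gamma> \<in> signed_compositions n. \<forall>w \<in> signed_perms n.
        signed_cycle_type n w = composition_type \<gamma> \<longrightarrow>
        \<chi> w = of_int (\<Sum>b\<in>\<B>. wt \<gamma> (D b)))"


section \<open>Characters\<close>

text \<open>Characters of a group \<open>G\<close> of permutations are functions that vanish outside \<open>G\<close>.\<close>

definition representation ::
    "('a \<Rightarrow> 'a) set \<Rightarrow> nat \<Rightarrow> (('a \<Rightarrow> 'a) \<Rightarrow> complex mat) \<Rightarrow> bool" where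
  "representation G d \<rho> \<longleftrightarrow>
     (\<forall>u \<in> G. \<rho> u \<in> carrier_mat d d) \<and> \<rho> id = 1\<^sub>m d \<and>
     (\<forall>u \<in> G. \<forall>v \<in> G. \<rho> (u \<circ> v) = \<rho> u * \<rho> v)"

definition invariant_subspace ::
    "('a \<Rightarrow> 'a) set \<Rightarrow> nat \<Rightarrow> (('a \<Rightarrow> 'a) \<Rightarrow> complex mat) \<Rightarrow> complex vec set \<Rightarrow> bool" where
  "invariant_subspace G d \<rho> W \<longleftrightarrow>
     W \<subseteq> carrier_vec d \<and> 0\<^sub>v d \<in> W \<and>
     (\<forall>v \<in> W. \<forall>v' \<in> W. v + v' \<in> W) \<and> (\<forall>c. \<forall>v \<in> W. c \<cdot>\<^sub>v v \<in> W) \<and>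
     (\<forall>u \<in> G. \<forall>v \<in> W. \<rho> u *\<^sub>v v \<in> W)"

definition irreducible_representation ::
    "('a \<Rightarrow> 'a) set \<Rightarrow> nat \<Rightarrow> (('a \<Rightarrow> 'a) \<Rightarrow> complex mat) \<Rightarrow> bool" where
  "irreducible_representation G d \<rho> \<longleftrightarrow> representation G d \<rho> \<and> d > 0 \<and>
     (\<forall>W. invariant_subspace G d \<rho> W \<longrightarrow> W = {0\<^sub>v d} \<or> W = carrier_vec d)"

definition irreducible_character :: "('a \<Rightarrow> 'a) set \<Rightarrow> (('a \<Rightarrow> 'a) \<Rightarrow> complex) \<Rightarrow> bool" where
  "irreducible_character G \<chi> \<longleftrightarrow> (\<exists>d \<rho>. irreducible_representation G d \<rho> \<and>
     \<chi> = (\<lambda>u. if u \<in> G then \<Sum>i<d. \<rho> u $$ (i, i) else 0))"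

text \<open>The induced class function, by the Frobenius formula.\<close>

definition induced ::
    "('a \<Rightarrow> 'a) set \<Rightarrow> ('a \<Rightarrow> 'a) set \<Rightarrow> (('a \<Rightarrow> 'a) \<Rightarrow> complex) \<Rightarrow> ('a \<Rightarrow> 'a) \<Rightarrow> complex" where
  "induced H G \<chi> g =
     (if g \<in> G
      then (\<Sum>u | u \<in> G \<and> inv_into UNIV u \<circ> g \<circ> u \<in> H. \<chi> (inv_into UNIV u \<circ> g \<circ> u)) / of_nat (card H)
      else 0)"

definition ch :: "nat \<Rightarrow> ((int \<Rightarrow> int) \<Rightarrow> complex) \<Rightarrow> var mseries" where
  "ch n \<chi> = mconst (1 / (2 ^ n * fact n)) *
     (\<Sum>w \<in> signed_perms n. case signed_cycle_type n w of (\<alpha>, \<beta>) \<Rightarrow>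
        mconst (\<chi> w) * prod_mset (image_mset p_plus \<alpha>) * prod_mset (image_mset p_minus \<beta>))"

definition irr_char :: "nat \<Rightarrow> nat list \<Rightarrow> nat list \<Rightarrow> (int \<Rightarrow> int) \<Rightarrow> complex" where
  "irr_char n lam mu =
     (THE \<chi>. irreducible_character (signed_perms n) \<chi> \<and> ch n \<chi> = schur X lam * schur Y mu)"


section \<open>The exterior algebra\<close>

text \<open>An element of the exterior algebra of the space with basis \<open>e 1, \<dots>, e m\<close> is given by its
  coordinates with respect to the basis elements \<open>e I = e i\<^sub>1 \<and> \<dots> \<and> e i\<^sub>k\<close>, where
  \<open>I = {i\<^sub>1 < \<dots> < i\<^sub>k}\<close> is a subset of \<open>{1..m}\<close>; the sign in the product counts the
  inversions between the two factors.\<close>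

type_synonym ext = "int set \<Rightarrow> complex"

definition ext_basis :: "int set \<Rightarrow> ext" where
  "ext_basis I = (\<lambda>J. if J = I then 1 else 0)"

definition wedge :: "ext \<Rightarrow> ext \<Rightarrow> ext" where
  "wedge f g = (\<lambda>K. \<Sum>I \<in> Pow K.
     (- 1) ^ card {(i, j). i \<in> I \<and> j \<in> K - I \<and> j < i} * f I * g (K - I))"

text \<open>The image of the basis vector \<open>e i\<close> under a signed permutation.\<close>

definition vec_act :: "(int \<Rightarrow> int) \<Rightarrow> int \<Rightarrow> ext" where
  "vec_act w i = (\<lambda>J. of_int (sgn (w i)) * ext_basis {\<bar>w i\<bar>} J)"

definition ext_act :: "nat \<Rightarrow> (int \<Rightarrow> int) \<Rightarrow> ext \<Rightarrow> ext" where
  "ext_act m w f = (\<lambda>J. \<Sum>I \<in> Pow {1..int m}.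
     f I * foldr wedge (map (vec_act w) (sorted_list_of_set I)) (ext_basis {}) J)"

definition ext_char :: "nat \<Rightarrow> (int \<Rightarrow> int) \<Rightarrow> complex" where
  "ext_char m w =
     (if w \<in> signed_perms m then \<Sum>I \<in> Pow {1..int m}. ext_act m w (ext_basis I) I else 0)"

end

theory Submission
  imports Defs "HOL-Combinatorics.Cycles"
begin

text \<open>
  A signed arc permutation is determined by its sign vector \<open>\<epsilon>\<close> and a residue modulo \<open>n\<close>: the
  unbarred letters increase cyclically, the barred ones decrease cyclically. Hence for every \<open>\<epsilon>\<close>
  the \<open>n\<close> signed descent sets are obtained from one basic signed set (descents exactly at the sign
  changes and at the pairs of adjacent barred letters) by toggling, for \<open>s = 1, \<dots>, n\<close>, the position
  \<open>s\<close> if \<open>\<epsilon>(s) = \<epsilon>(s + 1)\<close>, and doing nothing otherwise. Both generating functions are evaluated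
  from this description. The weights sum up to the number of unbarred parts \<open>1\<close> of \<open>\<gamma>\<close> times the
  product over all parts of \<open>1 \<plusminus> (-1)\<^bsup>r-1\<^esup>\<close> (\<open>r\<close> the length of the part, with the minus sign for
  barred parts), which is the induced character, because the character of the exterior algebra is
  \<open>det (1 + w)\<close>. The quasisymmetric functions sum up to the sum of all variables times
  \<open>\<Sum>\<^sub>k h\<^sub>k(x) e\<^sub>n\<^sub>-\<^sub>1\<^sub>-\<^sub>k(y)\<close>.

  On the other side, the power sum product of \<open>w\<close> is a signed count of the colourings of
  \<open>{1, \<dots>, n}\<close> by variables that are constant on the cycles of \<open>w\<close>. This gives the characteristic
  \<open>h\<^sub>k(x) e\<^sub>j(y)\<close> of the \<open>j\<close>-th exterior power of \<open>V\<^sub>k\<^sub>+\<^sub>j\<close>, which is irreducible because the sign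
  changes separate the basis vectors and the permutations act transitively on them, and it shows
  that class functions are determined by their characteristics.
\<close>

unbundle no m_inv_syntax

section \<open>Finite permutation groups\<close>

definition class_function :: "('a \<Rightarrow> 'a) set \<Rightarrow> (('a \<Rightarrow> 'a) \<Rightarrow> 'b) \<Rightarrow> bool" where
  "class_function G f \<longleftrightarrow> (\<forall>u\<in>G. \<forall>h\<in>G. f (u \<circ> h \<circ> inv u) = f h)"

lemma class_functionD: "class_function G f \<Longrightarrow> u \<in> G \<Longrightarrow> h \<in> G \<Longrightarrow> f (u \<circ> h \<circ> inv u) = f h"
  by (simp add: class_function_def)

locale perm_group =
  fixes G :: "('a \<Rightarrow> 'a) set"
  assumes finite: "finite G"
    and bij: "u \<in> G \<Longrightarrow> bij u"
    and id_mem: "id \<in> G"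
    and comp_mem: "u \<in> G \<Longrightarrow> v \<in> G \<Longrightarrow> u \<circ> v \<in> G"
    and inv_mem: "u \<in> G \<Longrightarrow> inv u \<in> G"
begin

lemma inv_comp: "u \<in> G \<Longrightarrow> inv u \<circ> u = id" and comp_inv: "u \<in> G \<Longrightarrow> u \<circ> inv u = id"
  using bij by (simp_all add: bij_is_inj bij_is_surj surj_iff[symmetric])

lemma inv_apply: "u \<in> G \<Longrightarrow> inv u (u x) = x" and apply_inv: "u \<in> G \<Longrightarrow> u (inv u x) = x"
  using inv_comp comp_inv by (simp_all add: pointfree_idE)

lemma inv_inv: "u \<in> G \<Longrightarrow> inv (inv u) = u"
  by (simp add: bij inv_inv_eq)

lemma conj_mem: "u \<in> G \<Longrightarrow> h \<in> G \<Longrightarrow> u \<circ> h \<circ> inv u \<in> G"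
  by (simp add: comp_mem inv_mem)

lemma conj_inv_mem: "u \<in> G \<Longrightarrow> h \<in> G \<Longrightarrow> inv u \<circ> h \<circ> u \<in> G"
  by (simp add: comp_mem inv_mem)

lemma inv_conj_conj: "u \<in> G \<Longrightarrow> inv u \<circ> (u \<circ> h \<circ> inv u) \<circ> u = h"
  by (simp add: fun_eq_iff inv_apply)

lemma conj_inv_conj: "u \<in> G \<Longrightarrow> u \<circ> (inv u \<circ> h \<circ> u) \<circ> inv u = h"
  by (simp add: fun_eq_iff apply_inv)

lemma class_function_conj_inv:
  assumes "class_function G f" "u \<in> G" "h \<in> G"
  shows "f (inv u \<circ> h \<circ> u) = f h"
  using class_functionD[OF assms(1) inv_mem[OF assms(2)] assms(3)] inv_inv[OF assms(2)] by simp

lemma card_left_translate: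
  assumes "u \<in> G" and PQ: "\<And>h. h \<in> G \<Longrightarrow> P (u \<circ> h) \<longleftrightarrow> Q h"
  shows "card {g \<in> G. P g} = card {h \<in> G. Q h}"
proof (rule bij_betw_same_card)
  have u_inv: "u \<circ> (inv u \<circ> g) = g" for g using assms(1) by (simp add: fun_eq_iff apply_inv)
  show "bij_betw (\<lambda>g. inv u \<circ> g) {g \<in> G. P g} {h \<in> G. Q h}"
  proof (rule bij_betw_byWitness[where f' = "\<lambda>h. u \<circ> h"])
    show "(\<lambda>g. inv u \<circ> g) ` {g \<in> G. P g} \<subseteq> {h \<in> G. Q h}"
    proof (rule image_subsetI)
      fix g assume "g \<in> {g \<in> G. P g}"
      then show "inv u \<circ> g \<in> {h \<in> G. Q h}"
        using PQ[of "inv u \<circ> g"] assms(1) by (simp add: u_inv comp_mem inv_mem)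
    qed
    show "(\<lambda>h. u \<circ> h) ` {h \<in> G. Q h} \<subseteq> {g \<in> G. P g}"
      using assms by (auto intro: comp_mem)
  qed (use assms(1) in \<open>auto simp: fun_eq_iff apply_inv inv_apply\<close>)
qed

lemma card_image_point_filter:
  "card {u \<in> G. P (u x)} = card {a \<in> (\<lambda>u. u x) ` G. P a} * card {u \<in> G. u x = x}"
proof -
  let ?X = "{a \<in> (\<lambda>u. u x) ` G. P a}"
  have "{u \<in> G. P (u x)} = (\<Union>a\<in>?X. {u \<in> G. u x = a})" by auto
  then have "card {u \<in> G. P (u x)} = (\<Sum>a\<in>?X. card {u \<in> G. u x = a})"
    using finite by (simp add: card_UN_disjoint disjoint_iff)
  also have "\<dots> = (\<Sum>a\<in>?X. card {u \<in> G. u x = x})"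
  proof (rule sum.cong[OF refl])
    fix a assume "a \<in> ?X"
    then obtain u where u: "u \<in> G" "u x = a" by blast
    show "card {u \<in> G. u x = a} = card {u \<in> G. u x = x}"
      using inj_eq[OF bij_is_inj[OF bij[OF u(1)]]] u(2) by (intro card_left_translate[OF u(1)]) auto
  qed
  finally show ?thesis by simp
qed

lemma induced_stabilizer:
  assumes "g \<in> G"
    and f: "\<And>u. u \<in> G \<Longrightarrow> inv u \<circ> g \<circ> u \<in> {u \<in> G. u x = x} \<Longrightarrow> f (inv u \<circ> g \<circ> u) = E"
  shows "induced {u \<in> G. u x = x} G f g = of_nat (card {a \<in> (\<lambda>u. u x) ` G. g a = a}) * E"
proof -
  let ?H = "{u \<in> G. u x = x}"
  have conj_mem_iff: "inv u \<circ> g \<circ> u \<in> ?H \<longleftrightarrow> g (u x) = u x" if "u \<in> G" for u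
    using that assms(1) conj_inv_mem[OF that assms(1)]
    by (auto simp: inv_apply apply_inv) (metis apply_inv)
  have "?H \<noteq> {}" using id_mem by auto
  then have H: "card ?H \<noteq> 0" using finite by simp
  have "induced ?H G f g = (\<Sum>u | u \<in> G \<and> inv u \<circ> g \<circ> u \<in> ?H. E) / of_nat (card ?H)"
    unfolding induced_def using assms(1) f by (auto intro!: sum.cong)
  also have "{u. u \<in> G \<and> inv u \<circ> g \<circ> u \<in> ?H} = {u \<in> G. g (u x) = u x}"
    using conj_mem_iff by blast
  also have "(\<Sum>u\<in>{u \<in> G. g (u x) = u x}. E) / of_nat (card ?H)
      = of_nat (card {a \<in> (\<lambda>u. u x) ` G. g a = a}) * E"
    using H by (simp add: card_image_point_filter[of "\<lambda>a. g a = a"])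
  finally show ?thesis .
qed

lemma sum_induced_mult_class_function:
  assumes "H \<subseteq> G" "class_function G q"
  shows "(\<Sum>w\<in>G. induced H G f w * q w)
    = of_nat (card G) / of_nat (card H) * (\<Sum>h\<in>H. f h * q h)"
proof -
  let ?c = "\<lambda>u w. inv u \<circ> w \<circ> u"
  have "(\<Sum>w\<in>G. induced H G f w * q w)
      = (\<Sum>w\<in>G. \<Sum>u\<in>{u \<in> G. ?c u w \<in> H}. f (?c u w) * q w / of_nat (card H))"
    by (intro sum.cong refl) (simp add: induced_def sum_distrib_right sum_divide_distrib)
  also have "\<dots> = (\<Sum>u\<in>G. \<Sum>w\<in>{w \<in> G. ?c u w \<in> H}. f (?c u w) * q w / of_nat (card H))"
    by (rule sum.swap_restrict) (rule finite)+
  also have "\<dots> = (\<Sum>u\<in>G. \<Sum>h\<in>H. f h * q h / of_nat (card H))"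
  proof (rule sum.cong[OF refl])
    fix u assume u: "u \<in> G"
    show "(\<Sum>w\<in>{w \<in> G. ?c u w \<in> H}. f (?c u w) * q w / of_nat (card H))
        = (\<Sum>h\<in>H. f h * q h / of_nat (card H))"
    proof (rule sum.reindex_bij_witness[of _ "\<lambda>h. u \<circ> h \<circ> inv u" "?c u"])
      fix w assume "w \<in> {w \<in> G. ?c u w \<in> H}"
      then show "f (?c u w) * q (?c u w) / of_nat (card H) = f (?c u w) * q w / of_nat (card H)"
        using class_function_conj_inv[OF assms(2) u] by simp
    qed (use u assms(1) in \<open>auto simp: conj_inv_conj inv_conj_conj conj_mem\<close>)
  qed
  finally show ?thesis by (simp add: sum_divide_distrib[symmetric])
qed

lemma class_function_trace:
  assumes "representation G d \<rho>"
  shows "class_function G (\<lambda>u. if u \<in> G then \<Sum>i<d. \<rho> u $$ (i, i) else 0)"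
  unfolding class_function_def
proof (intro ballI)
  define \<chi> where "\<chi> u = (if u \<in> G then \<Sum>i<d. \<rho> u $$ (i, i) else 0)" for u
  have carrier: "\<rho> w \<in> carrier_mat d d" if "w \<in> G" for w
    using assms that unfolding representation_def by blast
  have trace_comp: "\<chi> (v \<circ> w) = (\<Sum>i<d. \<Sum>k<d. \<rho> v $$ (i, k) * \<rho> w $$ (k, i))"
    if "v \<in> G" "w \<in> G" for v w
  proof -
    have "\<rho> (v \<circ> w) = \<rho> v * \<rho> w" using assms that unfolding representation_def by blast
    then have "\<chi> (v \<circ> w) = (\<Sum>i<d. (\<rho> v * \<rho> w) $$ (i, i))" using that by (simp add: \<chi>_def comp_mem)
    also have "\<dots> = (\<Sum>i<d. \<Sum>k<d. \<rho> v $$ (i, k) * \<rho> w $$ (k, i))"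
      using carrier[OF that(1)] carrier[OF that(2)]
      by (intro sum.cong refl) (auto simp: scalar_prod_def lessThan_atLeast0 intro!: sum.cong)
    finally show ?thesis .
  qed
  have trace_commute: "\<chi> (v \<circ> w) = \<chi> (w \<circ> v)" if "v \<in> G" "w \<in> G" for v w
    unfolding trace_comp[OF that] trace_comp[OF that(2,1)]
    by (subst sum.swap) (simp add: mult.commute)
  fix u h assume u: "u \<in> G" and h: "h \<in> G"
  have "\<chi> (u \<circ> h \<circ> inv u) = \<chi> (inv u \<circ> (u \<circ> h))"
    by (rule trace_commute[OF comp_mem[OF u h] inv_mem[OF u]])
  also have "inv u \<circ> (u \<circ> h) = h" using u by (simp add: fun_eq_iff inv_apply)
  finally show "\<chi> (u \<circ> h \<circ> inv u) = \<chi> h" .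
qed

lemma class_function_irreducible_character:
  "irreducible_character G \<chi> \<Longrightarrow> class_function G \<chi>"
  unfolding irreducible_character_def irreducible_representation_def
  using class_function_trace by blast

end

section \<open>The hyperoctahedral group\<close>

abbreviation signed_letters :: "nat \<Rightarrow> int set" where
  "signed_letters n \<equiv> {- int n..int n} - {0}"

lemma signed_letters_iff: "x \<in> signed_letters n \<longleftrightarrow> \<bar>x\<bar> \<in> {1..int n}"
  by auto

lemma card_signed_letters: "card (signed_letters n) = 2 * n"
  by (simp add: card_Diff_singleton)

definition unsigned :: "(int \<Rightarrow> int) \<Rightarrow> int \<Rightarrow> int" where
  "unsigned w i = sgn i * \<bar>w i\<bar>"

definition odd_extension :: "nat \<Rightarrow> (int \<Rightarrow> int) \<Rightarrow> int \<Rightarrow> int" where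
  "odd_extension n f i = (if \<bar>i\<bar> \<in> {1..int n} then sgn i * f \<bar>i\<bar> else i)"

lemma signed_perms_permutes: "w \<in> signed_perms n \<Longrightarrow> w permutes signed_letters n"
  and signed_perms_uminus: "w \<in> signed_perms n \<Longrightarrow> w (- i) = - w i"
  by (simp_all add: signed_perms_def)

lemma signed_perms_inj: "w \<in> signed_perms n \<Longrightarrow> inj w"
  by (rule permutes_inj[OF signed_perms_permutes])

lemma signed_perms_inj_on: "w \<in> signed_perms n \<Longrightarrow> inj_on w A"
  using signed_perms_inj inj_on_subset by blast

lemma signed_perms_0: "w \<in> signed_perms n \<Longrightarrow> w 0 = 0"
  using signed_perms_uminus[of w n 0] by simp

lemma signed_perms_eq_0_iff: "w \<in> signed_perms n \<Longrightarrow> w i = 0 \<longleftrightarrow> i = 0"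
  using inj_eq[OF signed_perms_inj, of w n i 0] signed_perms_0 by auto

lemma signed_perms_abs_mem_iff: "w \<in> signed_perms n \<Longrightarrow> \<bar>w i\<bar> \<in> {1..int n} \<longleftrightarrow> \<bar>i\<bar> \<in> {1..int n}"
  using permutes_in_image[OF signed_perms_permutes] unfolding signed_letters_iff .

lemma signed_perms_outside: "w \<in> signed_perms n \<Longrightarrow> \<bar>i\<bar> \<notin> {1..int n} \<Longrightarrow> w i = i"
  using permutes_not_in[OF signed_perms_permutes] unfolding signed_letters_iff .

lemma signed_perms_abs: "w \<in> signed_perms n \<Longrightarrow> \<bar>w \<bar>i\<bar>\<bar> = \<bar>w i\<bar>"
  by (simp add: abs_if signed_perms_uminus)

lemma signed_perms_sgn_mult: "w \<in> signed_perms n \<Longrightarrow> w (sgn x * i) = sgn x * w i"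
  using signed_perms_uminus signed_perms_0 by (cases x "0::int" rule: linorder_cases) auto

lemma signed_perms_sgn_abs: "w \<in> signed_perms n \<Longrightarrow> w i = sgn i * w \<bar>i\<bar>"
  using signed_perms_sgn_mult[of w n i "\<bar>i\<bar>"] by (simp add: mult_sgn_abs)

lemma signed_perms_permutation: "w \<in> signed_perms n \<Longrightarrow> permutation w"
  unfolding permutation_permutes using signed_perms_permutes by blast

lemma perm_group_signed_perms: "perm_group (signed_perms n)"
proof
  show "finite (signed_perms n)"
    by (rule finite_subset[OF _ finite_permutations[of "signed_letters n"]])
      (auto simp: signed_perms_def)
  show "id \<in> signed_perms n" by (simp add: signed_perms_def permutes_id)
  fix u assume u: "u \<in> signed_perms n"
  note p = signed_perms_permutes[OF u]
  show "bij u" by (rule permutes_bij[OF p])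
  show "u \<circ> v \<in> signed_perms n" if "v \<in> signed_perms n" for v
    using u that by (auto simp: signed_perms_def intro: permutes_compose)
  have "inv u (- i) = - inv u i" for i
    using permutes_inverses[OF p] signed_perms_uminus[OF u] by (metis permutes_inv_eq[OF p])
  then show "inv u \<in> signed_perms n" using permutes_inv[OF p] by (simp add: signed_perms_def)
qed

interpretation signed_perms: perm_group "signed_perms n" for n
  by (rule perm_group_signed_perms)

lemma odd_extension_apply: "i \<in> {1..int n} \<Longrightarrow> odd_extension n f i = f i"
  by (simp add: odd_extension_def)

lemma odd_extension_mem_signed_perms:
  assumes into: "\<And>i. i \<in> {1..int n} \<Longrightarrow> \<bar>f i\<bar> \<in> {1..int n}" and inj: "inj_on (\<lambda>i. \<bar>f i\<bar>) {1..int n}"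
  shows "odd_extension n f \<in> signed_perms n"
proof -
  let ?S = "signed_letters n"
  have "odd_extension n f ` ?S \<subseteq> ?S"
  proof (rule image_subsetI)
    fix x assume "x \<in> ?S"
    then have x: "\<bar>x\<bar> \<in> {1..int n}" by (simp only: signed_letters_iff)
    then have "\<bar>odd_extension n f x\<bar> = \<bar>f \<bar>x\<bar>\<bar>" by (auto simp: odd_extension_def abs_mult)
    then show "odd_extension n f x \<in> ?S" using into[OF x] by (simp only: signed_letters_iff)
  qed
  moreover have "inj_on (odd_extension n f) ?S"
  proof (rule inj_onI)
    fix x y assume "x \<in> ?S" "y \<in> ?S" and eq: "odd_extension n f x = odd_extension n f y"
    then have xy: "\<bar>x\<bar> \<in> {1..int n}" "\<bar>y\<bar> \<in> {1..int n}" by (simp_all only: signed_letters_iff)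
    then have sgn_eq: "sgn x * f \<bar>x\<bar> = sgn y * f \<bar>y\<bar>" using eq by (simp add: odd_extension_def)
    then have "\<bar>f \<bar>x\<bar>\<bar> = \<bar>f \<bar>y\<bar>\<bar>" using xy by (auto simp: sgn_if split: if_splits)
    then have abs_eq: "\<bar>x\<bar> = \<bar>y\<bar>" using inj_onD[OF inj _ xy] by simp
    moreover have "f \<bar>x\<bar> \<noteq> 0" using into[OF xy(1)] by auto
    ultimately have "sgn x = sgn y" using sgn_eq by simp
    then show "x = y" using abs_eq by (metis mult_sgn_abs)
  qed
  ultimately have "bij_betw (odd_extension n f) ?S ?S" by (simp add: bij_betw_def endo_inj_surj)
  then have "odd_extension n f permutes ?S"
    by (rule bij_imp_permutes) (auto simp: odd_extension_def)
  moreover have "odd_extension n f (- i) = - odd_extension n f i" for i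
    by (auto simp: odd_extension_def)
  ultimately show ?thesis by (simp add: signed_perms_def)
qed

lemma signed_perms_eqI:
  assumes "u \<in> signed_perms n" "v \<in> signed_perms n" "\<And>i. i \<in> {1..int n} \<Longrightarrow> u i = v i"
  shows "u = v"
proof
  fix i show "u i = v i"
  proof (cases "\<bar>i\<bar> \<in> {1..int n}")
    case True
    then show ?thesis
      using assms signed_perms_sgn_abs[OF assms(1), of i] signed_perms_sgn_abs[OF assms(2), of i]
      by simp
  next
    case False
    then show ?thesis using signed_perms_outside assms(1,2) by metis
  qed
qed

lemma inj_on_abs_signed_perm:
  assumes "w \<in> signed_perms n" shows "inj_on (\<lambda>i. \<bar>w i\<bar>) {1..int n}"
proof (rule inj_onI)
  fix x y assume xy: "x \<in> {1..int n}" "y \<in> {1..int n}" "\<bar>w x\<bar> = \<bar>w y\<bar>"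
  then have "w x = w y \<or> w x = w (- y)"
    using signed_perms_uminus[OF assms] by (auto simp: abs_eq_iff)
  then have "x = y \<or> x = - y" using signed_perms_inj[OF assms] by (auto dest: injD)
  then show "x = y" using xy by auto
qed

lemma abs_image_signed_perm:
  assumes "w \<in> signed_perms n" shows "(\<lambda>i. \<bar>w i\<bar>) ` {1..int n} = {1..int n}"
  using inj_on_abs_signed_perm[OF assms] signed_perms_abs_mem_iff[OF assms]
  by (intro endo_inj_surj) auto

lemma unsigned_pos_eq: "0 < i \<Longrightarrow> unsigned w i = \<bar>w i\<bar>"
  by (simp add: unsigned_def)

lemma abs_unsigned: "w \<in> signed_perms n \<Longrightarrow> \<bar>unsigned w i\<bar> = \<bar>w i\<bar>"
  using signed_perms_0 by (auto simp: unsigned_def abs_mult sgn_if)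

lemma unsigned_mem_signed_perms:
  assumes "w \<in> signed_perms n" shows "unsigned w \<in> signed_perms n"
proof -
  have "unsigned w = odd_extension n (\<lambda>i. \<bar>w i\<bar>)"
    using signed_perms_outside[OF assms] signed_perms_abs[OF assms]
    by (auto simp: unsigned_def odd_extension_def fun_eq_iff mult_sgn_abs)
  then show ?thesis
    using odd_extension_mem_signed_perms[of n "\<lambda>i. \<bar>w i\<bar>"] inj_on_abs_signed_perm[OF assms]
      signed_perms_abs_mem_iff[OF assms] by auto
qed

lemma unsigned_comp:
  assumes "u \<in> signed_perms n" "v \<in> signed_perms n"
  shows "unsigned (u \<circ> v) = unsigned u \<circ> unsigned v"
proof
  fix i
  have "sgn (unsigned v i) = sgn i"
    using signed_perms_eq_0_iff[OF assms(2), of i]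
    by (auto simp: unsigned_def sgn_mult sgn_if)
  moreover have "\<bar>u (unsigned v i)\<bar> = \<bar>u (v i)\<bar>"
    by (metis signed_perms_abs[OF assms(1)] abs_unsigned[OF assms(2)])
  ultimately show "unsigned (u \<circ> v) i = (unsigned u \<circ> unsigned v) i"
    by (simp add: unsigned_def)
qed

lemma unsigned_id: "unsigned id = id"
  by (auto simp: unsigned_def mult_sgn_abs)

lemma unsigned_inv:
  assumes "u \<in> signed_perms n" shows "unsigned (inv u) = inv (unsigned u)"
proof -
  have "unsigned (inv u) \<circ> unsigned u = id"
    using unsigned_comp[OF signed_perms.inv_mem[OF assms] assms]
    by (simp add: signed_perms.inv_comp[OF assms] unsigned_id)
  then show ?thesis
    using signed_perms.comp_inv[OF unsigned_mem_signed_perms[OF assms]]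
    by (metis comp_assoc comp_id id_comp)
qed

lemma unsigned_inj_on: "w \<in> signed_perms n \<Longrightarrow> inj_on (unsigned w) A"
  by (rule signed_perms_inj_on[OF unsigned_mem_signed_perms])

lemma unsigned_image: "w \<in> signed_perms n \<Longrightarrow> unsigned w ` {1..int n} = {1..int n}"
  using abs_image_signed_perm by (simp add: unsigned_pos_eq)

lemma unsigned_mem: "w \<in> signed_perms n \<Longrightarrow> i \<in> {1..int n} \<Longrightarrow> unsigned w i \<in> {1..int n}"
  using unsigned_image by blast

lemma signed_perms_sgn_unsigned: "0 < i \<Longrightarrow> w i = sgn (w i) * unsigned w i"
  by (simp add: unsigned_pos_eq sgn_mult_abs)

lemma signed_perms_stabilizer:
  assumes "n \<ge> 1"
  shows "signed_perms (n - 1) = {u \<in> signed_perms n. u (int n) = int n}"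
proof -
  let ?S = "signed_letters n" and ?T = "signed_letters (n - 1)"
  have "u permutes ?T \<longleftrightarrow> u permutes ?S \<and> u (int n) = int n" if odd: "\<forall>i. u (- i) = - u i" for u
  proof
    assume "u permutes ?T"
    then show "u permutes ?S \<and> u (int n) = int n"
      using assms by (intro conjI permutes_subset[of u ?T ?S] permutes_not_in[of u ?T]) auto
  next
    assume u: "u permutes ?S \<and> u (int n) = int n"
    have "u x = x" if "x \<in> ?S - ?T" for x
    proof -
      have "x = int n \<or> x = - int n" using that assms by auto
      then show ?thesis using u odd by auto
    qed
    then show "u permutes ?T" using u permutes_superset[of u ?S ?T] by blast
  qed
  then show ?thesis by (auto simp: signed_perms_def)
qed

lemma signed_perms_orbit:
  assumes "n \<ge> 1" shows "(\<lambda>u. u (int n)) ` signed_perms n = signed_letters n"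
proof (intro equalityI subsetI)
  fix a assume "a \<in> signed_letters n"
  then have a: "\<bar>a\<bar> \<in> {1..int n}" by (simp only: signed_letters_iff)
  define u where "u = odd_extension n (\<lambda>i. if i = int n then a else if i = \<bar>a\<bar> then int n else i)"
  have "u \<in> signed_perms n"
    unfolding u_def using a assms
    by (intro odd_extension_mem_signed_perms inj_onI) (auto split: if_splits)
  moreover have "u (int n) = a" using assms by (simp add: u_def odd_extension_apply)
  ultimately show "a \<in> (\<lambda>u. u (int n)) ` signed_perms n" by blast
next
  fix a assume "a \<in> (\<lambda>u. u (int n)) ` signed_perms n"
  then show "a \<in> signed_letters n"
    unfolding signed_letters_iff using assms signed_perms_abs_mem_iff by fastforce
qed

lemma card_signed_perms: "card (signed_perms n) = 2 ^ n * fact n"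
proof (induction n)
  case 0
  have "signed_perms 0 = {id}"
    using signed_perms.id_mem signed_perms_eqI[of _ 0] by auto
  then show ?case by simp
next
  case (Suc n)
  have "card (signed_perms (Suc n)) = card (signed_letters (Suc n)) * card (signed_perms n)"
    using signed_perms.card_image_point_filter[of "Suc n" "\<lambda>_. True" "int (Suc n)"]
      signed_perms_orbit[of "Suc n"] signed_perms_stabilizer[of "Suc n"]
    by (simp del: of_nat_Suc Diff_iff)
  then have "card (signed_perms (Suc n)) = 2 * Suc n * card (signed_perms n)"
    by (simp only: card_signed_letters)
  then show ?case using Suc by (simp add: algebra_simps)
qed

section \<open>Inversion signs and the exterior algebra\<close>

definition inv_sign :: "('a :: linordered_idom \<Rightarrow> 'a) \<Rightarrow> 'a set \<Rightarrow> 'a" where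
  "inv_sign a I = (\<Prod>i\<in>I. \<Prod>j\<in>I. if i < j then sgn (a j - a i) else 1)"

definition ext_sign :: "(int \<Rightarrow> int) \<Rightarrow> int set \<Rightarrow> int" where
  "ext_sign w I = (\<Prod>i\<in>I. sgn (w i)) * inv_sign (unsigned w) I"

lemma sgn_mult_sgn_self: "x \<noteq> 0 \<Longrightarrow> sgn x * sgn x = (1 :: 'a :: linordered_idom)"
  by (simp add: sgn_if)

lemma inv_sign_cong: "(\<And>i. i \<in> I \<Longrightarrow> a i = b i) \<Longrightarrow> inv_sign a I = inv_sign b I"
  unfolding inv_sign_def by (intro prod.cong refl) simp

lemma inv_sign_fixed: "(\<And>i. i \<in> I \<Longrightarrow> a i = i) \<Longrightarrow> inv_sign a I = 1"
  unfolding inv_sign_def by (intro prod.neutral ballI) auto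

lemma inv_sign_insert:
  assumes "finite I" "x \<notin> I"
  shows "inv_sign a (insert x I) = inv_sign a I * (\<Prod>i\<in>I. sgn ((a i - a x) * (i - x)))"
proof -
  have "sgn ((a i - a x) * (i - x))
      = (if i < x then sgn (a x - a i) else 1) * (if x < i then sgn (a i - a x) else 1)"
    if "i \<in> I" for i
    using that assms(2)
    by (cases i x rule: linorder_cases) (auto simp: sgn_if mult_less_0_iff zero_less_mult_iff)
  then have "(\<Prod>i\<in>I. sgn ((a i - a x) * (i - x)))
      = (\<Prod>i\<in>I. if i < x then sgn (a x - a i) else 1)
        * (\<Prod>i\<in>I. if x < i then sgn (a i - a x) else 1)"
    by (simp add: prod.distrib)
  then show ?thesis using assms by (simp add: inv_sign_def prod.distrib)
qed

lemma inv_sign_comp: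
  assumes "finite I" "inj_on c I"
  shows "inv_sign (a \<circ> c) I = inv_sign a (c ` I) * inv_sign c I"
  using assms
proof (induction I rule: finite_induct)
  case (insert x I)
  have c_x: "c x \<notin> c ` I" and inj: "inj_on c I" using insert by auto
  have "(\<Prod>i\<in>I. sgn (((a \<circ> c) i - (a \<circ> c) x) * (i - x)))
      = (\<Prod>i\<in>I. sgn ((a (c i) - a (c x)) * (c i - c x)) * sgn ((c i - c x) * (i - x)))"
  proof (rule prod.cong[OF refl])
    fix i assume "i \<in> I"
    then have "c i - c x \<noteq> 0" using c_x by (metis imageI eq_iff_diff_eq_0)
    then show "sgn (((a \<circ> c) i - (a \<circ> c) x) * (i - x))
      = sgn ((a (c i) - a (c x)) * (c i - c x)) * sgn ((c i - c x) * (i - x))"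
      using sgn_mult_sgn_self[of "c i - c x"] by (simp add: sgn_mult)
  qed
  also have "\<dots> = (\<Prod>i\<in>c ` I. sgn ((a i - a (c x)) * (i - c x)))
      * (\<Prod>i\<in>I. sgn ((c i - c x) * (i - x)))"
    by (simp add: prod.distrib prod.reindex[OF inj])
  finally have "(\<Prod>i\<in>I. sgn (((a \<circ> c) i - (a \<circ> c) x) * (i - x))) = \<dots>" .
  then show ?case
    unfolding image_insert inv_sign_insert[OF insert(1,2)]
      inv_sign_insert[OF finite_imageI[OF insert(1)] c_x] insert.IH[OF inj]
    by (simp only: ac_simps)
qed (simp add: inv_sign_def)

lemma inv_sign_Un:
  assumes "finite A" "finite B" "A \<inter> B = {}"
  shows "inv_sign a (A \<union> B)
    = inv_sign a A * inv_sign a B * (\<Prod>x\<in>A. \<Prod>y\<in>B. sgn ((a y - a x) * (y - x)))"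
  using assms
proof (induction A rule: finite_induct)
  case (insert x A)
  have "inv_sign a (insert x A \<union> B)
      = inv_sign a (A \<union> B) * (\<Prod>i\<in>A \<union> B. sgn ((a i - a x) * (i - x)))"
    using insert by (simp add: inv_sign_insert)
  also have "(\<Prod>i\<in>A \<union> B. sgn ((a i - a x) * (i - x)))
      = (\<Prod>i\<in>A. sgn ((a i - a x) * (i - x))) * (\<Prod>i\<in>B. sgn ((a i - a x) * (i - x)))"
    using insert by (intro prod.union_disjoint) auto
  finally show ?case using insert by (simp add: inv_sign_insert ac_simps)
qed (simp add: inv_sign_def)

lemma inv_sign_Un_invariant:
  assumes "finite A" "finite B" "A \<inter> B = {}" "a ` A = A" "a ` B = B"
  shows "inv_sign a (A \<union> B) = inv_sign a A * inv_sign a B"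
proof -
  have inj: "inj_on a A" "inj_on a B" using assms by (auto intro: eq_card_imp_inj_on)
  have "(\<Prod>x\<in>A. \<Prod>y\<in>B. sgn (a y - a x)) = (\<Prod>x\<in>a ` A. \<Prod>y\<in>a ` B. sgn (y - x))"
    by (simp add: prod.reindex[OF inj(1)] prod.reindex[OF inj(2)])
  then have "(\<Prod>x\<in>A. \<Prod>y\<in>B. sgn ((a y - a x) * (y - x)))
      = (\<Prod>x\<in>A. \<Prod>y\<in>B. sgn (y - x) * sgn (y - x))"
    using assms by (simp only: sgn_mult prod.distrib)
  also have "\<dots> = 1"
    using assms(3) by (intro prod.neutral ballI sgn_mult_sgn_self) auto
  finally show ?thesis using inv_sign_Un[OF assms(1-3)] by simp
qed

lemma inv_sign_transpose:
  assumes "finite I" "p \<in> I" "q \<in> I" "p \<noteq> q"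
  shows "inv_sign (transpose p q) I = - 1"
proof -
  define J where "J = I - {p, q}"
  have J: "I = insert p (insert q J)" "p \<notin> insert q J" "q \<notin> J" "finite J" "p \<notin> J"
    using assms by (auto simp: J_def)
  let ?t = "transpose p q"
  have fixed: "?t i = i" if "i \<in> J" for i using that J by (intro transpose_apply_other) auto
  then have sign_J: "inv_sign ?t J = 1" by (rule inv_sign_fixed)
  have cross: "(\<Prod>i\<in>J. sgn ((?t i - ?t q) * (i - q))) * (\<Prod>i\<in>J. sgn ((?t i - ?t p) * (i - p))) = 1"
    unfolding prod.distrib[symmetric]
  proof (intro prod.neutral ballI)
    fix i assume i: "i \<in> J"
    then have "i \<noteq> p" "i \<noteq> q" using J by auto
    then show "sgn ((?t i - ?t q) * (i - q)) * sgn ((?t i - ?t p) * (i - p)) = 1"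
      using fixed[OF i] by (auto simp: sgn_mult sgn_if mult.commute)
  qed
  have swap: "sgn ((?t q - ?t p) * (q - p)) = - 1"
    using assms
    by (cases p q rule: linorder_cases) (auto simp: sgn_if mult_less_0_iff zero_less_mult_iff)
  have "inv_sign ?t I = inv_sign ?t J * (\<Prod>i\<in>J. sgn ((?t i - ?t q) * (i - q)))
      * (sgn ((?t q - ?t p) * (q - p)) * (\<Prod>i\<in>J. sgn ((?t i - ?t p) * (i - p))))"
    unfolding J(1) using J(2-5)
    by (simp only: inv_sign_insert finite_insert prod.insert mult.assoc simp_thms)
  also have "\<dots> = - 1" unfolding sign_J swap using cross by simp
  finally show ?thesis .
qed

lemma inv_sign_cycle_of_list:
  "distinct cs \<Longrightarrow> inv_sign (cycle_of_list cs) (set cs) = (- 1) ^ (length cs - 1)"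
proof (induction cs rule: cycle_of_list.induct)
  case (1 i j cs)
  let ?c = "cycle_of_list (j # cs)" and ?I = "set (j # cs)"
  have perm: "?c permutes ?I" by (rule cycle_permutes)
  have fix_i: "?c i = i" using perm 1(2) by (intro permutes_not_in) auto
  have inj: "inj_on ?c A" for A using permutes_inj[OF perm] inj_on_subset by blast
  have image: "?c ` insert i ?I = insert i ?I" using permutes_image[OF perm] fix_i by simp
  have "inv_sign ?c ({i} \<union> ?I) = inv_sign ?c {i} * inv_sign ?c ?I"
    using 1(2) fix_i permutes_image[OF perm] by (intro inv_sign_Un_invariant) auto
  also have "inv_sign ?c {i} = 1" using fix_i by (intro inv_sign_fixed) simp
  also have "inv_sign ?c ?I = (- 1) ^ (length (j # cs) - 1)" using 1 by simp
  finally have tail: "inv_sign ?c (insert i ?I) = (- 1) ^ (length (j # cs) - 1)"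
    by (simp add: insert_commute)
  have "inv_sign (transpose i j \<circ> ?c) (insert i ?I)
      = inv_sign (transpose i j) (?c ` insert i ?I) * inv_sign ?c (insert i ?I)"
    by (rule inv_sign_comp[OF _ inj]) simp
  also have "inv_sign (transpose i j) (?c ` insert i ?I) = - 1"
    unfolding image using 1(2) by (intro inv_sign_transpose) auto
  finally show ?case using tail by simp
qed (auto simp: inv_sign_def)

lemma orbit_eq_set_support:
  assumes "permutation p" shows "orbit p x = set (support p x)"
proof -
  have "orbit p x = {(p ^^ k) x |k. True}" using orbit_altdef_permutation[OF assms] by simp
  moreover have "(p ^^ k) x \<in> set (support p x)" for k
    using support_set[OF assms, of x] by auto
  ultimately show ?thesis by fastforce
qed

lemma inv_sign_orbit:
  assumes "permutation p" shows "inv_sign p (orbit p x) = (- 1) ^ (card (orbit p x) - 1)"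
proof -
  note orbit = orbit_eq_set_support[OF assms, of x]
  have distinct: "distinct (support p x)" by (rule cycle_of_permutation[OF assms])
  have "inv_sign p (orbit p x) = inv_sign (cycle_of_list (support p x)) (set (support p x))"
    unfolding orbit by (rule inv_sign_cong) (use cycle_restrict[OF assms] in blast)
  also have "\<dots> = (- 1) ^ (length (support p x) - 1)"
    by (rule inv_sign_cycle_of_list[OF distinct])
  also have "length (support p x) = card (orbit p x)"
    unfolding orbit by (rule distinct_card[OF distinct, symmetric])
  finally show ?thesis .
qed

lemma ext_sign_comp:
  assumes "u \<in> signed_perms n" "v \<in> signed_perms n" "I \<subseteq> {1..int n}"
  shows "ext_sign (u \<circ> v) I = ext_sign u (unsigned v ` I) * ext_sign v I"
proof -
  have finite: "finite I" using assms(3) finite_subset by blast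
  note inj = unsigned_inj_on[OF assms(2), of I]
  have "(\<Prod>i\<in>I. sgn ((u \<circ> v) i)) = (\<Prod>i\<in>I. sgn (u (unsigned v i)) * sgn (v i))"
  proof (rule prod.cong[OF refl])
    fix i assume "i \<in> I"
    then have "i > 0" using assms(3) by auto
    then have "u (v i) = sgn (v i) * u (unsigned v i)"
      using signed_perms_sgn_unsigned[of i v] signed_perms_sgn_mult[OF assms(1)] by metis
    then show "sgn ((u \<circ> v) i) = sgn (u (unsigned v i)) * sgn (v i)"
      by (simp add: sgn_mult mult.commute)
  qed
  also have "\<dots> = (\<Prod>i\<in>unsigned v ` I. sgn (u i)) * (\<Prod>i\<in>I. sgn (v i))"
    by (simp add: prod.distrib prod.reindex[OF inj])
  finally show ?thesis
    unfolding ext_sign_def unsigned_comp[OF assms(1,2)] inv_sign_comp[OF finite inj]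
    by (simp add: ac_simps)
qed

lemma ext_sign_fixed:
  "(\<And>i. i \<in> I \<Longrightarrow> unsigned w i = i) \<Longrightarrow> ext_sign w I = (\<Prod>i\<in>I. sgn (w i))"
  by (simp add: ext_sign_def inv_sign_fixed)

lemma ext_sign_id: "I \<subseteq> {1..int m} \<Longrightarrow> ext_sign id I = 1"
  by (auto simp: ext_sign_fixed unsigned_id intro!: prod.neutral)

lemma ext_sign_nonzero:
  assumes "w \<in> signed_perms m" "I \<subseteq> {1..int m}" shows "ext_sign w I \<noteq> 0"
proof
  assume "ext_sign w I = 0"
  then have "ext_sign (inv w \<circ> w) I = 0"
    using ext_sign_comp[OF signed_perms.inv_mem[OF assms(1)] assms] by simp
  then show False using signed_perms.inv_comp[OF assms(1)] ext_sign_id[OF assms(2)] by simp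
qed

lemma prod_sgn_diff:
  fixes y :: "'a :: linordered_idom"
  assumes "finite K" "y \<notin> K"
  shows "(\<Prod>k\<in>K. sgn (k - y)) = (- 1) ^ card {k \<in> K. k < y}"
  using assms
proof (induction K rule: finite_induct)
  case (insert x K)
  have "{k \<in> insert x K. k < y} = (if x < y then insert x {k \<in> K. k < y} else {k \<in> K. k < y})"
    by auto
  then show ?case using insert by (auto simp: sgn_if)
qed simp

lemma wedge_basis:
  assumes "finite K" "y \<notin> K"
  shows "wedge (\<lambda>J. b * ext_basis {y} J) (\<lambda>J. c * ext_basis K J)
    = (\<lambda>J. b * c * (- 1) ^ card {k \<in> K. k < y} * ext_basis (insert y K) J)"
proof
  fix J
  let ?inversions = "\<lambda>I :: int set. {(i, j). i \<in> I \<and> j \<in> J - I \<and> j < i}"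
  let ?term = "\<lambda>I. (- 1) ^ card (?inversions I) * (b * ext_basis {y} I) * (c * ext_basis K (J - I))"
  show "wedge (\<lambda>J. b * ext_basis {y} J) (\<lambda>J. c * ext_basis K J) J
    = b * c * (- 1) ^ card {k \<in> K. k < y} * ext_basis (insert y K) J"
  proof (cases "J = insert y K")
    case True
    have "(\<Sum>I\<in>Pow J. ?term I) = (\<Sum>I\<in>{{y}}. ?term I)"
      by (rule sum.mono_neutral_right) (use True assms in \<open>auto simp: ext_basis_def\<close>)
    moreover have "?inversions {y} = (\<lambda>k. (y, k)) ` {k \<in> K. k < y}"
      using True assms by auto
    then have "card (?inversions {y}) = card {k \<in> K. k < y}"
      by (simp add: card_image inj_on_def)
    ultimately show ?thesis using True assms by (simp add: wedge_def ext_basis_def)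
  next
    case False
    then have "?term I = 0" if "I \<in> Pow J" for I
      using that by (auto simp: ext_basis_def)
    then have "(\<Sum>I\<in>Pow J. ?term I) = 0" by (intro sum.neutral) blast
    then show ?thesis using False by (simp add: wedge_def ext_basis_def)
  qed
qed

lemma foldr_wedge_vec_act:
  assumes "w \<in> signed_perms n" "sorted_wrt (<) xs" "set xs \<subseteq> {1..int n}"
  shows "foldr wedge (map (vec_act w) xs) (ext_basis {})
    = (\<lambda>J. of_int (ext_sign w (set xs)) * ext_basis (unsigned w ` set xs) J)"
  using assms(2,3)
proof (induction xs)
  case Nil
  then show ?case by (simp add: ext_sign_def inv_sign_def)
next
  case (Cons x xs)
  let ?I = "set xs" and ?u = "unsigned w"
  have x: "x > 0" "x \<notin> ?I" "\<And>i. i \<in> ?I \<Longrightarrow> x < i" using Cons.prems by auto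
  have inj: "inj_on ?u A" for A by (rule unsigned_inj_on[OF assms(1)])
  have u_x: "?u x \<notin> ?u ` ?I" using x(2) inj[of UNIV] by (auto dest: injD)
  have "(\<Prod>i\<in>?I. sgn ((?u i - ?u x) * (i - x))) = (\<Prod>i\<in>?I. sgn (?u i - ?u x))"
    using x(3) by (intro prod.cong refl) (auto simp: sgn_mult)
  also have "\<dots> = (\<Prod>k\<in>?u ` ?I. sgn (k - ?u x))"
    by (simp add: prod.reindex[OF inj])
  also have "\<dots> = (- 1) ^ card {k \<in> ?u ` ?I. k < ?u x}"
    using u_x by (intro prod_sgn_diff) auto
  finally have sign: "ext_sign w (insert x ?I)
      = sgn (w x) * ext_sign w ?I * (- 1) ^ card {k \<in> ?u ` ?I. k < ?u x}"
    using x(2) by (simp add: ext_sign_def inv_sign_insert)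
  have "foldr wedge (map (vec_act w) (x # xs)) (ext_basis {})
      = wedge (\<lambda>J. of_int (sgn (w x)) * ext_basis {?u x} J)
          (\<lambda>J. of_int (ext_sign w ?I) * ext_basis (?u ` ?I) J)"
    using Cons x(1) by (simp add: vec_act_def[of w x] unsigned_pos_eq)
  also have "\<dots> = (\<lambda>J. of_int (ext_sign w (insert x ?I)) * ext_basis (insert (?u x) (?u ` ?I)) J)"
    unfolding wedge_basis[OF finite_imageI[OF finite_set] u_x] sign by simp
  finally show ?case by simp
qed

lemma ext_char_eq_sum_ext_sign:
  assumes "w \<in> signed_perms m"
  shows "ext_char m w = of_int (\<Sum>I | I \<subseteq> {1..int m} \<and> unsigned w ` I = I. ext_sign w I)"
proof -
  have "ext_act m w (ext_basis I) I = of_int (if unsigned w ` I = I then ext_sign w I else 0)"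
    if I: "I \<in> Pow {1..int m}" for I
  proof -
    have finite: "finite I" using I finite_subset by blast
    have "ext_act m w (ext_basis I) I = (\<Sum>I'\<in>{I}. ext_basis I I'
          * foldr wedge (map (vec_act w) (sorted_list_of_set I')) (ext_basis {}) I)"
      unfolding ext_act_def
      by (rule sum.mono_neutral_right) (use I in \<open>auto simp: ext_basis_def\<close>)
    also have "\<dots> = of_int (ext_sign w I) * ext_basis (unsigned w ` I) I"
      using foldr_wedge_vec_act[OF assms, of "sorted_list_of_set I"] I finite
      by (simp add: ext_basis_def)
    finally show ?thesis by (auto simp: ext_basis_def)
  qed
  then have "ext_char m w
      = of_int (\<Sum>I\<in>Pow {1..int m}. if unsigned w ` I = I then ext_sign w I else 0)"
    using assms by (simp add: ext_char_def)
  also have "(\<Sum>I\<in>Pow {1..int m}. if unsigned w ` I = I then ext_sign w I else 0)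
      = (\<Sum>I\<in>{I \<in> Pow {1..int m}. unsigned w ` I = I}. ext_sign w I)"
    by (rule sum.inter_filter[symmetric]) simp
  finally show ?thesis by (simp add: Pow_def Collect_conj_eq)
qed

section \<open>Signed cycle types\<close>

lemma orbit_eq_range: "permutation p \<Longrightarrow> orbit p x = range (\<lambda>k. (p ^^ k) x)"
  by (simp add: orbit_altdef_permutation full_SetCompr_eq)

lemma orbit_eq_of_mem: "permutation p \<Longrightarrow> y \<in> orbit p x \<Longrightarrow> orbit p y = orbit p x"
  by (rule orbit_cyclic_eq3[OF cyclic_on_orbit'])

lemma orbit_apply: "permutation p \<Longrightarrow> orbit p (p x) = orbit p x"
  by (rule orbit_eq_of_mem[OF _ orbit.base])

lemma orbit_subset_of_image_subset:
  assumes "p ` A \<subseteq> A" "x \<in> A" shows "orbit p x \<subseteq> A"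
proof
  fix y assume "y \<in> orbit p x"
  then show "y \<in> A" by (induction rule: orbit.induct) (use assms in auto)
qed

lemma image_orbit:
  assumes "permutation p" shows "p ` orbit p x = orbit p x"
proof -
  have "inj p" using assms by (simp add: permutation_bijective bij_is_inj)
  moreover have "p ` orbit p x \<subseteq> orbit p x" by (auto intro: orbit.step)
  moreover have "finite (orbit p x)"
    using assms by (intro finite_orbit permutation_self_in_orbit)
  ultimately show ?thesis by (meson endo_inj_surj inj_on_subset subset_UNIV)
qed

lemma Union_orbits:
  assumes "permutation p" "p ` A \<subseteq> A" shows "\<Union>(orbit p ` A) = A"
  using orbit_subset_of_image_subset[OF assms(2)] permutation_self_in_orbit[OF assms(1)] by blast

lemma bij_betw_Union_orbits:
  assumes "permutation p" "p ` A \<subseteq> A"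
  shows "bij_betw Union (Pow (orbit p ` A)) {I. I \<subseteq> A \<and> p ` I = I}"
proof (rule bij_betw_byWitness[where f' = "\<lambda>I. orbit p ` I"])
  show "\<forall>Q\<in>Pow (orbit p ` A). orbit p ` \<Union>Q = Q"
  proof
    fix Q assume "Q \<in> Pow (orbit p ` A)"
    then have Q: "Q \<subseteq> orbit p ` A" by simp
    have eq_orbit: "orbit p x = b" if "b \<in> Q" "x \<in> b" for b x
      using that Q orbit_eq_of_mem[OF assms(1)] by blast
    show "orbit p ` \<Union>Q = Q"
    proof (intro equalityI subsetI)
      fix b assume "b \<in> orbit p ` \<Union>Q"
      then show "b \<in> Q" by (elim imageE UnionE) (simp add: eq_orbit)
    next
      fix b assume b: "b \<in> Q"
      then obtain x where x: "x \<in> b" using Q permutation_self_in_orbit[OF assms(1)] by blast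
      then have "x \<in> \<Union>Q" using b by blast
      then show "b \<in> orbit p ` \<Union>Q" by (rule rev_image_eqI) (simp add: eq_orbit[OF b x])
    qed
  qed
  show "\<forall>I\<in>{I. I \<subseteq> A \<and> p ` I = I}. \<Union>(orbit p ` I) = I"
    by (intro ballI Union_orbits[OF assms(1)]) simp
  show "Union ` Pow (orbit p ` A) \<subseteq> {I. I \<subseteq> A \<and> p ` I = I}"
  proof (rule image_subsetI)
    fix Q assume "Q \<in> Pow (orbit p ` A)"
    then have Q: "Q \<subseteq> orbit p ` A" by simp
    then have "p ` b = b" if "b \<in> Q" for b using that image_orbit[OF assms(1)] by auto
    then have "p ` \<Union>Q = \<Union>Q" by (simp add: image_Union)
    moreover have "\<Union>Q \<subseteq> A" using Union_mono[OF Q] by (simp only: Union_orbits[OF assms])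
    ultimately show "\<Union>Q \<in> {I. I \<subseteq> A \<and> p ` I = I}" by simp
  qed
  show "(`) (orbit p) ` {I. I \<subseteq> A \<and> p ` I = I} \<subseteq> Pow (orbit p ` A)"
    by (rule image_subsetI) (simp add: image_mono)
qed

lemma
  assumes "permutation p"
  shows inj_on_funpow_least_power: "inj_on (\<lambda>t. (p ^^ t) x) {..<least_power p x}"
    and funpow_image_least_power: "(\<lambda>t. (p ^^ t) x) ` {..<least_power p x} = orbit p x"
    and card_orbit: "card (orbit p x) = least_power p x"
proof -
  have "distinct (map (\<lambda>t. (p ^^ t) x) [0..<least_power p x])"
    by (rule cycle_of_permutation[OF assms])
  then show inj: "inj_on (\<lambda>t. (p ^^ t) x) {..<least_power p x}"
    by (simp add: distinct_map atLeast0LessThan)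
  show image: "(\<lambda>t. (p ^^ t) x) ` {..<least_power p x} = orbit p x"
    unfolding orbit_eq_set_support[OF assms] by (simp add: atLeast0LessThan)
  show "card (orbit p x) = least_power p x" using card_image[OF inj] image by simp
qed

definition abs_cycles :: "nat \<Rightarrow> (int \<Rightarrow> int) \<Rightarrow> int set set" where
  "abs_cycles n w = orbit (unsigned w) ` {1..int n}"

definition cycle_sign :: "(int \<Rightarrow> int) \<Rightarrow> int set \<Rightarrow> int" where
  "cycle_sign w b = (\<Prod>i\<in>b. sgn (w i))"

definition pos_abs_cycles :: "nat \<Rightarrow> (int \<Rightarrow> int) \<Rightarrow> int set set" where
  "pos_abs_cycles n w = {b \<in> abs_cycles n w. cycle_sign w b = 1}"

definition neg_abs_cycles :: "nat \<Rightarrow> (int \<Rightarrow> int) \<Rightarrow> int set set" where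
  "neg_abs_cycles n w = {b \<in> abs_cycles n w. cycle_sign w b = - 1}"

lemma unsigned_permutation: "w \<in> signed_perms n \<Longrightarrow> permutation (unsigned w)"
  by (rule signed_perms_permutation[OF unsigned_mem_signed_perms])

lemma orbit_mem_abs_cycles: "x \<in> {1..int n} \<Longrightarrow> orbit (unsigned w) x \<in> abs_cycles n w"
  by (simp add: abs_cycles_def)

lemma finite_abs_cycles: "finite (abs_cycles n w)"
  by (simp add: abs_cycles_def)

lemma card_abs_cycles_le: "card (abs_cycles n w) \<le> n"
  using card_image_le[of "{1..int n}" "orbit (unsigned w)"] by (simp add: abs_cycles_def)

context
  fixes n w
  assumes w: "w \<in> signed_perms n"
begin

lemma self_mem_orbit_unsigned: "x \<in> orbit (unsigned w) x"
  by (rule permutation_self_in_orbit[OF unsigned_permutation[OF w]])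

lemma Union_abs_cycles: "\<Union>(abs_cycles n w) = {1..int n}"
  unfolding abs_cycles_def
  by (rule Union_orbits[OF unsigned_permutation[OF w]]) (simp add: unsigned_image[OF w])

lemma abs_cycle_subset: "b \<in> abs_cycles n w \<Longrightarrow> b \<subseteq> {1..int n}"
  using Union_abs_cycles by blast

lemma finite_abs_cycle: "b \<in> abs_cycles n w \<Longrightarrow> finite b"
  using abs_cycle_subset finite_subset by blast

lemma orbit_eq_abs_cycle: "b \<in> abs_cycles n w \<Longrightarrow> x \<in> b \<Longrightarrow> orbit (unsigned w) x = b"
  unfolding abs_cycles_def using orbit_eq_of_mem[OF unsigned_permutation[OF w]] by blast

lemma image_abs_cycle: "b \<in> abs_cycles n w \<Longrightarrow> unsigned w ` b = b"
  unfolding abs_cycles_def using image_orbit[OF unsigned_permutation[OF w]] by blast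

lemma abs_cycle_nonempty: "b \<in> abs_cycles n w \<Longrightarrow> b \<noteq> {}"
  unfolding abs_cycles_def using self_mem_orbit_unsigned by blast

lemma abs_cycles_disjoint:
  "b \<in> abs_cycles n w \<Longrightarrow> c \<in> abs_cycles n w \<Longrightarrow> b \<noteq> c \<Longrightarrow> b \<inter> c = {}"
  using orbit_eq_abs_cycle by (metis disjoint_iff)

lemma cycle_sign_cases_subset:
  assumes "b \<subseteq> {1..int n}" shows "cycle_sign w b = 1 \<or> cycle_sign w b = - 1"
proof -
  have "\<forall>i\<in>b. sgn (w i) = 1 \<or> sgn (w i) = - 1"
  proof
    fix i assume "i \<in> b"
    then have "w i \<noteq> 0" using assms signed_perms_eq_0_iff[OF w, of i] by auto
    then show "sgn (w i) = 1 \<or> sgn (w i) = - 1" by (simp add: sgn_if)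
  qed
  with finite_subset[OF assms finite_atLeastAtMost_int] show ?thesis
    unfolding cycle_sign_def
    by (induction b rule: finite_induct) auto
qed

lemma cycle_sign_cases: "b \<in> abs_cycles n w \<Longrightarrow> cycle_sign w b = 1 \<or> cycle_sign w b = - 1"
  by (rule cycle_sign_cases_subset[OF abs_cycle_subset])

lemma funpow_mem_signed_perms: "w ^^ k \<in> signed_perms n"
  by (induction k) (simp_all only: funpow.simps signed_perms.id_mem signed_perms.comp_mem[OF w])

lemma unsigned_funpow: "unsigned (w ^^ k) = unsigned w ^^ k"
  by (induction k)
    (simp_all only: funpow.simps unsigned_id unsigned_comp[OF w funpow_mem_signed_perms])

lemma unsigned_funpow_mem: "x \<in> {1..int n} \<Longrightarrow> (unsigned w ^^ k) x \<in> {1..int n}"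
  unfolding unsigned_funpow[symmetric] by (rule unsigned_mem[OF funpow_mem_signed_perms])

lemma abs_funpow: "\<bar>(w ^^ k) x\<bar> = (unsigned w ^^ k) \<bar>x\<bar>"
proof (cases "x = 0")
  case True
  then show ?thesis
    using signed_perms_0[OF funpow_mem_signed_perms, of k]
      signed_perms_0[OF unsigned_mem_signed_perms[OF funpow_mem_signed_perms], of k]
    by (simp add: unsigned_funpow)
next
  case False
  then show ?thesis
    using signed_perms_abs[OF funpow_mem_signed_perms]
    by (simp add: unsigned_pos_eq flip: unsigned_funpow)
qed

lemma sgn_funpow:
  "x > 0 \<Longrightarrow> sgn ((w ^^ k) x) = (\<Prod>t<k. sgn (w ((unsigned w ^^ t) x)))"
proof (induction k)
  case (Suc k)
  have "w ((w ^^ k) x) = sgn ((w ^^ k) x) * w ((unsigned w ^^ k) x)"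
    using signed_perms_sgn_abs[OF w, of "(w ^^ k) x"] Suc.prems by (simp add: abs_funpow)
  then have "sgn ((w ^^ Suc k) x) = sgn ((w ^^ k) x) * sgn (w ((unsigned w ^^ k) x))"
    by (simp add: sgn_mult)
  then show ?case using Suc by simp
qed simp

lemma funpow_card_orbit:
  assumes "x \<in> signed_letters n"
  defines "b \<equiv> orbit (unsigned w) \<bar>x\<bar>"
  shows "(w ^^ card b) x = cycle_sign w b * x"
proof -
  note permutation = unsigned_permutation[OF w]
  have card: "card b = least_power (unsigned w) \<bar>x\<bar>"
    unfolding b_def by (rule card_orbit[OF permutation])
  have "sgn ((w ^^ card b) \<bar>x\<bar>) = (\<Prod>t<card b. sgn (w ((unsigned w ^^ t) \<bar>x\<bar>)))"
    using assms(1) by (intro sgn_funpow) auto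
  also have "\<dots> = cycle_sign w b"
    unfolding card by (simp add: b_def cycle_sign_def prod.reindex
        inj_on_funpow_least_power[OF permutation] flip: funpow_image_least_power[OF permutation])
  finally have "sgn ((w ^^ card b) \<bar>x\<bar>) = cycle_sign w b" .
  moreover have "\<bar>(w ^^ card b) \<bar>x\<bar>\<bar> = \<bar>x\<bar>"
    unfolding abs_funpow abs_idempotent card by (rule least_power_of_permutation(1)[OF permutation])
  ultimately have "(w ^^ card b) \<bar>x\<bar> = cycle_sign w b * \<bar>x\<bar>" by (metis sgn_mult_abs)
  then show ?thesis
    using signed_perms_sgn_abs[OF funpow_mem_signed_perms, of "card b" x]
    by (metis mult.left_commute sgn_mult_abs)
qed

lemma funpow_add_mult_card_orbit:
  assumes "x \<in> signed_letters n"
  defines "b \<equiv> orbit (unsigned w) \<bar>x\<bar>"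
  shows "(w ^^ (t + q * card b)) x = cycle_sign w b ^ q * (w ^^ t) x"
proof (induction q)
  case (Suc q)
  have "b \<in> abs_cycles n w" unfolding b_def using assms(1) by (intro orbit_mem_abs_cycles) auto
  then have sign: "cycle_sign w b = 1 \<or> cycle_sign w b = - 1" by (rule cycle_sign_cases)
  have "(w ^^ (t + Suc q * card b)) x = (w ^^ (t + q * card b)) ((w ^^ card b) x)"
    by (simp add: funpow_add[symmetric, THEN fun_cong, unfolded comp_def] algebra_simps)
  also have "(w ^^ card b) x = cycle_sign w b * x"
    unfolding b_def by (rule funpow_card_orbit[OF assms(1)])
  also have "(w ^^ (t + q * card b)) (cycle_sign w b * x)
      = cycle_sign w b * (w ^^ (t + q * card b)) x"
    using sign signed_perms_uminus[OF funpow_mem_signed_perms] by auto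
  finally show ?case using Suc by simp
qed simp

lemma orbit_Un_uminus:
  assumes "x \<in> signed_letters n"
  defines "b \<equiv> orbit (unsigned w) \<bar>x\<bar>"
  shows "orbit w x \<union> uminus ` orbit w x = b \<union> uminus ` b"
proof (rule Set.set_eqI)
  fix y
  have orbits: "orbit w x = range (\<lambda>k. (w ^^ k) x)" "b = range (\<lambda>k. \<bar>(w ^^ k) x\<bar>)"
    unfolding b_def abs_funpow
    by (intro orbit_eq_range signed_perms_permutation[OF w] unsigned_permutation[OF w])+
  have "y \<in> orbit w x \<union> uminus ` orbit w x \<longleftrightarrow> \<bar>y\<bar> \<in> b"
    unfolding orbits by (auto simp: image_iff abs_eq_iff)
  also have "b \<subseteq> {0<..}"
    using abs_cycle_subset[of b] orbit_mem_abs_cycles[of "\<bar>x\<bar>" n w] assms by force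
  then have "\<bar>y\<bar> \<in> b \<longleftrightarrow> y \<in> b \<union> uminus ` b"
    by (auto simp: abs_if image_iff) (metis minus_minus)+
  finally show "y \<in> orbit w x \<union> uminus ` orbit w x \<longleftrightarrow> y \<in> b \<union> uminus ` b" .
qed

lemma uminus_orbit_eq_iff:
  assumes "x \<in> signed_letters n"
  defines "b \<equiv> orbit (unsigned w) \<bar>x\<bar>"
  shows "uminus ` orbit w x = orbit w x \<longleftrightarrow> cycle_sign w b = - 1"
proof
  note permutation = signed_perms_permutation[OF w]
  assume "cycle_sign w b = - 1"
  then have "(w ^^ card b) x = - x"
    using funpow_card_orbit[OF assms(1)] by (simp add: b_def)
  then have "- x \<in> orbit w x" unfolding orbit_eq_range[OF permutation] by (metis rangeI)
  moreover have "uminus ` orbit w x = orbit w (- x)"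
    unfolding orbit_eq_range[OF permutation] image_image
    by (simp add: signed_perms_uminus[OF funpow_mem_signed_perms])
  ultimately show "uminus ` orbit w x = orbit w x" using orbit_eq_of_mem[OF permutation] by metis
next
  note permutation = signed_perms_permutation[OF w]
  assume "uminus ` orbit w x = orbit w x"
  then have "- x \<in> orbit w x" using permutation_self_in_orbit[OF permutation, of x] by blast
  then obtain k where k: "(w ^^ k) x = - x" unfolding orbit_eq_range[OF permutation] by auto
  then have "(unsigned w ^^ k) \<bar>x\<bar> = \<bar>x\<bar>" using abs_funpow[of k x] by simp
  then have "card b dvd k"
    unfolding b_def card_orbit[OF unsigned_permutation[OF w]] by (rule least_power_minimal)
  then obtain q where "k = 0 + q * card b" by (metis dvd_div_mult_self add_0)
  then have "- x = cycle_sign w b ^ q * x"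
    using k funpow_add_mult_card_orbit[OF assms(1), of 0 q] by (simp add: b_def)
  moreover have "b \<in> abs_cycles n w"
    unfolding b_def using assms(1) by (intro orbit_mem_abs_cycles) auto
  ultimately show "cycle_sign w b = - 1" using cycle_sign_cases[of b] assms(1) by auto
qed

lemma abs_cycles_eq_image_signed_letters:
  "abs_cycles n w = (\<lambda>x. orbit (unsigned w) \<bar>x\<bar>) ` signed_letters n"
proof -
  have "{1..int n} = abs ` signed_letters n"
  proof (intro equalityI subsetI)
    fix x assume "x \<in> {1..int n}"
    then show "x \<in> abs ` signed_letters n" by (intro image_eqI[of _ _ x]) auto
  qed auto
  then show ?thesis by (simp only: abs_cycles_def image_image)
qed

lemma Un_uminus_image_cycles:
  "(\<lambda>c. c \<union> uminus ` c) ` {c \<in> cycles n w. P (uminus ` c = c)}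
    = (\<lambda>b. b \<union> uminus ` b) ` {b \<in> abs_cycles n w. P (cycle_sign w b = - 1)}"
proof -
  let ?S = "signed_letters n" and ?O = "\<lambda>x. orbit (unsigned w) \<bar>x\<bar>"
  have "(\<lambda>c. c \<union> uminus ` c) ` {c \<in> cycles n w. P (uminus ` c = c)}
      = (\<lambda>x. orbit w x \<union> uminus ` orbit w x) ` {x \<in> ?S. P (uminus ` orbit w x = orbit w x)}"
    unfolding cycles_def by blast
  also have "\<dots> = (\<lambda>x. ?O x \<union> uminus ` ?O x) ` {x \<in> ?S. P (cycle_sign w (?O x) = - 1)}"
  proof (rule image_cong)
    show "{x \<in> ?S. P (uminus ` orbit w x = orbit w x)} = {x \<in> ?S. P (cycle_sign w (?O x) = - 1)}"
      by (rule Collect_cong, rule conj_cong[OF refl]) (simp only: uminus_orbit_eq_iff)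
  qed (simp only: mem_Collect_eq orbit_Un_uminus)
  also have "\<dots> = (\<lambda>b. b \<union> uminus ` b) ` {b \<in> abs_cycles n w. P (cycle_sign w b = - 1)}"
    unfolding abs_cycles_eq_image_signed_letters by blast
  finally show ?thesis .
qed

lemma pos_cycles_eq: "pos_cycles n w = (\<lambda>b. b \<union> uminus ` b) ` pos_abs_cycles n w"
proof -
  have "pos_abs_cycles n w = {b \<in> abs_cycles n w. \<not> cycle_sign w b = - 1}"
    using cycle_sign_cases by (force simp: pos_abs_cycles_def)
  moreover have "pos_cycles n w
      = (\<lambda>c. c \<union> uminus ` c) ` {c \<in> cycles n w. \<not> uminus ` c = c}"
    unfolding pos_cycles_def by blast
  ultimately show ?thesis by (simp only: Un_uminus_image_cycles[of Not])
qed

lemma neg_cycles_eq: "neg_cycles n w = (\<lambda>b. b \<union> uminus ` b) ` neg_abs_cycles n w"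
proof -
  have "neg_cycles n w = (\<lambda>c. c \<union> uminus ` c) ` {c \<in> cycles n w. uminus ` c = c}"
    unfolding neg_cycles_def by (auto simp: image_iff)
  then show ?thesis using Un_uminus_image_cycles[of "\<lambda>x. x"] by (simp only: neg_abs_cycles_def)
qed

end

lemma uminus_image_neg: "b \<subseteq> {0<..} \<Longrightarrow> x \<in> uminus ` b \<Longrightarrow> x < 0"
  for b :: "'a :: linordered_ab_group_add set"
  by (elim imageE) (simp add: subset_iff)

lemma positive_part_Un_uminus:
  fixes b :: "'a :: linordered_ab_group_add set"
  assumes "b \<subseteq> {0<..}" shows "(b \<union> uminus ` b) \<inter> {0<..} = b"
proof -
  have "uminus ` b \<inter> {0<..} = {}" using uminus_image_neg[OF assms] by (auto dest: less_asym)
  then show ?thesis using assms by blast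
qed

lemma card_Un_uminus:
  fixes b :: "'a :: linordered_ab_group_add set"
  assumes "finite b" "b \<subseteq> {0<..}" shows "card (b \<union> uminus ` b) = 2 * card b"
proof -
  have "b \<inter> uminus ` b = {}"
    using assms(2) uminus_image_neg[OF assms(2)] by (auto dest: less_asym simp del: image_iff)
  then have "card (b \<union> uminus ` b) = card b + card (uminus ` b)"
    using assms(1) by (intro card_Un_disjoint) auto
  then show ?thesis by (simp add: card_image)
qed

lemma image_mset_card_Un_uminus:
  assumes "\<And>b. b \<in> B \<Longrightarrow> finite b \<and> b \<subseteq> {0<..}"
  shows "image_mset (\<lambda>c. card c div 2) (mset_set ((\<lambda>b. b \<union> uminus ` b) ` B))
    = image_mset card (mset_set (B :: 'a :: linordered_ab_group_add set set))"
proof -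
  have "inj_on (\<lambda>b. b \<union> uminus ` b) B"
    by (rule inj_on_inverseI[where g = "\<lambda>d. d \<inter> {0<..}"]) (simp add: positive_part_Un_uminus assms)
  then have "image_mset (\<lambda>c. card c div 2) (mset_set ((\<lambda>b. b \<union> uminus ` b) ` B))
      = image_mset (\<lambda>b. card (b \<union> uminus ` b) div 2) (mset_set B)"
    by (simp add: image_mset_mset_set[symmetric] image_mset.compositionality comp_def)
  also have "\<dots> = image_mset card (mset_set B)"
  proof (rule image_mset_cong)
    fix b assume "b \<in># mset_set B"
    then have "b \<in> B" by (metis elem_mset_set empty_iff mset_set.infinite set_mset_empty)
    then show "card (b \<union> uminus ` b) div 2 = card b" using assms by (simp add: card_Un_uminus)
  qed
  finally show ?thesis .
qed

lemma signed_cycle_type_eq: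
  assumes "w \<in> signed_perms n"
  shows "signed_cycle_type n w = (image_mset card (mset_set (pos_abs_cycles n w)),
    image_mset card (mset_set (neg_abs_cycles n w)))"
proof -
  have "finite b \<and> b \<subseteq> {0<..}" if "b \<in> abs_cycles n w" for b
    using abs_cycle_subset[OF assms that] finite_abs_cycle[OF assms that] by auto
  then show ?thesis
    unfolding signed_cycle_type_def pos_cycles_eq[OF assms] neg_cycles_eq[OF assms]
    by (intro arg_cong2[of _ _ _ _ Pair] image_mset_card_Un_uminus)
      (simp_all add: pos_abs_cycles_def neg_abs_cycles_def)
qed

lemma prod_abs_cycles_eq_prod_type:
  fixes f g :: "nat \<Rightarrow> 'c :: comm_monoid_mult"
  assumes "w \<in> signed_perms n"
  shows "(\<Prod>b\<in>abs_cycles n w. if cycle_sign w b = 1 then f (card b) else g (card b))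
    = (\<Prod>r\<in>#fst (signed_cycle_type n w). f r) * (\<Prod>r\<in>#snd (signed_cycle_type n w). g r)"
proof -
  have "{b \<in> abs_cycles n w. cycle_sign w b \<noteq> 1} = neg_abs_cycles n w"
    using cycle_sign_cases[OF assms] by (force simp: neg_abs_cycles_def)
  then have "(\<Prod>b\<in>abs_cycles n w. if cycle_sign w b = 1 then f (card b) else g (card b))
      = (\<Prod>b\<in>pos_abs_cycles n w. f (card b)) * (\<Prod>b\<in>neg_abs_cycles n w. g (card b))"
    by (simp add: prod.If_cases[OF finite_abs_cycles] pos_abs_cycles_def Int_def)
  then show ?thesis
    unfolding signed_cycle_type_eq[OF assms]
    by (simp add: prod_unfold_prod_mset image_mset.compositionality comp_def)
qed

lemma cycles_conj:
  assumes u: "u \<in> signed_perms n" and h: "h \<in> signed_perms n"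
  shows "cycles n (u \<circ> h \<circ> inv u) = (`) u ` cycles n h"
proof -
  let ?g = "u \<circ> h \<circ> inv u"
  have g: "?g \<in> signed_perms n" by (rule signed_perms.conj_mem[OF u h])
  have "(?g ^^ k) (u x) = u ((h ^^ k) x)" for k x
    by (induction k) (simp_all add: signed_perms.inv_apply[OF u])
  then have orbit_conj: "orbit ?g (u x) = u ` orbit h x" for x
    by (simp only: orbit_eq_range signed_perms_permutation[OF g] signed_perms_permutation[OF h]
        image_image)
  have "cycles n ?g = orbit ?g ` u ` signed_letters n"
    by (simp only: cycles_def permutes_image[OF signed_perms_permutes[OF u]])
  also have "\<dots> = (`) u ` cycles n h" by (simp only: cycles_def image_image orbit_conj)
  finally show ?thesis .
qed

lemma class_function_signed_cycle_type: "class_function (signed_perms n) (signed_cycle_type n)"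
  unfolding class_function_def
proof (intro ballI)
  fix u h assume u: "u \<in> signed_perms n" and h: "h \<in> signed_perms n"
  let ?g = "u \<circ> h \<circ> inv u"
  note inj = signed_perms_inj[OF u] and cycles = cycles_conj[OF u h]
  have image_eq_iff: "u ` c = u ` d \<longleftrightarrow> c = d" for c d by (rule inj_image_eq_iff[OF inj])
  have image_uminus: "uminus ` u ` c = u ` uminus ` c" for c
    by (simp add: image_image signed_perms_uminus[OF u])
  have "pos_cycles n ?g
      = (\<lambda>c. u ` c \<union> uminus ` u ` c) ` {c \<in> cycles n h. uminus ` u ` c \<noteq> u ` c}"
    unfolding pos_cycles_def cycles by blast
  also have "\<dots> = (\<lambda>c. u ` (c \<union> uminus ` c)) ` {c \<in> cycles n h. uminus ` c \<noteq> c}"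
    by (simp only: image_uminus image_eq_iff image_Un)
  also have "\<dots> = (`) u ` pos_cycles n h" unfolding pos_cycles_def by blast
  finally have "pos_cycles n ?g = (`) u ` pos_cycles n h" .
  moreover have "neg_cycles n ?g = (`) u ` {c \<in> cycles n h. uminus ` u ` c = u ` c}"
    unfolding neg_cycles_def cycles by blast
  then have "neg_cycles n ?g = (`) u ` neg_cycles n h"
    by (simp only: neg_cycles_def image_uminus image_eq_iff)
  moreover have "image_mset (\<lambda>c. card c div 2) (mset_set ((`) u ` P))
      = image_mset (\<lambda>c. card c div 2) (mset_set P)" for P
  proof -
    have "inj_on ((`) u) P" by (simp add: inj_on_def image_eq_iff)
    then have "image_mset (\<lambda>c. card c div 2) (mset_set ((`) u ` P))
        = image_mset (\<lambda>c. card (u ` c) div 2) (mset_set P)"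
      by (simp add: image_mset_mset_set[symmetric] image_mset.compositionality comp_def)
    then show ?thesis by (simp add: card_image inj_on_subset[OF inj])
  qed
  ultimately show "signed_cycle_type n ?g = signed_cycle_type n h"
    unfolding signed_cycle_type_def by simp
qed

lemma signed_cycle_type_stabilizer:
  assumes "n \<ge> 1" "h \<in> signed_perms (n - 1)"
  shows "signed_cycle_type n h
    = (add_mset 1 (fst (signed_cycle_type (n - 1) h)), snd (signed_cycle_type (n - 1) h))"
proof -
  have h: "h \<in> signed_perms n" "h (int n) = int n"
    using assms(2) unfolding signed_perms_stabilizer[OF assms(1)] by auto
  have "{1..int n} = insert (int n) {1..int (n - 1)}" using assms(1) by auto
  moreover have "orbit (unsigned h) (int n) = {int n}"
    unfolding orbit_eq_singleton_iff using h assms(1) by (simp add: unsigned_def)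
  ultimately have cycles: "abs_cycles n h = insert {int n} (abs_cycles (n - 1) h)"
    by (simp add: abs_cycles_def)
  have new: "{int n} \<notin> abs_cycles (n - 1) h"
    using abs_cycle_subset[OF assms(2), of "{int n}"] assms(1) by auto
  have "cycle_sign h {int n} = 1" using h assms(1) by (simp add: cycle_sign_def)
  then have "pos_abs_cycles n h = insert {int n} (pos_abs_cycles (n - 1) h)"
    "neg_abs_cycles n h = neg_abs_cycles (n - 1) h"
    unfolding pos_abs_cycles_def neg_abs_cycles_def cycles by auto
  then show ?thesis
    unfolding signed_cycle_type_eq[OF h(1)] signed_cycle_type_eq[OF assms(2)]
    using new finite_abs_cycles[of "n - 1" h] by (simp add: pos_abs_cycles_def)
qed

section \<open>The character induced from the exterior algebra\<close>

definition type_product :: "nat multiset \<times> nat multiset \<Rightarrow> int" where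
  "type_product t = (\<Prod>r\<in>#fst t. 1 + (- 1) ^ (r - 1)) * (\<Prod>r\<in>#snd t. 1 - (- 1) ^ (r - 1))"

lemma ext_sign_abs_cycle:
  assumes "w \<in> signed_perms n" "b \<in> abs_cycles n w"
  shows "ext_sign w b = (- 1) ^ (card b - 1) * cycle_sign w b"
proof -
  obtain x where "b = orbit (unsigned w) x" using assms(2) unfolding abs_cycles_def by blast
  then have "inv_sign (unsigned w) b = (- 1) ^ (card b - 1)"
    using inv_sign_orbit[OF unsigned_permutation[OF assms(1)]] by simp
  then show ?thesis by (simp add: ext_sign_def cycle_sign_def)
qed

lemma ext_sign_Union:
  assumes "w \<in> signed_perms n" "Q \<subseteq> abs_cycles n w"
  shows "ext_sign w (\<Union>Q) = (\<Prod>b\<in>Q. ext_sign w b)"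
proof -
  have "finite Q" using assms(2) finite_abs_cycles finite_subset by blast
  then show ?thesis using assms(2)
  proof (induction Q rule: finite_induct)
    case (insert b Q)
    then have b: "b \<in> abs_cycles n w" and Q: "Q \<subseteq> abs_cycles n w" by auto
    have disjoint: "b \<inter> \<Union>Q = {}"
      using abs_cycles_disjoint[OF assms(1) b] Q insert(2) by blast
    have finite: "finite b" "finite (\<Union>Q)"
      using finite_abs_cycle[OF assms(1)] insert(1) b Q by auto
    have "unsigned w ` c = c" if "c \<in> Q" for c using image_abs_cycle[OF assms(1)] Q that by blast
    then have invariant: "unsigned w ` b = b" "unsigned w ` \<Union>Q = \<Union>Q"
      by (simp_all add: image_abs_cycle[OF assms(1) b] image_Union)
    have "ext_sign w (b \<union> \<Union>Q) = ext_sign w b * ext_sign w (\<Union>Q)"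
      unfolding ext_sign_def inv_sign_Un_invariant[OF finite disjoint invariant]
        prod.union_disjoint[OF finite disjoint] by (simp only: mult_ac)
    then show ?case using insert Q by simp
  qed (simp add: ext_sign_def inv_sign_def)
qed

lemma sum_ext_sign_invariant:
  assumes "w \<in> signed_perms n"
  shows "(\<Sum>I | I \<subseteq> {1..int n} \<and> unsigned w ` I = I. ext_sign w I)
    = (\<Prod>b\<in>abs_cycles n w. 1 + (- 1) ^ (card b - 1) * cycle_sign w b)"
proof -
  have "(\<Sum>I | I \<subseteq> {1..int n} \<and> unsigned w ` I = I. ext_sign w I)
      = (\<Sum>Q\<in>Pow (abs_cycles n w). ext_sign w (\<Union>Q))"
    unfolding abs_cycles_def
    by (rule sum.reindex_bij_betw[symmetric], rule bij_betw_Union_orbits)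
      (simp_all add: unsigned_permutation[OF assms] unsigned_image[OF assms])
  also have "\<dots> = (\<Sum>Q\<in>Pow (abs_cycles n w). \<Prod>b\<in>Q. (- 1) ^ (card b - 1) * cycle_sign w b)"
    using ext_sign_Union[OF assms] ext_sign_abs_cycle[OF assms]
    by (intro sum.cong refl) (simp add: subset_iff)
  also have "\<dots> = (\<Prod>b\<in>abs_cycles n w. (- 1) ^ (card b - 1) * cycle_sign w b + 1)"
    by (simp add: prod_add[OF finite_abs_cycles])
  finally show ?thesis by (simp add: add.commute)
qed

lemma ext_char_eq_type_product:
  assumes "w \<in> signed_perms n"
  shows "ext_char n w = of_int (type_product (signed_cycle_type n w))"
proof -
  have "(\<Prod>b\<in>abs_cycles n w. 1 + (- 1) ^ (card b - 1) * cycle_sign w b)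
      = (\<Prod>b\<in>abs_cycles n w. if cycle_sign w b = 1 then 1 + (- 1) ^ (card b - 1)
          else 1 - (- 1) ^ (card b - 1))"
    using cycle_sign_cases[OF assms] by (intro prod.cong refl) fastforce
  also have "\<dots> = type_product (signed_cycle_type n w)"
    unfolding type_product_def by (rule prod_abs_cycles_eq_prod_type[OF assms])
  finally show ?thesis
    unfolding ext_char_eq_sum_ext_sign[OF assms] sum_ext_sign_invariant[OF assms] by simp
qed

lemma singleton_mem_pos_abs_cycles_iff:
  assumes "w \<in> signed_perms n"
  shows "{a} \<in> pos_abs_cycles n w \<longleftrightarrow> a \<in> {1..int n} \<and> w a = a"
proof
  assume "{a} \<in> pos_abs_cycles n w"
  then have cycle: "{a} \<in> abs_cycles n w" and sign: "sgn (w a) = 1"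
    by (simp_all add: pos_abs_cycles_def cycle_sign_def)
  have "a \<in> {1..int n}" "unsigned w a = a"
    using abs_cycle_subset[OF assms cycle] image_abs_cycle[OF assms cycle] by simp_all
  then show "a \<in> {1..int n} \<and> w a = a" using signed_perms_sgn_unsigned[of a w] sign by simp
next
  assume a: "a \<in> {1..int n} \<and> w a = a"
  then have "orbit (unsigned w) a = {a}"
    unfolding orbit_eq_singleton_iff by (simp add: unsigned_def)
  then show "{a} \<in> pos_abs_cycles n w"
    using a orbit_mem_abs_cycles[of a n w] by (simp add: pos_abs_cycles_def cycle_sign_def)
qed

lemma card_fixed_letters:
  assumes "w \<in> signed_perms n"
  shows "card {a \<in> signed_letters n. w a = a} = 2 * count (fst (signed_cycle_type n w)) 1"
proof -
  let ?F = "{a \<in> {1..int n}. w a = a}"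
  have "signed_letters n = {1..int n} \<union> uminus ` {1..int n}" by auto
  then have "{a \<in> signed_letters n. w a = a} = ?F \<union> {a \<in> uminus ` {1..int n}. w a = a}" by blast
  also have "{a \<in> uminus ` {1..int n}. w a = a} = uminus ` {a \<in> {1..int n}. w (- a) = - a}" by blast
  also have "{a \<in> {1..int n}. w (- a) = - a} = ?F" by (simp add: signed_perms_uminus[OF assms])
  finally have "card {a \<in> signed_letters n. w a = a} = card (?F \<union> uminus ` ?F)"
    by (rule arg_cong)
  also have "\<dots> = 2 * card ?F"
    by (rule card_Un_uminus) (auto intro: finite_subset[of _ "{1..int n}"])
  also have "card ?F = card ((\<lambda>a. {a}) ` ?F)" by (simp add: card_image)
  also have "(\<lambda>a. {a}) ` ?F = {b \<in> pos_abs_cycles n w. \<exists>a. b = {a}}"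
    using singleton_mem_pos_abs_cycles_iff[OF assms] by blast
  also have "\<dots> = {b \<in> pos_abs_cycles n w. card b = 1}"
    by (simp only: card_1_singleton_iff One_nat_def)
  also have "card \<dots> = count (fst (signed_cycle_type n w)) 1"
    unfolding signed_cycle_type_eq[OF assms] using finite_abs_cycles[of n w]
    by (simp add: count_image_mset_eq_card_vimage pos_abs_cycles_def)
  finally show ?thesis .
qed

lemma induced_ext_char:
  assumes "n \<ge> 1" "g \<in> signed_perms n"
  shows "induced (signed_perms (n - 1)) (signed_perms n) (ext_char (n - 1)) g
    = of_nat (count (fst (signed_cycle_type n g)) 1)
      * of_int (type_product (signed_cycle_type n g))"
proof -
  let ?T = "complex_of_int (type_product (signed_cycle_type n g))"
  have ext_char: "ext_char (n - 1) (inv u \<circ> g \<circ> u) = ?T / 2"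
    if u: "u \<in> signed_perms n" and h: "inv u \<circ> g \<circ> u \<in> signed_perms (n - 1)" for u
  proof -
    have type: "signed_cycle_type n g = signed_cycle_type n (inv u \<circ> g \<circ> u)"
      by (rule signed_perms.class_function_conj_inv[OF class_function_signed_cycle_type u assms(2),
        symmetric])
    have "type_product (signed_cycle_type n g)
        = 2 * type_product (signed_cycle_type (n - 1) (inv u \<circ> g \<circ> u))"
      unfolding type signed_cycle_type_stabilizer[OF assms(1) h] by (simp add: type_product_def)
    then show ?thesis using ext_char_eq_type_product[OF h] by simp
  qed
  have "induced (signed_perms (n - 1)) (signed_perms n) (ext_char (n - 1)) g
      = of_nat (card {a \<in> signed_letters n. g a = a}) * (?T / 2)"
    using signed_perms.induced_stabilizer[where x = "int n" and E = "?T / 2", OF assms(2),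
        of "ext_char (n - 1)"] ext_char
    by (simp only: signed_perms_stabilizer[OF assms(1), symmetric] signed_perms_orbit[OF assms(1)])
  then show ?thesis unfolding card_fixed_letters[OF assms(2)] by simp
qed

section \<open>Cyclic intervals of residues\<close>

definition residue_rep :: "nat \<Rightarrow> int \<Rightarrow> int" where
  "residue_rep n x = (x - 1) mod int n + 1"

lemma residue_rep_mem:
  assumes "n \<ge> 1" shows "residue_rep n x \<in> {1..int n}"
proof -
  have "0 < int n" using assms by simp
  then have "(x - 1) mod int n < int n" "0 \<le> (x - 1) mod int n" by simp_all
  then show ?thesis unfolding residue_rep_def by simp
qed

lemma residue_rep_eq_iff: "residue_rep n x = residue_rep n y \<longleftrightarrow> [x = y] (mod int n)"
  by (simp add: residue_rep_def mod_eq_dvd_iff cong_iff_dvd_diff)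

lemma residue_rep_cong: "[residue_rep n x = x] (mod int n)"
proof -
  have "[(x - 1) mod int n + 1 = (x - 1) + 1] (mod int n)" by (intro cong_add) (auto simp: cong_def)
  then show ?thesis by (simp add: residue_rep_def)
qed

lemma residue_rep_add: "residue_rep n (residue_rep n x + y) = residue_rep n (x + y)"
  unfolding residue_rep_eq_iff by (intro cong_add residue_rep_cong cong_refl)

lemma residue_rep_diff: "residue_rep n (residue_rep n x - y) = residue_rep n (x - y)"
  unfolding residue_rep_eq_iff by (intro cong_diff residue_rep_cong cong_refl)

lemma residue_rep_id: "x \<in> {1..int n} \<Longrightarrow> residue_rep n x = x"
  by (simp add: residue_rep_def)

lemma residue_rep_mem_iff:
  assumes "A \<subseteq> {1..int n}" shows "residue_rep n x \<in> A \<longleftrightarrow> (\<exists>a\<in>A. [x = a] (mod int n))"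
proof -
  have "residue_rep n x = a \<longleftrightarrow> [x = a] (mod int n)" if "a \<in> A" for a
    using that assms residue_rep_id[of a n] residue_rep_eq_iff[of n x a] by auto
  then show ?thesis by blast
qed

lemma cong_eq_of_bounds:
  assumes "[x = y] (mod int n)" "\<bar>x - y\<bar> < int n" shows "x = y"
proof (rule ccontr)
  assume "x \<noteq> y"
  then have "\<not> int n dvd \<bar>x - y\<bar>" using assms(2) by (intro zdvd_not_zless) auto
  then show False using assms(1) by (simp add: cong_iff_dvd_diff)
qed

lemma residue_rep_mem_image_iff:
  assumes "hi - int n < x" "x < lo + int n"
  shows "residue_rep n x \<in> residue_rep n ` {lo..hi} \<longleftrightarrow> x \<in> {lo..hi}"
proof
  assume "residue_rep n x \<in> residue_rep n ` {lo..hi}"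
  then obtain y where y: "y \<in> {lo..hi}" "[x = y] (mod int n)"
    unfolding image_iff residue_rep_eq_iff by blast
  then have "x = y" using assms by (intro cong_eq_of_bounds) auto
  then show "x \<in> {lo..hi}" using y by simp
qed simp

lemma residue_rep_image_interval:
  assumes "n \<ge> 1" shows "residue_rep n ` {a..a + int n - 1} = {1..int n}"
proof (rule card_subset_eq)
  show "residue_rep n ` {a..a + int n - 1} \<subseteq> {1..int n}" using residue_rep_mem[OF assms] by blast
  have "inj_on (residue_rep n) {a..a + int n - 1}"
    by (intro inj_onI, unfold residue_rep_eq_iff, erule cong_eq_of_bounds) auto
  then show "card (residue_rep n ` {a..a + int n - 1}) = card {1..int n}" by (simp add: card_image)
qed simp

lemma residue_rep_Suc_less_iff:
  assumes "n \<ge> 2" shows "residue_rep n (x + 1) < residue_rep n x \<longleftrightarrow> int n dvd x"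
proof -
  let ?r = "residue_rep n x"
  have r: "?r \<in> {1..int n}" using residue_rep_mem assms by simp
  have Suc: "residue_rep n (x + 1) = residue_rep n (?r + 1)" by (rule residue_rep_add[symmetric])
  have dvd: "int n dvd x \<longleftrightarrow> int n dvd ?r" using cong_dvd_iff[OF residue_rep_cong[of n x]] by simp
  show ?thesis
  proof (cases "?r = int n")
    case True
    have "residue_rep n (int n + 1) = residue_rep n 1"
      unfolding residue_rep_eq_iff by (simp add: cong_def)
    also have "\<dots> = 1" using assms by (intro residue_rep_id) simp
    finally show ?thesis using Suc dvd True assms by simp
  next
    case False
    then have "residue_rep n (?r + 1) = ?r + 1" using r by (intro residue_rep_id) simp
    moreover have "\<not> int n dvd ?r" using False r by (intro zdvd_not_zless) auto
    ultimately show ?thesis using Suc dvd by simp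
  qed
qed

lemma residue_rep_Suc_neq: "n \<ge> 2 \<Longrightarrow> residue_rep n (x + 1) \<noteq> residue_rep n x"
  by (simp add: residue_rep_eq_iff cong_iff_dvd_diff)

lemma residue_rep_pred_neq: "n \<ge> 2 \<Longrightarrow> residue_rep n (x - 1) \<noteq> residue_rep n x"
  using residue_rep_Suc_neq[of n "x - 1"] by simp

lemma cyclic_interval_residue_rep: "cyclic_interval n (residue_rep n ` {a..c})"
proof -
  have interval: "{a..c} = (\<lambda>j. a + int j) ` {..<nat (c - a + 1)}"
  proof (intro equalityI subsetI)
    fix x assume "x \<in> {a..c}"
    then have "x = a + int (nat (x - a))" "nat (x - a) \<in> {..<nat (c - a + 1)}" by auto
    then show "x \<in> (\<lambda>j. a + int j) ` {..<nat (c - a + 1)}" by (rule image_eqI)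
  qed auto
  have "(\<lambda>x. x mod int n) ` residue_rep n ` {a..c} = (\<lambda>x. x mod int n) ` {a..c}"
    unfolding image_image using residue_rep_cong by (intro image_cong refl) (simp add: cong_def)
  also have "\<dots> = (\<lambda>j. (a + int j) mod int n) ` {..<nat (c - a + 1)}"
    by (simp only: interval image_image)
  finally show ?thesis unfolding cyclic_interval_def by blast
qed

lemma cyclic_interval_Diff_singleton:
  assumes "a \<in> {1..int n}" shows "cyclic_interval n ({1..int n} - {a})"
proof -
  have "{1..int n} = residue_rep n ` {a..a + int n - 1}"
    using assms by (intro residue_rep_image_interval[symmetric]) auto
  also have "{a..a + int n - 1} = insert a {a + 1..a + int n - 1}" using assms by auto
  finally have "{1..int n} = insert a (residue_rep n ` {a + 1..a + int n - 1})"
    using residue_rep_id[OF assms] by simp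
  moreover have "a \<notin> residue_rep n ` {a + 1..a + int n - 1}"
    using residue_rep_mem_image_iff[of "a + int n - 1" n a "a + 1"] residue_rep_id[OF assms] assms
    by simp
  ultimately have "{1..int n} - {a} = residue_rep n ` {a + 1..a + int n - 1}" by blast
  then show ?thesis by (simp only: cyclic_interval_residue_rep)
qed

lemma cyclic_interval_neighbour:
  assumes "cyclic_interval n A" "x \<in> A" "y \<in> A" "\<not> [x = y] (mod int n)"
  obtains z where "z \<in> A" "[z = x - 1] (mod int n) \<or> [z = x + 1] (mod int n)"
proof -
  obtain a k where A: "(\<lambda>x. x mod int n) ` A = (\<lambda>j. (a + int j) mod int n) ` {..<k}"
    using assms(1) unfolding cyclic_interval_def by blast
  have index: "\<exists>t<k. [v = a + int t] (mod int n)" if "v \<in> A" for v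
  proof -
    have "v mod int n \<in> (\<lambda>j. (a + int j) mod int n) ` {..<k}" using that A by blast
    then show ?thesis by (auto simp: cong_def)
  qed
  have elem: "\<exists>z\<in>A. [z = a + int t] (mod int n)" if "t < k" for t
  proof -
    have "(a + int t) mod int n \<in> (\<lambda>x. x mod int n) ` A" unfolding A using that by blast
    then show ?thesis by (auto simp: cong_def)
  qed
  obtain t where t: "t < k" "[x = a + int t] (mod int n)" using index[OF assms(2)] by blast
  obtain r where r: "r < k" "[y = a + int r] (mod int n)" using index[OF assms(3)] by blast
  show ?thesis
  proof (cases "t = 0")
    case True
    then have "r \<noteq> 0" using t r assms(4) by (metis cong_sym cong_trans)
    then obtain z where z: "z \<in> A" "[z = a + int 1] (mod int n)" using elem[of 1] r(1) by auto
    moreover have "[x + 1 = a + int 1] (mod int n)"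
      using cong_add[OF t(2) cong_refl[of 1]] True by simp
    ultimately show ?thesis using that by (meson cong_sym cong_trans)
  next
    case False
    then obtain z where z: "z \<in> A" "[z = a + int (t - 1)] (mod int n)"
      using elem[of "t - 1"] t(1) by (meson less_imp_diff_less)
    moreover have "[x - 1 = a + int (t - 1)] (mod int n)"
      using cong_diff[OF t(2) cong_refl[of 1]] False by (simp add: of_nat_diff add_diff_eq)
    ultimately show ?thesis using that by (meson cong_sym cong_trans)
  qed
qed

section \<open>Signed arc permutations\<close>

definition pluses :: "(nat \<Rightarrow> bool) \<Rightarrow> nat \<Rightarrow> int" where
  "pluses e i = int (card {j \<in> {1..<i}. e j})"

abbreviation minuses :: "(nat \<Rightarrow> bool) \<Rightarrow> nat \<Rightarrow> int" where
  "minuses e \<equiv> pluses (\<lambda>j. \<not> e j)"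

text \<open>The unbarred letters are \<open>b, b + 1, \<dots>\<close> and the barred ones \<open>b - 1, b - 2, \<dots>\<close> (modulo \<open>n\<close>),
  in the order of their positions; \<open>e\<close> tells which positions are unbarred.\<close>

definition arc_letter :: "nat \<Rightarrow> int \<Rightarrow> (nat \<Rightarrow> bool) \<Rightarrow> nat \<Rightarrow> int" where
  "arc_letter n b e i =
     (if e i then residue_rep n (b + pluses e i) else residue_rep n (b - 1 - minuses e i))"

definition arc_perm :: "nat \<Rightarrow> int \<Rightarrow> (nat \<Rightarrow> bool) \<Rightarrow> int \<Rightarrow> int" where
  "arc_perm n b e =
     odd_extension n (\<lambda>i. (if e (nat i) then 1 else - 1) * arc_letter n b e (nat i))"

definition prefix_letters :: "(int \<Rightarrow> int) \<Rightarrow> nat \<Rightarrow> int set" where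
  "prefix_letters w i = (\<lambda>j. \<bar>w (int j)\<bar>) ` {1..<i}"

lemma pluses_1: "pluses e 1 = 0"
  by (simp add: pluses_def)

lemma pluses_Suc:
  assumes "i \<ge> 1" shows "pluses e (Suc i) = pluses e i + (if e i then 1 else 0)"
proof -
  have "{j \<in> {1..<Suc i}. e j} = (if e i then insert i {j \<in> {1..<i}. e j} else {j \<in> {1..<i}. e j})"
    using assms by (auto simp: less_Suc_eq)
  then show ?thesis by (simp add: pluses_def)
qed

lemma pluses_nonneg: "pluses e i \<ge> 0"
  by (simp add: pluses_def)

lemma pluses_mono: "i \<le> j \<Longrightarrow> pluses e i \<le> pluses e j"
  unfolding pluses_def of_nat_le_iff by (rule card_mono) auto

lemma pluses_less:
  assumes "1 \<le> i" "i < j" "e i" shows "pluses e i < pluses e j"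
  using pluses_mono[of "Suc i" j e] assms by (simp add: pluses_Suc)

lemma pluses_add_minuses: "i \<ge> 1 \<Longrightarrow> pluses e i + minuses e i = int i - 1"
proof (induction i rule: dec_induct)
  case base
  show ?case by (simp only: pluses_1)
next
  case (step i)
  then show ?case by (auto simp: pluses_Suc)
qed

lemma arc_letter_mem: "n \<ge> 1 \<Longrightarrow> arc_letter n b e i \<in> {1..int n}"
  by (simp add: arc_letter_def residue_rep_mem del: atLeastAtMost_iff)

lemma arc_letter_image:
  assumes "i \<ge> 1"
  shows "arc_letter n b e ` {1..<i} = residue_rep n ` {b - minuses e i..b + pluses e i - 1}"
  using assms
proof (induction i rule: dec_induct)
  case base
  show ?case by (simp add: pluses_1[simplified])
next
  case (step i)
  let ?I = "{b - minuses e i..b + pluses e i - 1}"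
  have "{1..<Suc i} = insert i {1..<i}" using step by auto
  then have image: "arc_letter n b e ` {1..<Suc i}
      = insert (arc_letter n b e i) (residue_rep n ` ?I)"
    using step by simp
  have nonneg: "pluses e i \<ge> 0" "minuses e i \<ge> 0" by (rule pluses_nonneg)+
  show ?case
  proof (cases "e i")
    case True
    then have "{b - minuses e (Suc i)..b + pluses e (Suc i) - 1} = insert (b + pluses e i) ?I"
      using step nonneg by (auto simp: pluses_Suc)
    then show ?thesis using image True by (simp add: arc_letter_def)
  next
    case False
    then have "{b - minuses e (Suc i)..b + pluses e (Suc i) - 1} = insert (b - 1 - minuses e i) ?I"
      using step nonneg by (auto simp: pluses_Suc)
    then show ?thesis using image False by (simp add: arc_letter_def)
  qed
qed

lemma arc_letter_inj_on:
  assumes "n \<ge> 1" shows "inj_on (arc_letter n b e) {1..n}"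
proof (rule eq_card_imp_inj_on)
  have size: "b + pluses e (Suc n) - 1 = b - minuses e (Suc n) + int n - 1"
    using pluses_add_minuses[of "Suc n" e] by simp
  have "arc_letter n b e ` {1..<Suc n} = {1..int n}"
    unfolding arc_letter_image[OF le_SucI[OF assms]] size
    by (rule residue_rep_image_interval[OF assms])
  then show "card (arc_letter n b e ` {1..n}) = card {1..n}"
    by (simp add: atLeastLessThanSuc_atLeastAtMost)
qed simp

lemma arc_perm_apply:
  "i \<in> {1..n} \<Longrightarrow> arc_perm n b e (int i) = (if e i then 1 else - 1) * arc_letter n b e i"
  unfolding arc_perm_def by (simp add: odd_extension_def)

lemma arc_perm_mem_signed_perms:
  assumes "n \<ge> 1" shows "arc_perm n b e \<in> signed_perms n"
  unfolding arc_perm_def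
proof (rule odd_extension_mem_signed_perms)
  have abs: "\<bar>(if e (nat i) then 1 else - 1) * arc_letter n b e (nat i)\<bar>
      = arc_letter n b e (nat i)" for i
    using arc_letter_mem[OF assms, of b e "nat i"] by (auto simp: abs_mult)
  show "\<bar>(if e (nat i) then 1 else - 1) * arc_letter n b e (nat i)\<bar> \<in> {1..int n}" for i
    unfolding abs by (rule arc_letter_mem[OF assms])
  have "inj_on (arc_letter n b e \<circ> nat) {1..int n}"
  proof (rule comp_inj_on)
    show "inj_on (arc_letter n b e) (nat ` {1..int n})"
      by (rule inj_on_subset[OF arc_letter_inj_on[OF assms]]) auto
  qed (auto intro!: inj_onI)
  then show "inj_on (\<lambda>i. \<bar>(if e (nat i) then 1 else - 1) * arc_letter n b e (nat i)\<bar>) {1..int n}"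
    unfolding abs by (simp add: comp_def)
qed

lemma abs_arc_perm: "i \<in> {1..n} \<Longrightarrow> \<bar>arc_perm n b e (int i)\<bar> = arc_letter n b e i"
  using arc_letter_mem[of n b e i] by (simp add: arc_perm_apply abs_mult)

lemma arc_perm_pos_iff: "i \<in> {1..n} \<Longrightarrow> 0 < arc_perm n b e (int i) \<longleftrightarrow> e i"
  using arc_letter_mem[of n b e i] by (simp add: arc_perm_apply)

lemma prefix_letters_subset:
  "w \<in> signed_perms n \<Longrightarrow> i \<le> Suc n \<Longrightarrow> prefix_letters w i \<subseteq> {1..int n}"
  using signed_perms_abs_mem_iff[of w n] by (force simp: prefix_letters_def)

lemma prefix_letters_Suc:
  "i \<ge> 1 \<Longrightarrow> prefix_letters w (Suc i) = insert \<bar>w (int i)\<bar> (prefix_letters w i)"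
  unfolding prefix_letters_def by (auto simp: less_Suc_eq)

lemma signed_perms_letter_notin_prefix:
  assumes "w \<in> signed_perms n" "i \<in> {1..n}" shows "\<bar>w (int i)\<bar> \<notin> prefix_letters w i"
proof
  assume "\<bar>w (int i)\<bar> \<in> prefix_letters w i"
  then obtain j where "j \<in> {1..<i}" "\<bar>w (int i)\<bar> = \<bar>w (int j)\<bar>"
    unfolding prefix_letters_def by blast
  then show False using inj_onD[OF inj_on_abs_signed_perm[OF assms(1)], of "int i" "int j"] assms(2)
    by simp
qed

lemma prefix_letters_last:
  assumes "w \<in> signed_perms n" "n \<ge> 1" shows "prefix_letters w n = {1..int n} - {\<bar>w (int n)\<bar>}"
proof -
  have "prefix_letters w (Suc n) = (\<lambda>i. \<bar>w i\<bar>) ` int ` {1..n}"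
    unfolding prefix_letters_def by (simp add: image_image atLeastLessThanSuc_atLeastAtMost)
  also have "\<dots> = {1..int n}"
    using abs_image_signed_perm[OF assms(1)] by (simp add: image_int_atLeastAtMost)
  finally show ?thesis
    using signed_perms_letter_notin_prefix[OF assms(1), of n] assms(2)
    by (simp add: prefix_letters_Suc) blast
qed

lemma signed_arc_perms_iff:
  assumes "n \<ge> 1"
  shows "w \<in> signed_arc_perms n \<longleftrightarrow> w \<in> signed_perms n \<and>
    (\<forall>i\<in>{2..n - 1}. cyclic_interval n (prefix_letters w i) \<and>
      (residue_rep n (\<bar>w (int i)\<bar> - 1) \<in> prefix_letters w i \<longrightarrow> w (int i) > 0) \<and>
      (residue_rep n (\<bar>w (int i)\<bar> + 1) \<in> prefix_letters w i \<longrightarrow> w (int i) < 0))"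
proof (cases "w \<in> signed_perms n")
  case True
  have prefix: "(\<lambda>j. \<bar>w j\<bar>) ` {1..int i - 1} = prefix_letters w i" if "i \<ge> 1" for i
  proof -
    have "{1..int i - 1} = int ` {1..<i}"
      using that
      by (simp add: image_int_atLeastLessThan atLeastLessThanPlusOne_atLeastAtMost_int[symmetric])
    then show ?thesis by (simp add: prefix_letters_def image_image)
  qed
  have "{2..int n - 1} = int ` {2..n - 1}"
    using assms by (simp add: image_int_atLeastAtMost of_nat_diff)
  then show ?thesis
    unfolding signed_arc_perms_def Let_def using True
    by (simp only: mem_Collect_eq simp_thms ball_simps)
      (intro ball_cong refl, subst (1 2) residue_rep_mem_iff[OF prefix_letters_subset[OF True]],
        auto simp: prefix)
next
  case False
  then show ?thesis by (simp add: signed_arc_perms_def)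
qed

lemma
  assumes "w \<in> signed_arc_perms n" "i \<in> {2..n - 1}"
  shows cyclic_interval_prefix_letters: "cyclic_interval n (prefix_letters w i)"
    and signed_arc_perm_pos: "residue_rep n (\<bar>w (int i)\<bar> - 1) \<in> prefix_letters w i \<Longrightarrow> w (int i) > 0"
    and signed_arc_perm_neg: "residue_rep n (\<bar>w (int i)\<bar> + 1) \<in> prefix_letters w i \<Longrightarrow> w (int i) < 0"
  using assms signed_arc_perms_iff[of n w] by auto

lemma signed_arc_perms_subset: "signed_arc_perms n \<subseteq> signed_perms n"
  by (auto simp: signed_arc_perms_def)

lemma finite_signed_arc_perms: "finite (signed_arc_perms n)"
  by (rule finite_subset[OF signed_arc_perms_subset signed_perms.finite])

lemma prefix_letters_eq_arc_letter_image:
  assumes "\<And>j. j \<in> {1..<i} \<Longrightarrow> \<bar>w (int j)\<bar> = arc_letter n b e j" "i \<ge> 1"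
  shows "prefix_letters w i = residue_rep n ` {b - minuses e i..b + pluses e i - 1}"
  unfolding prefix_letters_def arc_letter_image[OF assms(2), symmetric]
  using assms(1) by (rule image_cong[OF refl])

lemma prefix_letters_arc_perm:
  assumes "i \<in> {1..n}"
  shows "prefix_letters (arc_perm n b e) i = residue_rep n ` {b - minuses e i..b + pluses e i - 1}"
  using assms by (intro prefix_letters_eq_arc_letter_image abs_arc_perm) auto

lemma residue_rep_notin_prefix_letters_arc_perm:
  assumes i: "i \<in> {2..n - 1}" and x: "x = b - minuses e i - 2 \<or> x = b + pluses e i + 1"
  shows "residue_rep n x \<notin> prefix_letters (arc_perm n b e) i"
proof
  let ?lo = "b - minuses e i" and ?hi = "b + pluses e i - 1"
  have i_le: "i \<in> {1..n}" "int i < int n" using i by auto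
  have size: "pluses e i + minuses e i = int i - 1" using i_le by (intro pluses_add_minuses) simp
  have nonneg: "pluses e i \<ge> 0" "minuses e i \<ge> 0" by (rule pluses_nonneg)+
  assume "residue_rep n x \<in> prefix_letters (arc_perm n b e) i"
  then have "residue_rep n x \<in> residue_rep n ` {?lo..?hi}"
    unfolding prefix_letters_arc_perm[OF i_le(1)] .
  then have "x \<in> {?lo..?hi}"
    using x size nonneg i_le(2) by (subst (asm) residue_rep_mem_image_iff) auto
  then show False using x by auto
qed

lemma arc_perm_mem_signed_arc_perms:
  assumes "n \<ge> 2" shows "arc_perm n b e \<in> signed_arc_perms n"
proof -
  let ?w = "arc_perm n b e"
  have "cyclic_interval n (prefix_letters ?w i)
      \<and> (residue_rep n (\<bar>?w (int i)\<bar> - 1) \<in> prefix_letters ?w i \<longrightarrow> ?w (int i) > 0)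
      \<and> (residue_rep n (\<bar>?w (int i)\<bar> + 1) \<in> prefix_letters ?w i \<longrightarrow> ?w (int i) < 0)"
    if i: "i \<in> {2..n - 1}" for i
  proof (intro conjI impI)
    have i_le: "i \<in> {1..n}" using i by auto
    note outside = residue_rep_notin_prefix_letters_arc_perm[OF i]
    show "cyclic_interval n (prefix_letters ?w i)"
      unfolding prefix_letters_arc_perm[OF i_le] by (rule cyclic_interval_residue_rep)
    show "?w (int i) > 0" if "residue_rep n (\<bar>?w (int i)\<bar> - 1) \<in> prefix_letters ?w i"
    proof (rule ccontr)
      assume "\<not> ?w (int i) > 0"
      then have "\<bar>?w (int i)\<bar> = residue_rep n (b - 1 - minuses e i)"
        by (simp add: arc_perm_pos_iff[OF i_le] abs_arc_perm[OF i_le] arc_letter_def)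
      then have "residue_rep n (\<bar>?w (int i)\<bar> - 1) = residue_rep n (b - minuses e i - 2)"
        by (simp add: residue_rep_diff algebra_simps)
      then show False using that outside by simp
    qed
    show "?w (int i) < 0" if "residue_rep n (\<bar>?w (int i)\<bar> + 1) \<in> prefix_letters ?w i"
    proof -
      have "\<not> e i"
      proof
        assume "e i"
        then have "\<bar>?w (int i)\<bar> = residue_rep n (b + pluses e i)"
          by (simp add: abs_arc_perm[OF i_le] arc_letter_def)
        then have "residue_rep n (\<bar>?w (int i)\<bar> + 1) = residue_rep n (b + pluses e i + 1)"
          by (simp add: residue_rep_add)
        then show False using that outside by simp
      qed
      then show ?thesis
        using arc_letter_mem[of n b e i] assms by (simp add: arc_perm_apply[OF i_le])
    qed
  qed
  then show ?thesis using arc_perm_mem_signed_perms assms by (simp add: signed_arc_perms_iff)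
qed

lemma signed_arc_perm_neighbour:
  assumes w: "w \<in> signed_arc_perms n" and i: "i \<in> {2..n - 1}"
  shows "residue_rep n (\<bar>w (int i)\<bar> - 1) \<in> prefix_letters w i
    \<or> residue_rep n (\<bar>w (int i)\<bar> + 1) \<in> prefix_letters w i"
proof -
  have signed: "w \<in> signed_perms n" using w signed_arc_perms_subset by blast
  have n: "n \<ge> 2" "i \<in> {1..n}" using i by auto
  let ?A = "prefix_letters w (Suc i)"
  have A: "?A = insert \<bar>w (int i)\<bar> (prefix_letters w i)" using i by (intro prefix_letters_Suc) simp
  have A_subset: "?A \<subseteq> {1..int n}" using n(2) by (intro prefix_letters_subset[OF signed]) simp
  have "cyclic_interval n ?A"
  proof (cases "Suc i = n")
    case True
    have "\<bar>w (int n)\<bar> \<in> {1..int n}" using signed_perms_abs_mem_iff[OF signed] n(1) by simp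
    then show ?thesis
      unfolding True prefix_letters_last[OF signed order_trans[OF one_le_numeral n(1)]]
      by (rule cyclic_interval_Diff_singleton)
  next
    case False
    then show ?thesis using i by (intro cyclic_interval_prefix_letters[OF w]) auto
  qed
  moreover have "\<bar>w 1\<bar> \<in> prefix_letters w i" using i by (force simp: prefix_letters_def)
  moreover have "\<not> [\<bar>w (int i)\<bar> = \<bar>w 1\<bar>] (mod int n)"
    using calculation(2) signed_perms_letter_notin_prefix[OF signed n(2)] A_subset A
    by (metis insert_iff residue_rep_eq_iff residue_rep_id subsetD)
  ultimately obtain z where z: "z \<in> ?A"
    "[z = \<bar>w (int i)\<bar> - 1] (mod int n) \<or> [z = \<bar>w (int i)\<bar> + 1] (mod int n)"
    using cyclic_interval_neighbour[of n ?A "\<bar>w (int i)\<bar>" "\<bar>w 1\<bar>"] A by blast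
  have rep: "residue_rep n x = x" if "x \<in> ?A" for x using residue_rep_id that A_subset by blast
  have z_cases: "z = residue_rep n (\<bar>w (int i)\<bar> - 1) \<or> z = residue_rep n (\<bar>w (int i)\<bar> + 1)"
    using z(2) unfolding residue_rep_eq_iff[symmetric] rep[OF z(1)] .
  have "residue_rep n \<bar>w (int i)\<bar> = \<bar>w (int i)\<bar>" using rep A by blast
  then have "z \<noteq> \<bar>w (int i)\<bar>"
    using z_cases residue_rep_Suc_neq[OF n(1)] residue_rep_pred_neq[OF n(1)] by metis
  then show ?thesis using z(1) z_cases A by blast
qed

lemma signed_arc_perm_next_letter:
  assumes w: "w \<in> signed_arc_perms n" and i: "i \<in> {2..n - 1}"
    and prefix: "prefix_letters w i = residue_rep n ` {lo..hi}"
  shows "\<bar>w (int i)\<bar> = residue_rep n (if 0 < w (int i) then hi + 1 else lo - 1)"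
proof -
  have signed: "w \<in> signed_perms n" using w signed_arc_perms_subset by blast
  have i_le: "i \<in> {1..n}" using i by auto
  let ?a = "\<bar>w (int i)\<bar>"
  have rep: "residue_rep n ?a = ?a"
    using signed_perms_abs_mem_iff[OF signed] i_le by (intro residue_rep_id) simp
  have new: "residue_rep n x \<noteq> ?a" if "x \<in> {lo..hi}" for x
    using signed_perms_letter_notin_prefix[OF signed i_le] imageI[OF that, of "residue_rep n"]
    unfolding prefix by auto
  show ?thesis
    using signed_arc_perm_neighbour[OF w i]
  proof
    assume pred: "residue_rep n (?a - 1) \<in> prefix_letters w i"
    then have pos: "0 < w (int i)" by (rule signed_arc_perm_pos[OF w i])
    obtain x where x: "x \<in> {lo..hi}" "residue_rep n (?a - 1) = residue_rep n x"
      using pred unfolding prefix by blast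
    have "?a = residue_rep n (residue_rep n (?a - 1) + 1)" using rep by (simp add: residue_rep_add)
    also have "\<dots> = residue_rep n (x + 1)" unfolding x(2) by (rule residue_rep_add)
    finally have "?a = residue_rep n (x + 1)" .
    moreover from this have "x + 1 \<notin> {lo..hi}" using new by metis
    then have "x = hi" using x(1) by auto
    ultimately show ?thesis using pos by simp
  next
    assume succ: "residue_rep n (?a + 1) \<in> prefix_letters w i"
    then have neg: "\<not> 0 < w (int i)" using signed_arc_perm_neg[OF w i] by simp
    obtain x where x: "x \<in> {lo..hi}" "residue_rep n (?a + 1) = residue_rep n x"
      using succ unfolding prefix by blast
    have "?a = residue_rep n (residue_rep n (?a + 1) - 1)" using rep by (simp add: residue_rep_diff)
    also have "\<dots> = residue_rep n (x - 1)" unfolding x(2) by (rule residue_rep_diff)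
    finally have "?a = residue_rep n (x - 1)" .
    moreover from this have "x - 1 \<notin> {lo..hi}" using new by metis
    then have "x = lo" using x(1) by auto
    ultimately show ?thesis using neg by simp
  qed
qed

lemma signed_perm_last_letter:
  assumes w: "w \<in> signed_perms n" and n: "n \<ge> 1"
    and prefix: "prefix_letters w n = residue_rep n ` {lo..hi}" and size: "hi = lo + int n - 2"
  shows "\<bar>w (int n)\<bar> = residue_rep n (hi + 1)" "\<bar>w (int n)\<bar> = residue_rep n (lo - 1)"
proof -
  have "\<bar>w (int n)\<bar> \<in> {1..int n}" using signed_perms_abs_mem_iff[OF w] n by simp
  also have "{1..int n} = residue_rep n ` {lo..lo + int n - 1}"
    by (rule residue_rep_image_interval[OF n, symmetric])
  also have "{lo..lo + int n - 1} = insert (hi + 1) {lo..hi}" using n size by auto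
  finally show "\<bar>w (int n)\<bar> = residue_rep n (hi + 1)"
    using signed_perms_letter_notin_prefix[OF w, of n] n unfolding prefix by auto
  also have "\<dots> = residue_rep n (lo - 1)"
    unfolding residue_rep_eq_iff size by (simp add: cong_iff_dvd_diff)
  finally show "\<bar>w (int n)\<bar> = residue_rep n (lo - 1)" .
qed

lemma signed_arc_perm_letters:
  assumes n: "n \<ge> 2" and w: "w \<in> signed_arc_perms n"
    and e: "\<And>i. i \<in> {1..n} \<Longrightarrow> e i \<longleftrightarrow> 0 < w (int i)"
    and b: "b = (if e 1 then \<bar>w 1\<bar> else residue_rep n (\<bar>w 1\<bar> + 1))"
    and "i \<in> {1..n}"
  shows "\<bar>w (int i)\<bar> = arc_letter n b e i"
  using \<open>i \<in> {1..n}\<close>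
proof (induction i rule: less_induct)
  case (less i)
  have signed: "w \<in> signed_perms n" using w signed_arc_perms_subset by blast
  have prefix: "prefix_letters w i = residue_rep n ` {b - minuses e i..b + pluses e i - 1}"
    using less by (intro prefix_letters_eq_arc_letter_image) auto
  have size: "pluses e i + minuses e i = int i - 1"
    using less.prems by (intro pluses_add_minuses) simp
  consider "i = 1" | "i \<in> {2..n - 1}" | "i = n" using less.prems by fastforce
  then show ?case
  proof cases
    case 1
    have "\<bar>w 1\<bar> \<in> {1..int n}" using signed_perms_abs_mem_iff[OF signed] n by simp
    then show ?thesis
      using residue_rep_diff[of n "\<bar>w 1\<bar> + 1" 1]
      by (simp add: 1 b arc_letter_def pluses_1[simplified] residue_rep_id)
  next
    case 2
    then show ?thesis
      using signed_arc_perm_next_letter[OF w 2 prefix] e[OF less.prems]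
      by (simp add: arc_letter_def algebra_simps)
  next
    case 3
    then have "prefix_letters w n = residue_rep n ` {b - minuses e n..b + pluses e n - 1}"
      using prefix by simp
    from signed_perm_last_letter[OF signed _ this] show ?thesis
      using n size by (simp add: 3 arc_letter_def algebra_simps)
  qed
qed

lemma signed_arc_perm_eq_arc_perm:
  assumes n: "n \<ge> 2" and w: "w \<in> signed_arc_perms n"
  obtains b e where "b \<in> {1..int n}" "e \<in> {1..n} \<rightarrow>\<^sub>E UNIV" "w = arc_perm n b e"
proof -
  define e where "e = (\<lambda>i\<in>{1..n}. 0 < w (int i))"
  define b where "b = (if e 1 then \<bar>w 1\<bar> else residue_rep n (\<bar>w 1\<bar> + 1))"
  have signed: "w \<in> signed_perms n" using w signed_arc_perms_subset by blast
  have e: "e i \<longleftrightarrow> 0 < w (int i)" if "i \<in> {1..n}" for i using that by (simp add: e_def)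
  have letters: "\<bar>w (int i)\<bar> = arc_letter n b e i" if "i \<in> {1..n}" for i
    by (rule signed_arc_perm_letters[OF n w], rule e, assumption, rule b_def, rule that)
  show ?thesis
  proof
    show "e \<in> {1..n} \<rightarrow>\<^sub>E UNIV" by (simp add: e_def)
    show "b \<in> {1..int n}"
      using signed_perms_abs_mem_iff[OF signed, of 1] residue_rep_mem[of n "\<bar>w 1\<bar> + 1"] n
      by (simp add: b_def)
    show "w = arc_perm n b e"
    proof (rule signed_perms_eqI[OF signed arc_perm_mem_signed_perms])
      fix x assume "x \<in> {1..int n}"
      then have "x = int (nat x)" "nat x \<in> {1..n}" by auto
      then obtain i where i: "x = int i" "i \<in> {1..n}" by blast
      have "w (int i) = (if e i then 1 else - 1) * \<bar>w (int i)\<bar>" using e[OF i(2)] by auto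
      then show "w x = arc_perm n b e x"
        by (simp add: i(1) letters[OF i(2)] arc_perm_apply[OF i(2)])
    qed (use n in simp)
  qed
qed

lemma bij_betw_arc_perm:
  assumes n: "n \<ge> 2"
  shows "bij_betw (\<lambda>(e, b). arc_perm n b e) (({1..n} \<rightarrow>\<^sub>E UNIV) \<times> {1..int n}) (signed_arc_perms n)"
proof (rule bij_betw_imageI)
  show "inj_on (\<lambda>(e, b). arc_perm n b e) (({1..n} \<rightarrow>\<^sub>E UNIV) \<times> {1..int n})"
  proof (rule inj_onI, clarify)
    fix e e' :: "nat \<Rightarrow> bool" and b b'
    assume e: "e \<in> {1..n} \<rightarrow>\<^sub>E UNIV" "e' \<in> {1..n} \<rightarrow>\<^sub>E UNIV" and b: "b \<in> {1..int n}" "b' \<in> {1..int n}"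
      and eq: "arc_perm n b e = arc_perm n b' e'"
    have "e = e'" by (rule PiE_ext[OF e]) (metis arc_perm_pos_iff eq)
    moreover have "1 \<in> {1..n}" using n by simp
    ultimately have "arc_letter n b e 1 = arc_letter n b' e 1" using abs_arc_perm eq by metis
    then have "[b = b'] (mod int n)"
      by (cases "e 1")
        (simp_all add: arc_letter_def pluses_1[simplified] residue_rep_eq_iff cong_iff_dvd_diff)
    then have "b = b'" using b by (intro cong_eq_of_bounds) auto
    then show "e = e' \<and> b = b'" using \<open>e = e'\<close> by simp
  qed
  show "(\<lambda>(e, b). arc_perm n b e) ` (({1..n} \<rightarrow>\<^sub>E UNIV) \<times> {1..int n}) = signed_arc_perms n"
  proof (intro equalityI subsetI)
    fix w assume "w \<in> signed_arc_perms n"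
    then obtain b e where "b \<in> {1..int n}" "e \<in> {1..n} \<rightarrow>\<^sub>E UNIV" "w = arc_perm n b e"
      using signed_arc_perm_eq_arc_perm[OF n] by blast
    then show "w \<in> (\<lambda>(e, b). arc_perm n b e) ` (({1..n} \<rightarrow>\<^sub>E UNIV) \<times> {1..int n})"
      by (intro image_eqI[of _ _ "(e, b)"]) auto
  qed (use arc_perm_mem_signed_arc_perms[OF n] in auto)
qed

section \<open>The signed descent sets of the signed arc permutations\<close>

definition arc_descents :: "nat \<Rightarrow> (nat \<Rightarrow> bool) \<Rightarrow> nat set \<Rightarrow> nat set" where
  "arc_descents n e T = {n} \<union> {s \<in> {1..n - 1}. e s \<noteq> e (s + 1) \<or> (e s \<longleftrightarrow> s \<in> T)}"

definition arc_signs :: "nat \<Rightarrow> (nat \<Rightarrow> bool) \<Rightarrow> nat \<Rightarrow> int" where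
  "arc_signs n e s = (if s \<in> {1..n} \<and> \<not> e s then - 1 else 1)"

abbreviation arc_sDes :: "nat \<Rightarrow> (nat \<Rightarrow> bool) \<Rightarrow> nat set \<Rightarrow> signed_set" where
  "arc_sDes n e T \<equiv> (arc_descents n e T, arc_signs n e)"

text \<open>The value of \<open>b\<close>, modulo \<open>n\<close>, for which the letters in the positions \<open>s\<close> and \<open>s + 1\<close> of
  \<^term>\<open>arc_perm n b e\<close> are \<open>n\<close> and \<open>1\<close> (in either order), provided that they have equal signs.\<close>

definition wrap_shift :: "(nat \<Rightarrow> bool) \<Rightarrow> nat \<Rightarrow> int" where
  "wrap_shift e s = (if e s then - pluses e s else 2 + minuses e s)"

definition plateaus :: "nat \<Rightarrow> (nat \<Rightarrow> bool) \<Rightarrow> nat set" where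
  "plateaus n e = {s \<in> {1..n - 1}. e s = e (Suc s)}"

lemma arc_descents_cong:
  "T \<inter> plateaus n e = T' \<inter> plateaus n e \<Longrightarrow> arc_descents n e T = arc_descents n e T'"
  unfolding arc_descents_def plateaus_def by auto

lemma less_r_descent_iff:
  assumes "a \<noteq> 0" "b \<noteq> 0"
  shows "less_r b a \<or> (a < 0 \<and> b > 0) \<longleftrightarrow> (0 < a) \<noteq> (0 < b) \<or> \<bar>b\<bar> < \<bar>a\<bar>"
  using assms by (auto simp: less_r_def)

lemma arc_letter_descent_iff:
  assumes n: "n \<ge> 2" and s: "s \<in> plateaus n e"
  shows "arc_letter n b e (Suc s) < arc_letter n b e s \<longleftrightarrow> (e s \<longleftrightarrow> [b = wrap_shift e s] (mod int n))"
proof (cases "e s")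
  case True
  then show ?thesis
    using s residue_rep_Suc_less_iff[OF n, of "b + pluses e s"]
    by (simp add: plateaus_def wrap_shift_def arc_letter_def pluses_Suc cong_iff_dvd_diff add.assoc)
next
  case False
  let ?x = "b - 2 - minuses e s"
  have "arc_letter n b e s = residue_rep n (?x + 1)" "arc_letter n b e (Suc s) = residue_rep n ?x"
    using False s by (simp_all add: plateaus_def arc_letter_def pluses_Suc algebra_simps)
  then have "arc_letter n b e (Suc s) < arc_letter n b e s \<longleftrightarrow> \<not> int n dvd ?x"
    using residue_rep_Suc_less_iff[OF n, of ?x] residue_rep_Suc_neq[OF n, of ?x] by auto
  then show ?thesis using False by (simp add: wrap_shift_def cong_iff_dvd_diff diff_diff_eq)
qed

lemma sDes_arc_perm:
  assumes n: "n \<ge> 2"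
  shows "sDes n (arc_perm n b e) = arc_sDes n e {s. [b = wrap_shift e s] (mod int n)}"
proof -
  let ?w = "arc_perm n b e" and ?T = "{s. [b = wrap_shift e s] (mod int n)}"
  have signed: "?w \<in> signed_perms n" using arc_perm_mem_signed_perms n by simp
  have "(if ?w (int s) < 0 then - 1 else 1) = arc_signs n e s" for s
  proof (cases "s \<in> {1..n}")
    case True
    have "1 \<le> arc_letter n b e s" using arc_letter_mem[of n b e s] n by simp
    then show ?thesis using True arc_perm_apply[OF True, of b e] by (simp add: arc_signs_def)
  next
    case False
    then have "?w (int s) = int s" by (intro signed_perms_outside[OF signed]) auto
    then show ?thesis using False by (auto simp: arc_signs_def)
  qed
  moreover have "less_r (?w (int s + 1)) (?w (int s)) \<or> (?w (int s) < 0 \<and> ?w (int s + 1) > 0)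
      \<longleftrightarrow> e s \<noteq> e (s + 1) \<or> (e s \<longleftrightarrow> s \<in> ?T)" if s: "s \<in> {1..n - 1}" for s
  proof -
    have s_le: "s \<in> {1..n}" "Suc s \<in> {1..n}" using s by auto
    have Suc: "int s + 1 = int (Suc s)" by simp
    have nonzero: "?w (int i) \<noteq> 0" if "i \<in> {1..n}" for i
      using that signed_perms_eq_0_iff[OF signed, of "int i"] by simp
    have "less_r (?w (int s + 1)) (?w (int s)) \<or> (?w (int s) < 0 \<and> ?w (int s + 1) > 0)
        \<longleftrightarrow> e s \<noteq> e (Suc s) \<or> arc_letter n b e (Suc s) < arc_letter n b e s"
      unfolding Suc less_r_descent_iff[OF nonzero[OF s_le(1)] nonzero[OF s_le(2)]]
      by (simp only: arc_perm_pos_iff[OF s_le(1)] arc_perm_pos_iff[OF s_le(2)]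
          abs_arc_perm[OF s_le(1)] abs_arc_perm[OF s_le(2)])
    also have "\<dots> \<longleftrightarrow> e s \<noteq> e (s + 1) \<or> (e s \<longleftrightarrow> s \<in> ?T)"
      using arc_letter_descent_iff[OF n, of s e b] s unfolding plateaus_def by auto
    finally show ?thesis .
  qed
  ultimately show ?thesis
    unfolding sDes_def arc_descents_def
    by (intro arg_cong2[of _ _ _ _ Pair] arg_cong[of _ _ "(\<union>) {n}"] Collect_cong ext) blast+
qed

lemma pluses_plateau:
  assumes "s \<in> {1..n - 1}" "e s" "e (Suc s)" shows "pluses e s + 2 \<le> pluses e (Suc n)"
proof -
  have "pluses e s + 2 = pluses e (Suc (Suc s))" using assms by (simp add: pluses_Suc)
  also have "\<dots> \<le> pluses e (Suc n)" using assms by (intro pluses_mono) auto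
  finally show ?thesis .
qed

lemma wrap_shift_bounds:
  assumes "s \<in> plateaus n e"
  shows "wrap_shift e s \<in> {2 - pluses e (Suc n)..minuses e (Suc n)}"
proof (cases "e s")
  case True
  then show ?thesis
    using assms pluses_plateau[of s n e] pluses_nonneg[of e s]
      pluses_nonneg[of "\<lambda>j. \<not> e j" "Suc n"]
    by (auto simp: plateaus_def wrap_shift_def)
next
  case False
  then show ?thesis
    using assms pluses_plateau[of s n "\<lambda>j. \<not> e j"] pluses_nonneg[of e "Suc n"]
      pluses_nonneg[of "\<lambda>j. \<not> e j" s]
    by (auto simp: plateaus_def wrap_shift_def)
qed

lemma inj_on_wrap_shift: "inj_on (\<lambda>s. residue_rep n (wrap_shift e s)) (plateaus n e)"
proof (rule inj_onI)
  fix s t assume s: "s \<in> plateaus n e" and t: "t \<in> plateaus n e"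
    and "residue_rep n (wrap_shift e s) = residue_rep n (wrap_shift e t)"
  then have "[wrap_shift e s = wrap_shift e t] (mod int n)" by (simp only: residue_rep_eq_iff)
  moreover have "\<bar>wrap_shift e s - wrap_shift e t\<bar> < int n"
    using wrap_shift_bounds[OF s] wrap_shift_bounds[OF t] pluses_add_minuses[of "Suc n" e] by auto
  ultimately have eq: "wrap_shift e s = wrap_shift e t" by (rule cong_eq_of_bounds)
  then have sign: "e s = e t"
    using pluses_nonneg[of e s] pluses_nonneg[of e t] pluses_nonneg[of "\<lambda>j. \<not> e j" s]
      pluses_nonneg[of "\<lambda>j. \<not> e j" t] by (auto simp: wrap_shift_def split: if_splits)
  have "s \<ge> 1" "t \<ge> 1" using s t by (auto simp: plateaus_def)
  then have "\<not> s < t" "\<not> t < s"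
    using eq sign pluses_less[of s t e] pluses_less[of t s e]
      pluses_less[of s t "\<lambda>j. \<not> e j"] pluses_less[of t s "\<lambda>j. \<not> e j"]
    by (auto simp: wrap_shift_def split: if_splits)
  then show "s = t" by simp
qed

lemma sum_eq_of_partial_injection:
  fixes f :: "'b \<Rightarrow> 'c :: comm_monoid_add"
  assumes "finite A" "finite B" "card A = card B" "Q \<subseteq> A" "inj_on r Q" "r ` Q \<subseteq> B"
    and on: "\<And>s. s \<in> Q \<Longrightarrow> f (r s) = g s"
    and off: "\<And>b. b \<in> B - r ` Q \<Longrightarrow> f b = z" "\<And>s. s \<in> A - Q \<Longrightarrow> g s = z"
  shows "sum f B = sum g A"
proof -
  have "card (B - r ` Q) = card (A - Q)"
    using assms(1-6) by (simp add: card_Diff_subset card_image finite_subset)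
  then obtain h where h: "bij_betw h (A - Q) (B - r ` Q)"
    using finite_same_card_bij[of "A - Q" "B - r ` Q"] assms(1,2) by auto
  have "sum f B = sum f (r ` Q) + sum f (B - r ` Q)"
    using assms(2,6) by (simp add: sum.subset_diff add.commute)
  also have "sum f (r ` Q) = sum g Q" by (simp add: sum.reindex[OF assms(5)] on)
  also have "sum f (B - r ` Q) = (\<Sum>s\<in>A - Q. f (h s))"
    by (rule sum.reindex_bij_betw[OF h, symmetric])
  also have "\<dots> = sum g (A - Q)"
    using off bij_betwE[OF h] by (intro sum.cong refl) simp
  also have "sum g Q + sum g (A - Q) = sum g A"
    using assms(1,4) by (simp add: sum.subset_diff add.commute)
  finally show ?thesis .
qed

text \<open>Rotating the letters moves the step from \<open>n\<close> to \<open>1\<close> through all pairs of adjacent positions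
  of equal sign; whenever that step is not between adjacent positions, it does not affect the
  descents.\<close>

lemma sum_arc_descents_rotations:
  fixes f :: "nat set \<Rightarrow> 'c :: comm_monoid_add"
  assumes n: "n \<ge> 2"
  shows "(\<Sum>b = 1..int n. f (arc_descents n e {s. [b = wrap_shift e s] (mod int n)}))
    = (\<Sum>s = 1..n. f (arc_descents n e {s}))"
proof -
  let ?T = "\<lambda>b. {s. [b = wrap_shift e s] (mod int n)}" and ?r = "\<lambda>s. residue_rep n (wrap_shift e s)"
  have wrap_iff: "s \<in> ?T b \<longleftrightarrow> b = ?r s" if "b \<in> {1..int n}" for b s
    using residue_rep_id[OF that] residue_rep_eq_iff[of n b] by simp
  have r_mem: "?r s \<in> {1..int n}" for s using n by (intro residue_rep_mem) simp
  show ?thesis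
  proof (rule sum_eq_of_partial_injection[where Q = "plateaus n e" and r = ?r
        and z = "f (arc_descents n e {})"])
    show "inj_on ?r (plateaus n e)" by (rule inj_on_wrap_shift)
    show "f (arc_descents n e (?T (?r s))) = f (arc_descents n e {s})"
      if s: "s \<in> plateaus n e" for s
      using s wrap_iff[OF r_mem] inj_onD[OF inj_on_wrap_shift _ s]
      by (intro arg_cong[of _ _ f] arc_descents_cong) blast
    show "f (arc_descents n e (?T b)) = f (arc_descents n e {})"
      if b: "b \<in> {1..int n} - ?r ` plateaus n e" for b
      using b wrap_iff[of b] by (intro arg_cong[of _ _ f] arc_descents_cong) blast
    show "f (arc_descents n e {s}) = f (arc_descents n e {})" if "s \<in> {1..n} - plateaus n e" for s
      using that by (intro arg_cong[of _ _ f] arc_descents_cong) blast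
  qed (use r_mem in \<open>auto simp: plateaus_def\<close>)
qed

lemma sum_sDes_signed_arc_perms:
  fixes f :: "signed_set \<Rightarrow> 'c :: comm_monoid_add"
  assumes "n \<ge> 2"
  shows "(\<Sum>w\<in>signed_arc_perms n. f (sDes n w))
    = (\<Sum>e\<in>{1..n} \<rightarrow>\<^sub>E UNIV. \<Sum>s = 1..n. f (arc_sDes n e {s}))"
proof -
  have "(\<Sum>w\<in>signed_arc_perms n. f (sDes n w))
      = (\<Sum>(e, b)\<in>({1..n} \<rightarrow>\<^sub>E UNIV) \<times> {1..int n}. f (sDes n (arc_perm n b e)))"
    unfolding sum.reindex_bij_betw[OF bij_betw_arc_perm[OF assms], symmetric]
    by (simp add: case_prod_unfold)
  also have "\<dots> = (\<Sum>e\<in>{1..n} \<rightarrow>\<^sub>E UNIV. \<Sum>b = 1..int n. f (sDes n (arc_perm n b e)))"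
    by (rule sum.cartesian_product[symmetric])
  also have "\<dots> = (\<Sum>e\<in>{1..n} \<rightarrow>\<^sub>E UNIV. \<Sum>s = 1..n. f (arc_sDes n e {s}))"
    unfolding sDes_arc_perm[OF assms]
    by (intro sum.cong refl)
      (rule sum_arc_descents_rotations[OF assms, where f = "\<lambda>S. f (S, arc_signs n _)"])
  finally show ?thesis .
qed

section \<open>The weights of the signed arc permutations\<close>

lemma signed_compositions_nth_neq_0: "c \<in> signed_compositions n \<Longrightarrow> i < length c \<Longrightarrow> c ! i \<noteq> 0"
  by (auto simp: signed_compositions_def) (metis nth_mem)

lemma partial_sum_Suc: "i < length c \<Longrightarrow> partial_sum c (Suc i) = partial_sum c i + nat \<bar>c ! i\<bar>"
  by (simp add: partial_sum_def take_Suc_conv_app_nth)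

lemma partial_sum_mono: "i \<le> j \<Longrightarrow> j \<le> length c \<Longrightarrow> partial_sum c i \<le> partial_sum c j"
  by (induction j rule: dec_induct) (auto simp: partial_sum_Suc)

lemma partial_sum_strict_mono:
  assumes "c \<in> signed_compositions n" "i < k" "k \<le> length c"
  shows "partial_sum c i < partial_sum c k"
  using partial_sum_mono[of "Suc i" k c] assms partial_sum_Suc[of i c]
    signed_compositions_nth_neq_0[OF assms(1), of i] by simp

lemma partial_sum_length:
  assumes "c \<in> signed_compositions n" shows "partial_sum c (length c) = n"
proof -
  have "int (\<Sum>x\<leftarrow>c. nat \<bar>x\<bar>) = (\<Sum>x\<leftarrow>c. \<bar>x\<bar>)" by (induction c) auto
  then show ?thesis using assms by (simp add: partial_sum_def signed_compositions_def)
qed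

lemma partial_sum_image_subset:
  assumes "c \<in> signed_compositions n" shows "partial_sum c ` {1..length c} \<subseteq> {1..n}"
proof (rule image_subsetI)
  fix k assume "k \<in> {1..length c}"
  then show "partial_sum c k \<in> {1..n}"
    using partial_sum_strict_mono[OF assms, of 0 k] partial_sum_mono[of k "length c" c]
      partial_sum_length[OF assms] by (simp add: Suc_le_eq)
qed

lemma card_partial_sum_image:
  assumes "c \<in> signed_compositions n" shows "card (partial_sum c ` {1..length c}) = length c"
proof -
  have "inj_on (partial_sum c) {1..length c}"
    by (rule inj_onI)
      (metis partial_sum_strict_mono[OF assms] atLeastAtMost_iff linorder_neqE_nat less_irrefl)
  then show ?thesis by (simp add: card_image)
qed

lemma block_unique:
  assumes "i < length c" "k < length c" "j \<in> block c i" "j \<in> block c k" shows "i = k"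
proof (rule ccontr)
  assume "i \<noteq> k"
  then consider "Suc i \<le> k" | "Suc k \<le> i" by linarith
  then show False
    using assms partial_sum_mono[of "Suc i" k c] partial_sum_mono[of "Suc k" i c]
    by cases (auto simp: block_def)
qed

lemma block_exists:
  assumes "k \<le> length c" "j \<in> {1..partial_sum c k}" obtains i where "i < k" "j \<in> block c i"
  using assms
proof (induction k arbitrary: thesis)
  case 0
  then show ?case by (simp add: partial_sum_def)
next
  case (Suc k)
  show ?case
  proof (cases "j \<le> partial_sum c k")
    case True
    then show ?thesis using Suc.IH[of thesis] Suc.prems less_SucI by force
  next
    case False
    then show ?thesis using Suc.prems by (intro Suc.prems(1)[of k]) (auto simp: block_def)
  qed
qed

lemma block_subset: "c \<in> signed_compositions n \<Longrightarrow> i < length c \<Longrightarrow> block c i \<subseteq> {1..n}"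
  using partial_sum_mono[of "Suc i" "length c" c] partial_sum_length[of c n]
  by (auto simp: block_def)

lemma partial_sum_Suc_mem_block:
  "c \<in> signed_compositions n \<Longrightarrow> i < length c \<Longrightarrow> partial_sum c (Suc i) \<in> block c i"
  using signed_compositions_nth_neq_0[of c n i] by (simp add: block_def partial_sum_Suc)

definition block_interior :: "int list \<Rightarrow> nat \<Rightarrow> nat set" where
  "block_interior c i = {partial_sum c i + 1..<partial_sum c (i + 1)}"

lemma block_interior_subset: "block_interior c i \<subseteq> block c i"
  and Suc_mem_block: "j \<in> block_interior c i \<Longrightarrow> Suc j \<in> block c i"
  by (auto simp: block_interior_def block_def)

lemma block_interior_disjoint:
  "i < length c \<Longrightarrow> k < length c \<Longrightarrow> i \<noteq> k \<Longrightarrow> block_interior c i \<inter> block_interior c k = {}"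
  using block_unique block_interior_subset by blast

lemma finite_block_interior: "finite (block_interior c i)"
  and card_block_interior: "i < length c \<Longrightarrow> card (block_interior c i) = nat \<bar>c ! i\<bar> - 1"
  by (simp_all add: block_interior_def partial_sum_Suc)

lemma Union_block_interior:
  assumes "c \<in> signed_compositions n"
  shows "{1..n} - partial_sum c ` {1..length c} = (\<Union>i<length c. block_interior c i)"
proof (intro equalityI subsetI)
  fix j assume j: "j \<in> {1..n} - partial_sum c ` {1..length c}"
  then obtain i where i: "i < length c" "j \<in> block c i"
    using block_exists[of "length c" c j] partial_sum_length[OF assms] by auto
  then have "j \<noteq> partial_sum c (Suc i)" using j by auto
  then have "j \<in> block_interior c i" using i by (auto simp: block_def block_interior_def)
  then show "j \<in> (\<Union>i<length c. block_interior c i)" using i by blast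
next
  fix j assume "j \<in> (\<Union>i<length c. block_interior c i)"
  then obtain i where i: "i < length c" "j \<in> block_interior c i" by blast
  have "j \<noteq> partial_sum c k" if "k \<in> {1..length c}" for k
  proof (cases "k \<le> i")
    case True
    then show ?thesis using partial_sum_mono[of k i c] i by (auto simp: block_interior_def)
  next
    case False
    then show ?thesis
      using partial_sum_mono[of "Suc i" k c] i that by (auto simp: block_interior_def)
  qed
  moreover have "j \<in> {1..n}" using block_subset[OF assms i(1)] block_interior_subset i(2) by blast
  ultimately show "j \<in> {1..n} - partial_sum c ` {1..length c}" by blast
qed

definition block_weight :: "int list \<Rightarrow> signed_set \<Rightarrow> nat \<Rightarrow> int" where
  "block_weight c \<sigma> i =
     (if initial_segment (fst \<sigma> \<inter> block_interior c i) (block_interior c i)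
         \<and> (\<exists>x. \<forall>j\<in>block c i. sign_vector \<sigma> j = x)
      then (- 1) ^ card (fst \<sigma> \<inter> block_interior c i)
        * (if (\<forall>j\<in>block c i. sign_vector \<sigma> j = - 1) \<and> c ! i < 0 then - 1 else 1)
      else 0)"

lemma wt_eq_prod_block_weight:
  assumes "c \<in> signed_compositions n" "fst \<sigma> \<subseteq> {1..n}"
  shows "wt c \<sigma> = (\<Prod>i<length c. block_weight c \<sigma> i)"
proof (cases "\<exists>i<length c. block_weight c \<sigma> i = 0")
  case True
  then have "(\<Prod>i<length c. block_weight c \<sigma> i) = 0" by (auto intro: prod_zero)
  moreover have "wt c \<sigma> = 0"
    using True unfolding wt_def Let_def block_interior_def[symmetric]
    by (intro if_P) (auto simp: block_weight_def split: if_splits)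
  ultimately show ?thesis by simp
next
  case False
  let ?m = "length c"
  let ?barred = "\<lambda>i. (\<forall>j\<in>block c i. sign_vector \<sigma> j = - 1) \<and> c ! i < 0"
  have weight: "block_weight c \<sigma> i
      = (- 1) ^ card (fst \<sigma> \<inter> block_interior c i) * (if ?barred i then - 1 else 1)"
    if "i < ?m" for i
    using False that by (auto simp: block_weight_def split: if_splits)
  have "fst \<sigma> - partial_sum c ` {1..?m} = fst \<sigma> \<inter> ({1..n} - partial_sum c ` {1..?m})"
    using assms(2) by blast
  also have "\<dots> = (\<Union>i<?m. fst \<sigma> \<inter> block_interior c i)"
    unfolding Union_block_interior[OF assms(1)] by blast
  also have "card \<dots> = (\<Sum>i<?m. card (fst \<sigma> \<inter> block_interior c i))"
    using finite_block_interior block_interior_disjoint[of _ c] by (intro card_UN_disjoint) blast+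
  finally have "(- 1) ^ card (fst \<sigma> - partial_sum c ` {1..?m})
      = (\<Prod>i<?m. (- 1 :: int) ^ card (fst \<sigma> \<inter> block_interior c i))"
    by (simp add: power_sum)
  moreover have "(- 1 :: int) ^ card {i. i < ?m \<and> ?barred i}
      = (\<Prod>i<?m. if ?barred i then - 1 else 1)"
    by (simp add: prod.If_cases Collect_conj_eq lessThan_def)
  moreover have "wt c \<sigma>
      = (- 1) ^ (card (fst \<sigma> - partial_sum c ` {1..?m}) + card {i. i < ?m \<and> ?barred i})"
    using False unfolding wt_def Let_def block_interior_def[symmetric]
    by (intro if_not_P) (auto simp: block_weight_def split: if_splits)
  ultimately show ?thesis by (simp add: power_add weight prod.distrib)
qed

lemma sign_vector_arc_sDes:
  assumes "j \<in> {1..n}" shows "sign_vector (arc_sDes n e T) j = arc_signs n e j"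
proof -
  let ?P = "\<lambda>s. s \<in> arc_descents n e T \<and> j \<le> s"
  define t where "t = (LEAST s. ?P s)"
  have n: "?P n" using assms by (simp add: arc_descents_def)
  have t: "?P t" unfolding t_def using n by (rule LeastI)
  have t_le: "t \<le> n" unfolding t_def using n by (rule Least_le)
  have const: "arc_signs n e j = arc_signs n e i" if "j \<le> i" "i \<le> t" for i
    using that
  proof (induction i rule: dec_induct)
    case (step i)
    then have "\<not> ?P i" unfolding t_def by (intro not_less_Least) simp
    then have "i \<notin> arc_descents n e T" using step by simp
    moreover have "i \<in> {1..n - 1}" using step t_le assms by auto
    ultimately have "e i = e (Suc i)" by (simp add: arc_descents_def)
    then show ?case using step t_le assms by (simp add: arc_signs_def)
  qed simp
  have "arc_signs n e t = arc_signs n e j" using const[of t] t by simp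
  then show ?thesis unfolding sign_vector_def fst_conv snd_conv t_def .
qed

lemma initial_segment_Int_singleton: "s \<in> B \<Longrightarrow> initial_segment (B \<inter> {s}) B \<longleftrightarrow> (\<forall>x\<in>B. s \<le> x)"
  by (auto simp: initial_segment_def not_less[symmetric])

lemma initial_segment_Diff_singleton: "s \<in> B \<Longrightarrow> initial_segment (B - {s}) B \<longleftrightarrow> (\<forall>x\<in>B. x \<le> s)"
  by (auto simp: initial_segment_def not_less[symmetric])

definition sign_weight :: "int \<Rightarrow> int" where
  "sign_weight x = (- 1) ^ (nat \<bar>x\<bar> - 1) * sgn x"

definition toggle_weight :: "int list \<Rightarrow> bool \<Rightarrow> nat \<Rightarrow> nat \<Rightarrow> int" where
  "toggle_weight c p s i = (if s \<notin> block_interior c i then 1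
     else if s = (if p then partial_sum c i + 1 else partial_sum c (i + 1) - 1) then - 1 else 0)"

lemma arc_descents_Int_block_interior:
  assumes "c \<in> signed_compositions n" "i < length c" and e: "\<And>j. j \<in> block c i \<Longrightarrow> e j = p"
  shows "arc_descents n e {s} \<inter> block_interior c i
    = (if p then block_interior c i \<inter> {s} else block_interior c i - {s})"
proof -
  have "j \<in> arc_descents n e {s} \<longleftrightarrow> (p \<longleftrightarrow> j = s)" if j: "j \<in> block_interior c i" for j
  proof -
    have mem: "j \<in> block c i" "Suc j \<in> block c i"
      using block_interior_subset Suc_mem_block j by auto
    then have "j \<in> {1..n}" "Suc j \<in> {1..n}" using block_subset[OF assms(1,2)] by blast+
    then show ?thesis using e[OF mem(1)] e[OF mem(2)] by (auto simp: arc_descents_def)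
  qed
  then show ?thesis by auto
qed

lemma initial_segment_toggle_iff:
  "initial_segment (if p then block_interior c i \<inter> {s} else block_interior c i - {s})
    (block_interior c i)
    \<longleftrightarrow> toggle_weight c p s i \<noteq> 0"
proof (cases "s \<in> block_interior c i")
  case True
  let ?first = "partial_sum c i + 1" and ?last = "partial_sum c (i + 1) - 1"
  have "?first \<in> block_interior c i" "?last \<in> block_interior c i"
    using True by (auto simp: block_interior_def)
  moreover have "\<forall>x\<in>block_interior c i. ?first \<le> x \<and> x \<le> ?last" by (auto simp: block_interior_def)
  ultimately have "(\<forall>x\<in>block_interior c i. s \<le> x) \<longleftrightarrow> s = ?first"
    "(\<forall>x\<in>block_interior c i. x \<le> s) \<longleftrightarrow> s = ?last"
    using True by (metis le_antisym)+
  then show ?thesis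
    using True
    by (simp add: initial_segment_Int_singleton initial_segment_Diff_singleton toggle_weight_def
        del: Int_insert_right_if1)
next
  case False
  then show ?thesis by (auto simp: initial_segment_def toggle_weight_def)
qed

lemma minus_one_power_card_Diff_singleton:
  assumes "finite A"
  shows "(- 1 :: 'a :: ring_1) ^ card (A - {x}) = (- 1) ^ card A * (if x \<in> A then - 1 else 1)"
proof (cases "x \<in> A")
  case True
  have "(- 1 :: 'a) ^ card A = - ((- 1) ^ card (A - {x}))"
    unfolding card_Suc_Diff1[OF assms True, symmetric] by simp
  then show ?thesis using True by simp
qed simp

lemma block_weight_arc_sDes:
  assumes c: "c \<in> signed_compositions n" and i: "i < length c"
    and e: "\<And>j. j \<in> block c i \<Longrightarrow> e j = p"
  shows "block_weight c (arc_sDes n e {s}) i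
    = (if p then 1 else sign_weight (c ! i)) * toggle_weight c p s i"
proof -
  let ?B = "block_interior c i"
  have Int: "arc_descents n e {s} \<inter> ?B = (if p then ?B \<inter> {s} else ?B - {s})"
    by (rule arc_descents_Int_block_interior[OF c i]) (rule e)
  have sign: "sign_vector (arc_sDes n e {s}) j = (if p then 1 else - 1)" if "j \<in> block c i" for j
    using block_subset[OF c i] that e[OF that] sign_vector_arc_sDes[of j n e "{s}"]
    by (auto simp: arc_signs_def)
  then have const: "\<exists>x. \<forall>j\<in>block c i. sign_vector (arc_sDes n e {s}) j = x" by blast
  have negative: "(\<forall>j\<in>block c i. sign_vector (arc_sDes n e {s}) j = - 1) \<longleftrightarrow> \<not> p"
    using sign partial_sum_Suc_mem_block[OF c i] by (cases p) auto
  have initial: "initial_segment (arc_descents n e {s} \<inter> ?B) ?B \<longleftrightarrow> toggle_weight c p s i \<noteq> 0"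
    unfolding Int by (rule initial_segment_toggle_iff)
  have sign_power: "(- 1 :: int) ^ card (arc_descents n e {s} \<inter> ?B)
      = (if p then 1 else (- 1) ^ (nat \<bar>c ! i\<bar> - 1)) * (if s \<in> ?B then - 1 else 1)"
    unfolding Int using minus_one_power_card_Diff_singleton[where ?'a = int and A = ?B and x = s]
    by (simp add: finite_block_interior card_block_interior[OF i]
        del: card_Diff_insert card_Diff_singleton)
  show ?thesis
  proof (cases "toggle_weight c p s i = 0")
    case True
    then show ?thesis unfolding block_weight_def fst_conv initial by simp
  next
    case False
    then have toggle: "toggle_weight c p s i = (if s \<in> ?B then - 1 else 1)"
      by (simp add: toggle_weight_def split: if_splits)
    have "block_weight c (arc_sDes n e {s}) i
        = (- 1) ^ card (arc_descents n e {s} \<inter> ?B) * (if \<not> p \<and> c ! i < 0 then - 1 else 1)"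
      unfolding block_weight_def fst_conv initial negative using const False by simp
    then show ?thesis
      unfolding sign_power toggle using signed_compositions_nth_neq_0[OF c i]
      by (simp add: sign_weight_def sgn_if)
  qed
qed

lemma sum_toggle_weight_block_interior:
  assumes c: "c \<in> signed_compositions n" and i: "i < length c"
  shows "(\<Sum>s\<in>block_interior c i. toggle_weight c p s i) = (if \<bar>c ! i\<bar> = 1 then 0 else - 1)"
proof -
  define t where "t = (if p then partial_sum c i + 1 else partial_sum c (i + 1) - 1)"
  have "(\<Sum>s\<in>block_interior c i. toggle_weight c p s i)
      = (\<Sum>s\<in>block_interior c i. if s = t then - 1 else 0)"
    by (intro sum.cong refl) (simp add: toggle_weight_def t_def)
  also have "\<dots> = (if t \<in> block_interior c i then - 1 else 0)"
    using finite_block_interior[of c i] by (simp add: sum.delta)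
  also have "t \<in> block_interior c i \<longleftrightarrow> \<bar>c ! i\<bar> \<noteq> 1"
    using signed_compositions_nth_neq_0[OF c i] partial_sum_Suc[OF i]
    by (auto simp: t_def block_interior_def)
  finally show ?thesis by simp
qed

lemma prod_toggle_weight_block_interior:
  assumes "i < length c" "s \<in> block_interior c i"
  shows "(\<Prod>k<length c. toggle_weight c (E k) s k) = toggle_weight c (E i) s i"
proof -
  have "toggle_weight c (E k) s k = 1" if "k \<in> {..<length c} - {i}" for k
    using block_interior_disjoint[of i c k] assms that by (auto simp: toggle_weight_def)
  then have "(\<Prod>k<length c. toggle_weight c (E k) s k) = (\<Prod>k\<in>{i}. toggle_weight c (E k) s k)"
    using assms(1) by (intro prod.mono_neutral_right) auto
  then show ?thesis by simp
qed

lemma sum_prod_toggle_weight: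
  assumes c: "c \<in> signed_compositions n"
  shows "(\<Sum>s = 1..n. \<Prod>i<length c. toggle_weight c (E i) s i)
    = int (card {i. i < length c \<and> \<bar>c ! i\<bar> = 1})"
proof -
  let ?m = "length c" and ?R = "partial_sum c ` {1..length c}"
  let ?t = "\<lambda>s. \<Prod>i<?m. toggle_weight c (E i) s i"
  note interior = Union_block_interior[OF c]
  have "sum ?t {1..n} = sum ?t ({1..n} - ?R) + sum ?t ?R"
    by (rule sum.subset_diff[OF partial_sum_image_subset[OF c]]) simp
  also have "sum ?t ?R = (\<Sum>s\<in>?R. 1)"
    using interior by (intro sum.cong refl prod.neutral) (auto simp: toggle_weight_def)
  also have "\<dots> = (\<Sum>i<?m. 1)" using card_partial_sum_image[OF c] by simp
  also have "sum ?t ({1..n} - ?R) = (\<Sum>i<?m. sum ?t (block_interior c i))"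
    unfolding interior using block_interior_disjoint[of _ c] finite_block_interior
    by (intro sum.UNION_disjoint) auto
  also have "\<dots> = (\<Sum>i<?m. if \<bar>c ! i\<bar> = 1 then 0 else - 1)"
    by (intro sum.cong refl)
      (simp add: prod_toggle_weight_block_interior sum_toggle_weight_block_interior[OF c])
  also have "\<dots> + (\<Sum>i<?m. 1) = (\<Sum>i<?m. if \<bar>c ! i\<bar> = 1 then 1 else 0)"
    unfolding sum.distrib[symmetric] by (intro sum.cong refl) auto
  also have "\<dots> = int (card {i. i < ?m \<and> \<bar>c ! i\<bar> = 1})"
    by (simp add: sum.If_cases Collect_conj_eq lessThan_def)
  finally show ?thesis .
qed

definition blockwise_constant :: "int list \<Rightarrow> (nat \<Rightarrow> 'a) \<Rightarrow> bool" where
  "blockwise_constant c e \<longleftrightarrow> (\<forall>i<length c. \<forall>j\<in>block c i. \<forall>k\<in>block c i. e j = e k)"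

definition block_index :: "int list \<Rightarrow> nat \<Rightarrow> nat" where
  "block_index c j = (THE i. i < length c \<and> j \<in> block c i)"

lemma block_index_eq: "i < length c \<Longrightarrow> j \<in> block c i \<Longrightarrow> block_index c j = i"
  unfolding block_index_def using block_unique[of _ c i j] by (intro the_equality) blast+

lemma
  assumes "c \<in> signed_compositions n" "j \<in> {1..n}"
  shows block_index_less: "block_index c j < length c"
    and mem_block_block_index: "j \<in> block c (block_index c j)"
proof -
  obtain i where "i < length c" "j \<in> block c i"
    by (rule block_exists[of "length c" c j]) (use assms partial_sum_length[OF assms(1)] in auto)
  then show "block_index c j < length c" "j \<in> block c (block_index c j)"
    by (simp_all add: block_index_eq)
qed

definition spread_blocks :: "nat \<Rightarrow> int list \<Rightarrow> (nat \<Rightarrow> 'a) \<Rightarrow> nat \<Rightarrow> 'a" where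
  "spread_blocks n c E = (\<lambda>j\<in>{1..n}. E (block_index c j))"

lemma spread_blocks_eq:
  assumes "c \<in> signed_compositions n" "i < length c" "j \<in> block c i"
  shows "spread_blocks n c E j = E i"
proof -
  have "j \<in> {1..n}" using block_subset[OF assms(1,2)] assms(3) by blast
  then show ?thesis using assms(2,3) by (simp add: spread_blocks_def block_index_eq)
qed

lemma bij_betw_spread_blocks:
  assumes c: "c \<in> signed_compositions n"
  shows "bij_betw (spread_blocks n c) ({..<length c} \<rightarrow>\<^sub>E UNIV)
    {e \<in> {1..n} \<rightarrow>\<^sub>E UNIV. blockwise_constant c e}"
proof (rule bij_betw_byWitness[where f' = "\<lambda>e. \<lambda>i\<in>{..<length c}. e (partial_sum c (Suc i))"])
  let ?E = "{e \<in> {1..n} \<rightarrow>\<^sub>E UNIV. blockwise_constant c e} :: (nat \<Rightarrow> 'a) set"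
    and ?pick = "\<lambda>e :: nat \<Rightarrow> 'a. \<lambda>i\<in>{..<length c}. e (partial_sum c (Suc i))"
  show "\<forall>E\<in>{..<length c} \<rightarrow>\<^sub>E UNIV. ?pick (spread_blocks n c E) = E"
  proof
    fix E :: "nat \<Rightarrow> 'a" assume E: "E \<in> {..<length c} \<rightarrow>\<^sub>E UNIV"
    show "?pick (spread_blocks n c E) = E"
      by (rule PiE_ext[OF _ E])
        (simp_all add: spread_blocks_eq[OF c] partial_sum_Suc_mem_block[OF c])
  qed
  show "\<forall>e\<in>?E. spread_blocks n c (?pick e) = e"
  proof
    fix e assume e: "e \<in> ?E"
    then have ext: "e \<in> {1..n} \<rightarrow>\<^sub>E UNIV" by simp
    show "spread_blocks n c (?pick e) = e"
    proof (rule PiE_ext[OF _ ext])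
      fix j assume j: "j \<in> {1..n}"
      note index = block_index_less[OF c j] mem_block_block_index[OF c j]
      have "e (partial_sum c (Suc (block_index c j))) = e j"
        using e index partial_sum_Suc_mem_block[OF c index(1)] unfolding blockwise_constant_def
        by blast
      then show "spread_blocks n c (?pick e) j = e j"
        using j index(1) by (simp add: spread_blocks_def)
    qed (simp add: spread_blocks_def)
  qed
  have "spread_blocks n c E \<in> {1..n} \<rightarrow>\<^sub>E UNIV" for E :: "nat \<Rightarrow> 'a" by (simp add: spread_blocks_def)
  then show "spread_blocks n c ` ({..<length c} \<rightarrow>\<^sub>E UNIV) \<subseteq> ?E"
    by (auto simp only: blockwise_constant_def spread_blocks_eq[OF c])
  show "?pick ` ?E \<subseteq> {..<length c} \<rightarrow>\<^sub>E UNIV" by (rule image_subsetI) simp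
qed

lemma wt_arc_sDes_not_blockwise_constant:
  assumes c: "c \<in> signed_compositions n" and n: "n \<ge> 1" and e: "\<not> blockwise_constant c e"
  shows "wt c (arc_sDes n e T) = 0"
proof -
  let ?\<sigma> = "arc_sDes n e T"
  obtain i j k where i: "i < length c" and jk: "j \<in> block c i" "k \<in> block c i" "e j \<noteq> e k"
    using e unfolding blockwise_constant_def by blast
  have "sign_vector ?\<sigma> x = (if e x then 1 else - 1)" if "x \<in> block c i" for x
    using block_subset[OF c i] that sign_vector_arc_sDes[of x n e T] by (auto simp: arc_signs_def)
  then have "sign_vector ?\<sigma> j \<noteq> sign_vector ?\<sigma> k" using jk by simp
  then have "\<not> (\<exists>x. \<forall>j\<in>block c i. sign_vector ?\<sigma> j = x)" using jk(1,2) by metis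
  then have "block_weight c ?\<sigma> i = 0" unfolding block_weight_def by (intro if_not_P) blast
  moreover have "fst ?\<sigma> \<subseteq> {1..n}" using n by (auto simp: arc_descents_def)
  ultimately show ?thesis using i by (auto simp: wt_eq_prod_block_weight[OF c] intro: prod_zero)
qed

lemma sum_wt_arc_sDes:
  assumes c: "c \<in> signed_compositions n" and n: "n \<ge> 1"
    and e: "\<And>i j. i < length c \<Longrightarrow> j \<in> block c i \<Longrightarrow> e j = E i"
  shows "(\<Sum>s = 1..n. wt c (arc_sDes n e {s})) = int (card {i. i < length c \<and> \<bar>c ! i\<bar> = 1})
    * (\<Prod>i<length c. if E i then 1 else sign_weight (c ! i))"
proof -
  have subset: "fst (arc_sDes n e {s}) \<subseteq> {1..n}" for s using n by (auto simp: arc_descents_def)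
  have "wt c (arc_sDes n e {s}) = (\<Prod>i<length c. if E i then 1 else sign_weight (c ! i))
      * (\<Prod>i<length c. toggle_weight c (E i) s i)" for s
    unfolding wt_eq_prod_block_weight[OF c subset] prod.distrib[symmetric]
    using e by (intro prod.cong refl block_weight_arc_sDes[OF c]) auto
  then have "(\<Sum>s = 1..n. wt c (arc_sDes n e {s}))
      = (\<Prod>i<length c. if E i then 1 else sign_weight (c ! i))
      * (\<Sum>s = 1..n. \<Prod>i<length c. toggle_weight c (E i) s i)"
    by (simp only: sum_distrib_left)
  then show ?thesis by (simp only: sum_prod_toggle_weight[OF c] mult.commute)
qed

lemma sum_wt_signed_arc_perms:
  assumes c: "c \<in> signed_compositions n" and n: "n \<ge> 2"
  shows "(\<Sum>w\<in>signed_arc_perms n. wt c (sDes n w))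
    = int (card {i. i < length c \<and> \<bar>c ! i\<bar> = 1}) * (\<Prod>i<length c. 1 + sign_weight (c ! i))"
proof -
  let ?m = "length c" and ?D = "{1..n} \<rightarrow>\<^sub>E (UNIV :: bool set)"
  let ?ones = "int (card {i. i < ?m \<and> \<bar>c ! i\<bar> = 1})"
  let ?W = "\<lambda>e. \<Sum>s = 1..n. wt c (arc_sDes n e {s})"
  have n1: "n \<ge> 1" using n by simp
  have "(\<Sum>w\<in>signed_arc_perms n. wt c (sDes n w)) = sum ?W ?D"
    by (rule sum_sDes_signed_arc_perms[OF n])
  also have "\<dots> = sum ?W {e \<in> ?D. blockwise_constant c e}"
    using wt_arc_sDes_not_blockwise_constant[OF c n1]
    by (intro sum.mono_neutral_right) (auto intro: finite_PiE)
  also have "\<dots> = (\<Sum>E\<in>{..<?m} \<rightarrow>\<^sub>E UNIV. ?W (spread_blocks n c E))"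
    by (rule sum.reindex_bij_betw[OF bij_betw_spread_blocks[OF c], symmetric])
  also have "\<dots> = (\<Sum>E\<in>{..<?m} \<rightarrow>\<^sub>E UNIV. ?ones * (\<Prod>i<?m. if E i then 1 else sign_weight (c ! i)))"
    by (intro sum.cong refl sum_wt_arc_sDes[OF c n1] spread_blocks_eq[OF c])
  also have "\<dots> = ?ones * (\<Sum>E\<in>{..<?m} \<rightarrow>\<^sub>E UNIV. \<Prod>i<?m. if E i then 1 else sign_weight (c ! i))"
    by (rule sum_distrib_left[symmetric])
  also have "(\<Sum>E\<in>{..<?m} \<rightarrow>\<^sub>E UNIV. \<Prod>i<?m. if E i then 1 else sign_weight (c ! i))
      = (\<Prod>i<?m. \<Sum>p\<in>UNIV. if p then 1 else sign_weight (c ! i))"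
    by (rule prod_sum_PiE[symmetric]) auto
  also have "\<dots> = (\<Prod>i<?m. 1 + sign_weight (c ! i))" by (simp add: UNIV_bool add.commute)
  finally show ?thesis .
qed

lemma type_product_composition_type:
  "0 \<notin> set c \<Longrightarrow> type_product (composition_type c) = (\<Prod>i<length c. 1 + sign_weight (c ! i))"
proof (induction c)
  case (Cons x c)
  have "(\<Prod>i<length (x # c). 1 + sign_weight ((x # c) ! i))
      = (1 + sign_weight x) * type_product (composition_type c)"
    using Cons by (simp add: prod.lessThan_Suc_shift del: prod.lessThan_Suc)
  also have "\<dots> = type_product (composition_type (x # c))"
    using Cons.prems by (cases x "0 :: int" rule: linorder_cases)
      (auto simp: type_product_def composition_type_def sign_weight_def mult_ac)
  finally show ?case by simp
qed (simp add: type_product_def composition_type_def)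

text \<open>Barred and unbarred parts \<open>1\<close> need not be distinguished, because a barred one makes the
  product vanish.\<close>

lemma count_composition_type_mult_prod:
  fixes c :: "int list"
  defines "P \<equiv> \<Prod>i<length c. 1 + sign_weight (c ! i)"
  shows "int (count (fst (composition_type c)) 1) * P
    = int (card {i. i < length c \<and> \<bar>c ! i\<bar> = 1}) * P"
proof (cases "- 1 \<in> set c")
  case True
  then obtain i where "i < length c" "c ! i = - 1" by (auto simp: in_set_conv_nth)
  then have "P = 0"
    unfolding P_def by (intro prod_zero bexI[of _ i]) (simp_all add: sign_weight_def)
  then show ?thesis by simp
next
  case False
  have "count (fst (composition_type c)) 1 = length (filter (\<lambda>x. x = 1) c)" for c :: "int list"
    by (induction c) (auto simp: composition_type_def nat_eq_iff)
  also have "length (filter (\<lambda>x. x = 1) c) = card {i. i < length c \<and> c ! i = 1}"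
    by (rule length_filter_conv_card)
  also have "{i. i < length c \<and> c ! i = 1} = {i. i < length c \<and> \<bar>c ! i\<bar> = 1}"
    using False by (auto simp: abs_if nth_mem split: if_splits) (metis minus_equation_iff nth_mem)
  finally show ?thesis by simp
qed

lemma fine_set_signed_arc_perms:
  assumes "n \<ge> 2"
  shows "fine_set n (signed_arc_perms n) (sDes n)
    (induced (signed_perms (n - 1)) (signed_perms n) (ext_char (n - 1)))"
  unfolding fine_set_def
proof (intro conjI ballI impI)
  show "finite (signed_arc_perms n)" by (rule finite_signed_arc_perms)
  fix c w assume c: "c \<in> signed_compositions n" and w: "w \<in> signed_perms n"
    and type: "signed_cycle_type n w = composition_type c"
  have c0: "0 \<notin> set c" using c by (simp add: signed_compositions_def)
  have "int (count (fst (composition_type c)) 1) * type_product (composition_type c)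
      = (\<Sum>b\<in>signed_arc_perms n. wt c (sDes n b))"
    unfolding sum_wt_signed_arc_perms[OF c assms] type_product_composition_type[OF c0]
    by (rule count_composition_type_mult_prod)
  moreover have "induced (signed_perms (n - 1)) (signed_perms n) (ext_char (n - 1)) w
      = of_int (int (count (fst (composition_type c)) 1) * type_product (composition_type c))"
    using induced_ext_char[OF _ w] assms type by simp
  ultimately show "induced (signed_perms (n - 1)) (signed_perms n) (ext_char (n - 1)) w
      = of_int (\<Sum>b\<in>signed_arc_perms n. wt c (sDes n b))"
    by (simp only:)
qed

section \<open>Coefficients of series\<close>

lemma mcoeff_0: "mcoeff 0 M = 0"
  and mcoeff_1: "mcoeff 1 M = (if M = {#} then 1 else 0)"
  and mcoeff_add: "mcoeff (f + g) M = mcoeff f M + mcoeff g M"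
  and mcoeff_diff: "mcoeff (f - g) M = mcoeff f M - mcoeff g M"
  and mcoeff_mult: "mcoeff (f * g) M = (\<Sum>A | A \<subseteq># M. mcoeff f A * mcoeff g (M - A))"
  by (simp_all add: zero_mseries.rep_eq one_mseries.rep_eq plus_mseries.rep_eq minus_mseries.rep_eq
      times_mseries.rep_eq)

lemma mcoeff_sum: "mcoeff (sum f A) M = (\<Sum>x\<in>A. mcoeff (f x) M)"
  by (induction A rule: infinite_finite_induct) (simp_all add: mcoeff_0 mcoeff_add)

lemma finite_submultisets: "finite {A. A \<subseteq># M}"
proof (induction M)
  case (add x M)
  have "{A. A \<subseteq># add_mset x M} \<subseteq> {A. A \<subseteq># M} \<union> add_mset x ` {A. A \<subseteq># M}"
  proof
    fix A assume "A \<in> {A. A \<subseteq># add_mset x M}"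
    then have A: "A \<subseteq># add_mset x M" by simp
    show "A \<in> {A. A \<subseteq># M} \<union> add_mset x ` {A. A \<subseteq># M}"
    proof (cases "x \<in># A")
      case True
      then obtain B where "A = add_mset x B" by (blast dest: multi_member_split)
      then show ?thesis using A by simp
    next
      case False
      have "A \<subseteq># M"
      proof (rule mset_subset_eqI)
        fix a show "count A a \<le> count M a"
          using mset_subset_eq_count[OF A, of a] False by (cases "a = x") (simp_all add: not_in_iff)
      qed
      then show ?thesis by simp
    qed
  qed
  then show ?case using add finite_subset by blast
qed simp

lemma mcoeff_p_plus_1: "mcoeff (p_plus 1) A = (if size A = 1 then 1 else 0)"
proof (cases "size A = 1")
  case True
  then obtain x where "A = {#x#}" by (metis One_nat_def size_1_singleton_mset)
  then show ?thesis by (cases x) (auto simp: p_plus_def mcoeff_add power_sum.rep_eq)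
next
  case False
  then show ?thesis by (auto simp: p_plus_def mcoeff_add power_sum.rep_eq)
qed

lemma mcoeff_p_plus_1_mult:
  "mcoeff (p_plus 1 * f) M = (\<Sum>x\<in>set_mset M. mcoeff f (M - {#x#}))"
proof -
  have "mcoeff (p_plus 1 * f) M = (\<Sum>A | A \<subseteq># M. if size A = 1 then mcoeff f (M - A) else 0)"
    unfolding mcoeff_mult mcoeff_p_plus_1 by (intro sum.cong refl) simp
  also have "\<dots> = (\<Sum>A | A \<subseteq># M \<and> size A = 1. mcoeff f (M - A))"
    by (subst sum.inter_filter[OF finite_submultisets, symmetric]) simp
  also have "{A. A \<subseteq># M \<and> size A = 1} = (\<lambda>x. {#x#}) ` set_mset M"
  proof (intro equalityI subsetI)
    fix A assume A: "A \<in> {A. A \<subseteq># M \<and> size A = 1}"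
    then have "size A = 1" by simp
    then obtain x where x: "A = {#x#}" using size_1_singleton_mset by blast
    then have "x \<in># M" using A by simp
    then show "A \<in> (\<lambda>x. {#x#}) ` set_mset M" using x by blast
  next
    fix A assume "A \<in> (\<lambda>x. {#x#}) ` set_mset M"
    then show "A \<in> {A. A \<subseteq># M \<and> size A = 1}" by (elim imageE) simp
  qed
  also have "(\<Sum>A\<in>(\<lambda>x. {#x#}) ` set_mset M. mcoeff f (M - A))
      = (\<Sum>x\<in>set_mset M. mcoeff f (M - {#x#}))"
    by (rule sum.reindex_cong[where l = "\<lambda>x. {#x#}"]) (simp_all add: inj_on_def)
  finally show ?thesis .
qed

section \<open>Increasing functions with prescribed content\<close>

definition incr_funs :: "'a :: linorder set \<Rightarrow> 'b :: linorder multiset \<Rightarrow> ('a \<Rightarrow> 'b) set" where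
  "incr_funs A M = {f \<in> A \<rightarrow>\<^sub>E UNIV. mono_on A f \<and> image_mset f (mset_set A) = M}"

lemma incr_funs_eq_empty: "size M \<noteq> card A \<Longrightarrow> incr_funs A M = {}"
  by (auto simp: incr_funs_def)

lemma map_incr_fun:
  assumes "finite A" "f \<in> incr_funs A M"
  shows "map f (sorted_list_of_set A) = sorted_list_of_multiset M"
proof -
  have "sorted (map f (sorted_list_of_set A))"
    using assms unfolding sorted_map incr_funs_def
    by (auto intro!: sorted_wrt_mono_rel[OF _ sorted_list_of_set.sorted_sorted_key_list_of_set]
        dest: mono_onD)
  moreover have "mset (map f (sorted_list_of_set A)) = mset (sorted_list_of_multiset M)"
    using assms(2) by (simp add: incr_funs_def)
      (metis mset_sorted_list_of_multiset sorted_list_of_mset_set)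
  ultimately show ?thesis by (metis properties_for_sort sort_sorted_list_of_multiset_eq)
qed

lemma incr_fun_exists:
  assumes "finite A" "size M = card A" shows "incr_funs A M \<noteq> {}"
proof -
  let ?xs = "sorted_list_of_set A" and ?ys = "sorted_list_of_multiset M"
  define f where "f = (\<lambda>x\<in>A. the (map_of (zip ?xs ?ys) x))"
  have length: "length ?ys = length ?xs"
    using assms by (metis length_sorted_list_of_set mset_sorted_list_of_multiset size_mset)
  have nth: "f (?xs ! i) = ?ys ! i" if "i < length ?xs" for i
    using that assms(1) length nth_mem[OF that] by (simp add: f_def map_of_zip_nth)
  have "mono_on A f"
  proof (rule mono_onI)
    fix x y assume "x \<in> A" "y \<in> A" "x \<le> y"
    then obtain i j where ij: "i < length ?xs" "j < length ?xs" "x = ?xs ! i" "y = ?xs ! j"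
      using assms(1) by (metis in_set_conv_nth set_sorted_list_of_set)
    show "f x \<le> f y"
    proof (cases "i \<le> j")
      case True
      then show ?thesis using ij length by (simp add: nth sorted_nth_mono)
    next
      case False
      then have "?xs ! j \<le> ?xs ! i" using ij by (intro sorted_nth_mono) auto
      then show ?thesis using \<open>x \<le> y\<close> ij by simp
    qed
  qed
  moreover have "map f ?xs = ?ys" using length nth by (intro nth_equalityI) simp_all
  then have "mset (map f ?xs) = M" by simp
  then have "image_mset f (mset_set A) = M" by (simp flip: sorted_list_of_mset_set)
  ultimately have "f \<in> incr_funs A M" by (simp add: incr_funs_def f_def)
  then show ?thesis by blast
qed

lemma incr_funs_eq_singleton:
  assumes "finite A" "size M = card A" obtains f where "incr_funs A M = {f}"
proof -
  obtain f where f: "f \<in> incr_funs A M" using incr_fun_exists[OF assms] by blast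
  have "g = f" if g: "g \<in> incr_funs A M" for g
  proof (rule PiE_ext)
    show "g \<in> A \<rightarrow>\<^sub>E UNIV" "f \<in> A \<rightarrow>\<^sub>E UNIV" using f g by (simp_all add: incr_funs_def)
    show "g x = f x" if "x \<in> A" for x
      using map_incr_fun[OF assms(1) f] map_incr_fun[OF assms(1) g] that assms(1)
      by (metis map_eq_conv set_sorted_list_of_set)
  qed
  then show ?thesis using that f by blast
qed

lemma transp_on_atLeastLessThan_iff_Suc:
  fixes a b :: nat
  assumes "transp R"
  shows "(\<forall>i\<in>{a..<b}. \<forall>j\<in>{a..<b}. i < j \<longrightarrow> R (f i) (f j))
    \<longleftrightarrow> (\<forall>j. a \<le> j \<and> Suc j < b \<longrightarrow> R (f j) (f (Suc j)))" (is "_ \<longleftrightarrow> ?step")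
proof
  assume step: ?step
  have "R (f i) (f (Suc (i + k)))" if "a \<le> i" "Suc (i + k) < b" for i k
    using that(2)
  proof (induction k)
    case 0
    then show ?case using step that(1) by simp
  next
    case (Suc k)
    then have "R (f i) (f (Suc (i + k)))" by simp
    moreover have "R (f (Suc (i + k))) (f (Suc (Suc (i + k))))" using step that(1) Suc.prems by simp
    ultimately show ?case using transpD[OF assms] by simp
  qed
  then show "\<forall>i\<in>{a..<b}. \<forall>j\<in>{a..<b}. i < j \<longrightarrow> R (f i) (f j)"
    by (auto simp: less_iff_Suc_add)
qed simp

lemma mono_on_atLeastLessThan_iff_Suc:
  fixes f :: "nat \<Rightarrow> 'a :: linorder"
  shows "mono_on {a..<b} f \<longleftrightarrow> (\<forall>j. a \<le> j \<and> Suc j < b \<longrightarrow> f j \<le> f (Suc j))"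
proof -
  have "mono_on {a..<b} f \<longleftrightarrow> (\<forall>i\<in>{a..<b}. \<forall>j\<in>{a..<b}. i < j \<longrightarrow> f i \<le> f j)"
  proof
    assume strict: "\<forall>i\<in>{a..<b}. \<forall>j\<in>{a..<b}. i < j \<longrightarrow> f i \<le> f j"
    show "mono_on {a..<b} f"
    proof (rule mono_onI)
      fix i j assume "i \<in> {a..<b}" "j \<in> {a..<b}" "i \<le> j"
      then show "f i \<le> f j" using strict by (cases "i = j") auto
    qed
  qed (simp add: mono_on_def)
  also have "\<dots> \<longleftrightarrow> (\<forall>j. a \<le> j \<and> Suc j < b \<longrightarrow> f j \<le> f (Suc j))"
    by (rule transp_on_atLeastLessThan_iff_Suc) simp
  finally show ?thesis .
qed

lemma strict_mono_on_atLeastLessThan_iff_Suc: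
  fixes f :: "nat \<Rightarrow> 'a :: linorder"
  shows "strict_mono_on {a..<b} f \<longleftrightarrow> (\<forall>j. a \<le> j \<and> Suc j < b \<longrightarrow> f j < f (Suc j))"
  using transp_on_atLeastLessThan_iff_Suc[of "(<)" a b f] unfolding strict_mono_on_def by auto

lemma strict_mono_on_iff_mono_on_inj_on:
  fixes f :: "'a :: linorder \<Rightarrow> 'b :: linorder"
  shows "strict_mono_on A f \<longleftrightarrow> mono_on A f \<and> inj_on f A"
proof
  assume "strict_mono_on A f"
  then show "mono_on A f \<and> inj_on f A"
    by (blast intro: strict_mono_on_imp_mono_on strict_mono_on_imp_inj_on)
next
  assume mono_inj: "mono_on A f \<and> inj_on f A"
  show "strict_mono_on A f"
  proof (rule strict_mono_onI)
    fix x y assume "x \<in> A" "y \<in> A" "x < y"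
    then have "f x \<le> f y" "f x \<noteq> f y" using mono_inj by (auto dest: mono_onD inj_onD)
    then show "f x < f y" by simp
  qed
qed

section \<open>The quasisymmetric generating function\<close>

fun is_X :: "var \<Rightarrow> bool" where
  "is_X (X i) = True" | "is_X (Y i) = False"

fun var_index :: "var \<Rightarrow> nat" where
  "var_index (X i) = i" | "var_index (Y i) = i"

fun var_rank :: "var \<Rightarrow> nat" where
  "var_rank (Y i) = 2 * i" | "var_rank (X i) = 2 * i + 1"

lemma var_rank_eq_iff: "var_rank x = var_rank y \<longleftrightarrow> x = y"
  by (cases x; cases y) (auto; presburger)+

text \<open>In the order \<open>y\<^sub>0 < x\<^sub>0 < y\<^sub>1 < x\<^sub>1 < \<dots>\<close> the words counted by the quasisymmetric functions are
  the weakly increasing ones with prescribed equalities.\<close>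

instantiation var :: linorder
begin

definition less_eq_var :: "var \<Rightarrow> var \<Rightarrow> bool" where
  "x \<le> y \<longleftrightarrow> var_rank x \<le> var_rank y"

definition less_var :: "var \<Rightarrow> var \<Rightarrow> bool" where
  "x < y \<longleftrightarrow> var_rank x < var_rank y"

instance
proof
  fix x y :: var
  show "x = y" if "x \<le> y" "y \<le> x"
    using that by (simp add: less_eq_var_def flip: var_rank_eq_iff)
qed (auto simp: less_eq_var_def less_var_def)

end

definition y_squarefree :: "var multiset \<Rightarrow> bool" where
  "y_squarefree M \<longleftrightarrow> (\<forall>i. count M (Y i) \<le> 1)"

lemma y_squarefree_image_mset_iff:
  assumes "finite U"
  shows "y_squarefree (image_mset c (mset_set U)) \<longleftrightarrow> inj_on c {i \<in> U. \<not> is_X (c i)}"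
proof -
  have "y_squarefree (image_mset c (mset_set U))
      \<longleftrightarrow> (\<forall>a. \<forall>i\<in>{i \<in> U. c i = Y a}. \<forall>j\<in>{i \<in> U. c i = Y a}. i = j)"
    using assms by (simp add: y_squarefree_def count_image_mset_eq_card_vimage card_le_Suc0_iff_eq)
  also have "\<dots> \<longleftrightarrow> inj_on c {i \<in> U. \<not> is_X (c i)}" (is "?L \<longleftrightarrow> ?R")
  proof
    assume eq: ?L
    show ?R
    proof (rule inj_onI)
      fix i j assume ij: "i \<in> {i \<in> U. \<not> is_X (c i)}" "j \<in> {i \<in> U. \<not> is_X (c i)}" "c i = c j"
      obtain a where "c i = Y a" using ij(1) by (cases "c i") simp_all
      then show "i = j" using eq ij by simp
    qed
  qed (simp add: inj_on_def)
  finally show ?thesis .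
qed

lemma wDes_arc_sDes:
  assumes "j \<in> {1..<n}"
  shows "j \<in> wDes (arc_sDes n e T)
    \<longleftrightarrow> (e j \<and> \<not> e (Suc j)) \<or> (e j = e (Suc j) \<and> (e j \<longleftrightarrow> j \<in> T))"
proof -
  let ?S = "arc_descents n e T" and ?\<epsilon> = "arc_signs n e"
  have "Suc j \<in> {1..n}" using assms by auto
  from sign_vector_arc_sDes[OF this] have "?\<epsilon> (LEAST t. t \<in> ?S \<and> j < t) = ?\<epsilon> (Suc j)"
    by (simp add: sign_vector_def Suc_le_eq)
  moreover have "n \<in> ?S" "j < n" using assms by (simp_all add: arc_descents_def)
  then have "\<exists>t\<in>?S. j < t" by blast
  ultimately have "j \<in> wDes (?S, ?\<epsilon>)
      \<longleftrightarrow> j \<in> ?S \<and> (?\<epsilon> j = ?\<epsilon> (Suc j) \<or> (?\<epsilon> j = 1 \<and> ?\<epsilon> (Suc j) = - 1))"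
    by (simp add: wDes_def Let_def)
  moreover have "j \<in> {1..n - 1}" "j \<noteq> n" "j \<in> {1..n}" "Suc j \<in> {1..n}" using assms by auto
  ultimately show ?thesis by (auto simp: arc_descents_def arc_signs_def)
qed

lemma wDes_arc_sDes_subset: "wDes (arc_sDes n e T) \<subseteq> {1..<n}"
  by (auto simp: wDes_def arc_descents_def)

definition admissible :: "nat \<Rightarrow> (nat \<Rightarrow> var) \<Rightarrow> nat \<Rightarrow> bool" where
  "admissible n v s \<longleftrightarrow> (\<forall>j\<in>{1..<n}. v j = v (Suc j) \<longrightarrow> (is_X (v j) \<longleftrightarrow> j \<noteq> s))"

definition signed_word :: "nat \<Rightarrow> (nat \<Rightarrow> bool) \<Rightarrow> (nat \<Rightarrow> nat) \<Rightarrow> nat \<Rightarrow> var" where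
  "signed_word n e i = (\<lambda>j\<in>{1..n}. if e j then X (i j) else Y (i j))"

lemma F_condition_iff:
  fixes n :: nat and e :: "nat \<Rightarrow> bool" and i :: "nat \<Rightarrow> nat"
  defines "v \<equiv> signed_word n e i"
  shows "(\<forall>j\<in>{1..<n}. i j \<le> i (j + 1)) \<and> (\<forall>j\<in>wDes (arc_sDes n e {s}). i j < i (j + 1))
    \<longleftrightarrow> mono_on {1..n} v \<and> admissible n v s"
proof -
  have step: "(i j \<le> i (Suc j) \<and> (j \<in> wDes (arc_sDes n e {s}) \<longrightarrow> i j < i (Suc j)))
      \<longleftrightarrow> v j \<le> v (Suc j) \<and> (v j = v (Suc j) \<longrightarrow> (is_X (v j) \<longleftrightarrow> j \<noteq> s))" if "j \<in> {1..<n}" for j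
    unfolding wDes_arc_sDes[OF that] v_def signed_word_def less_eq_var_def
    using that by (cases "e j"; cases "e (Suc j)") auto
  have "(\<forall>j\<in>{1..<n}. i j \<le> i (j + 1)) \<and> (\<forall>j\<in>wDes (arc_sDes n e {s}). i j < i (j + 1))
      \<longleftrightarrow> (\<forall>j\<in>{1..<n}. i j \<le> i (Suc j) \<and> (j \<in> wDes (arc_sDes n e {s}) \<longrightarrow> i j < i (Suc j)))"
    using wDes_arc_sDes_subset[of n e "{s}"] by auto
  also have "\<dots> \<longleftrightarrow> (\<forall>j\<in>{1..<n}. v j \<le> v (Suc j)) \<and> admissible n v s"
    unfolding admissible_def ball_conj_distrib[symmetric] by (rule ball_cong[OF refl step])
  also have "(\<forall>j\<in>{1..<n}. v j \<le> v (Suc j)) \<longleftrightarrow> mono_on {1..n} v"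
    using mono_on_atLeastLessThan_iff_Suc[of 1 "Suc n" v]
    by (auto simp: atLeastLessThanSuc_atLeastAtMost)
  finally show ?thesis .
qed

lemma mcoeff_F_arc_sDes:
  assumes e: "e \<in> {1..n} \<rightarrow>\<^sub>E UNIV"
  shows "mcoeff (F_fun n (arc_sDes n e {s})) M
    = of_nat (card {v \<in> incr_funs {1..n} M. admissible n v s \<and> (\<lambda>j\<in>{1..n}. is_X (v j)) = e})"
proof -
  let ?w = "signed_word n e" and ?index = "\<lambda>v. \<lambda>j\<in>{1..n}. var_index (v j)"
  let ?I = "{i \<in> {1..n} \<rightarrow>\<^sub>E UNIV. ?w i \<in> incr_funs {1..n} M \<and> admissible n (?w i) s}"
  let ?V = "{v \<in> incr_funs {1..n} M. admissible n v s \<and> (\<lambda>j\<in>{1..n}. is_X (v j)) = e}"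
  have content: "image_mset (\<lambda>j. if sign_vector (arc_sDes n e {s}) j = 1 then X (i j) else Y (i j))
      (mset_set {1..n}) = image_mset (?w i) (mset_set {1..n})" for i
    by (rule image_mset_cong) (simp add: sign_vector_arc_sDes signed_word_def arc_signs_def)
  have w_ext: "?w i \<in> {1..n} \<rightarrow>\<^sub>E UNIV" for i by (simp add: signed_word_def)
  have "mcoeff (F_fun n (arc_sDes n e {s})) M = of_nat (card ?I)"
    unfolding F_fun.rep_eq content using F_condition_iff[of n _ e s] w_ext
    by (intro arg_cong[of _ _ "\<lambda>S. of_nat (card S)"] Collect_cong) (auto simp: incr_funs_def)
  also have "card ?I = card ?V"
  proof (rule bij_betw_same_card, rule bij_betw_byWitness[where f = ?w and f' = ?index])
    show "\<forall>i\<in>?I. ?index (?w i) = i"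
    proof
      fix i assume "i \<in> ?I"
      then have i: "i \<in> {1..n} \<rightarrow>\<^sub>E UNIV" by simp
      show "?index (?w i) = i" by (rule PiE_ext[OF _ i]) (simp_all add: signed_word_def)
    qed
    have w_index: "?w (?index v) = v" if "v \<in> ?V" for v
    proof (rule PiE_ext[OF w_ext])
      show "v \<in> {1..n} \<rightarrow>\<^sub>E UNIV" using that by (simp add: incr_funs_def)
      fix j assume j: "j \<in> {1..n}"
      have "is_X (v j) \<longleftrightarrow> e j" using that j by auto
      then show "?w (?index v) j = v j" using j by (cases "v j") (simp_all add: signed_word_def)
    qed
    then show "\<forall>v\<in>?V. ?w (?index v) = v" by blast
    have "(\<lambda>j\<in>{1..n}. is_X (?w i j)) = e" for i
      by (rule PiE_ext[OF _ e]) (simp_all add: signed_word_def)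
    then show "?w ` ?I \<subseteq> ?V" by auto
    show "?index ` ?V \<subseteq> ?I" using w_index by auto
  qed
  finally show ?thesis .
qed

lemma sum_mcoeff_F_arc_sDes:
  "(\<Sum>e\<in>{1..n} \<rightarrow>\<^sub>E UNIV. mcoeff (F_fun n (arc_sDes n e {s})) M)
    = of_nat (card {v \<in> incr_funs {1..n} M. admissible n v s})"
proof -
  let ?V = "{v \<in> incr_funs {1..n} M. admissible n v s}"
  have "finite (incr_funs {1..n} M)"
    by (cases "size M = card {1..n}")
      (metis incr_funs_eq_singleton finite.emptyI finite.insertI finite_atLeastAtMost,
        simp add: incr_funs_eq_empty)
  then have finite: "finite ?V" by simp
  have "(\<Sum>e\<in>{1..n} \<rightarrow>\<^sub>E UNIV. mcoeff (F_fun n (arc_sDes n e {s})) M)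
      = (\<Sum>e\<in>{1..n} \<rightarrow>\<^sub>E UNIV. \<Sum>v\<in>{v \<in> ?V. (\<lambda>j\<in>{1..n}. is_X (v j)) = e}. 1)"
    by (intro sum.cong refl) (simp add: mcoeff_F_arc_sDes conj_assoc)
  also have "\<dots> = (\<Sum>v\<in>?V. 1)"
    using finite by (intro sum.group) (auto intro: finite_PiE)
  finally show ?thesis by simp
qed

context
  fixes n :: nat and v :: "nat \<Rightarrow> var" and M :: "var multiset"
  assumes v: "v \<in> incr_funs {1..n} M"
begin

lemma incr_word_adjacent_eq:
  assumes "i \<in> {1..n}" "j \<in> {1..n}" "i < j" "v i = v j" shows "v (Suc i) = v i"
proof (rule order.antisym)
  have mono: "mono_on {1..n} v" using v by (simp add: incr_funs_def)
  show "v i \<le> v (Suc i)" using assms by (intro mono_onD[OF mono]) auto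
  have "v (Suc i) \<le> v j" using assms by (intro mono_onD[OF mono]) auto
  then show "v (Suc i) \<le> v i" using assms(4) by simp
qed

lemma y_squarefree_delete_letter_iff:
  assumes "s \<in> {1..n}"
  shows "y_squarefree (M - {#v s#}) \<longleftrightarrow> inj_on v {j \<in> {1..n} - {s}. \<not> is_X (v j)}"
proof -
  have "M = image_mset v (mset_set (insert s ({1..n} - {s})))"
    using v assms by (simp add: incr_funs_def insert_absorb)
  then have "M - {#v s#} = image_mset v (mset_set ({1..n} - {s}))"
    by (subst (asm) mset_set.insert) auto
  then show ?thesis by (simp add: y_squarefree_image_mset_iff)
qed

lemma admissible_imp_y_squarefree:
  assumes "s \<in> {1..n}" "admissible n v s" shows "y_squarefree (M - {#v s#})"
  unfolding y_squarefree_delete_letter_iff[OF assms(1)]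
proof (rule linorder_inj_onI)
  fix i j assume "i < j" and i: "i \<in> {j \<in> {1..n} - {s}. \<not> is_X (v j)}"
    and j: "j \<in> {j \<in> {1..n} - {s}. \<not> is_X (v j)}"
  show "v i \<noteq> v j"
  proof
    assume "v i = v j"
    then have "v i = v (Suc i)" using incr_word_adjacent_eq[of i j] i j \<open>i < j\<close> by simp
    moreover have "i \<in> {1..<n}" using i j \<open>i < j\<close> by simp
    ultimately show False using assms(2) i unfolding admissible_def by blast
  qed
qed auto

lemma inj_on_admissible: "inj_on v {s \<in> {1..n}. admissible n v s}"
proof (rule linorder_inj_onI)
  fix s t assume "s < t" and s: "s \<in> {s \<in> {1..n}. admissible n v s}"
    and t: "t \<in> {s \<in> {1..n}. admissible n v s}"
  show "v s \<noteq> v t"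
  proof
    assume "v s = v t"
    then have "v s = v (Suc s)" using incr_word_adjacent_eq[of s t] s t \<open>s < t\<close> by simp
    moreover have "s \<in> {1..<n}" using s t \<open>s < t\<close> by simp
    ultimately have "is_X (v s) \<longleftrightarrow> s \<noteq> s" "is_X (v s) \<longleftrightarrow> s \<noteq> t"
      using s t unfolding admissible_def by blast+
    then show False using \<open>s < t\<close> by simp
  qed
qed auto

lemma admissible_exists:
  assumes "x \<in># M" "y_squarefree (M - {#x#})"
  obtains s where "s \<in> {1..n}" "admissible n v s" "v s = x"
proof -
  let ?P = "{j \<in> {1..n}. v j = x}"
  have "M = image_mset v (mset_set {1..n})" using v by (simp add: incr_funs_def)
  then have P: "finite ?P" "?P \<noteq> {}" using assms(1) by auto
  define s where "s = (if is_X x then Max ?P else Min ?P)"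
  have s: "s \<in> ?P" unfolding s_def using Max_in[OF P] Min_in[OF P] by simp
  then have inj: "inj_on v {j \<in> {1..n} - {s}. \<not> is_X (v j)}"
    using y_squarefree_delete_letter_iff[of s] assms(2) by simp
  have "is_X (v j) \<longleftrightarrow> j \<noteq> s" if j: "j \<in> {1..<n}" and eq: "v j = v (Suc j)" for j
  proof (cases "is_X (v j)")
    case True
    have "j \<noteq> s"
    proof
      assume "j = s"
      then have "Suc s \<in> ?P" "is_X x" using s j eq True by auto
      then have "Suc s \<le> s" unfolding s_def using Max_ge[OF P(1)] by simp
      then show False by simp
    qed
    then show ?thesis using True by simp
  next
    case False
    have "Suc j \<noteq> s"
    proof
      assume "Suc j = s"
      then have "j \<in> ?P" "\<not> is_X x" using s j eq False by auto
      then have "s \<le> j" unfolding s_def using Min_le[OF P(1)] by simp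
      then show False using \<open>Suc j = s\<close> by simp
    qed
    then have "j = s" using inj_onD[OF inj eq] j eq False by auto
    then show ?thesis using False by simp
  qed
  then have "admissible n v s" by (simp add: admissible_def)
  moreover have "s \<in> {1..n}" "v s = x" using s by simp_all
  ultimately show ?thesis using that by blast
qed

lemma card_admissible:
  "card {s \<in> {1..n}. admissible n v s} = card {x \<in> set_mset M. y_squarefree (M - {#x#})}"
proof -
  have "v ` {s \<in> {1..n}. admissible n v s} = {x \<in> set_mset M. y_squarefree (M - {#x#})}"
  proof (intro equalityI subsetI)
    fix x assume "x \<in> v ` {s \<in> {1..n}. admissible n v s}"
    then obtain s where s: "s \<in> {1..n}" "admissible n v s" "x = v s" by blast
    have "M = image_mset v (mset_set {1..n})" using v by (simp add: incr_funs_def)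
    then have "x \<in># M" using s by simp
    then show "x \<in> {x \<in> set_mset M. y_squarefree (M - {#x#})}"
      using admissible_imp_y_squarefree[OF s(1,2)] s(3) by simp
  next
    fix x assume "x \<in> {x \<in> set_mset M. y_squarefree (M - {#x#})}"
    then have "x \<in># M" "y_squarefree (M - {#x#})" by simp_all
    then obtain s where "s \<in> {1..n}" "admissible n v s" "v s = x" by (rule admissible_exists)
    then show "x \<in> v ` {s \<in> {1..n}. admissible n v s}" by blast
  qed
  then show ?thesis using card_image[OF inj_on_admissible] by simp
qed

end

lemma mcoeff_sum_F_signed_arc_perms:
  assumes n: "n \<ge> 2"
  shows "mcoeff (\<Sum>w\<in>signed_arc_perms n. F_fun n (sDes n w)) M
    = (if size M = n then of_nat (card {x \<in> set_mset M. y_squarefree (M - {#x#})}) else 0)"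
proof -
  let ?W = "incr_funs {1..n} M"
  have "mcoeff (\<Sum>w\<in>signed_arc_perms n. F_fun n (sDes n w)) M
      = (\<Sum>s = 1..n. \<Sum>e\<in>{1..n} \<rightarrow>\<^sub>E UNIV. mcoeff (F_fun n (arc_sDes n e {s})) M)"
    unfolding sum_sDes_signed_arc_perms[OF n] mcoeff_sum by (rule sum.swap)
  also have "\<dots> = (\<Sum>s = 1..n. of_nat (card {v \<in> ?W. admissible n v s}))"
    by (simp only: sum_mcoeff_F_arc_sDes)
  also have "\<dots> = (if size M = n
      then of_nat (card {x \<in> set_mset M. y_squarefree (M - {#x#})}) else 0)"
  proof (cases "size M = n")
    case True
    then obtain v where W: "?W = {v}" using incr_funs_eq_singleton[of "{1..n}" M] by auto
    then have v: "v \<in> ?W" by simp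
    have card: "card {v \<in> ?W. admissible n v s} = (if admissible n v s then 1 else 0)" for s
    proof -
      have "{v \<in> ?W. admissible n v s} = (if admissible n v s then {v} else {})" unfolding W by auto
      then show ?thesis by simp
    qed
    have "(\<Sum>s = 1..n. of_nat (card {v \<in> ?W. admissible n v s}))
        = (of_nat (card {s \<in> {1..n}. admissible n v s}) :: complex)"
      unfolding card by (simp add: sum.If_cases Int_def if_distrib)
    then show ?thesis using True card_admissible[OF v] by simp
  next
    case False
    then show ?thesis by (simp add: incr_funs_eq_empty)
  qed
  finally show ?thesis .
qed

section \<open>Schur functions of rows and columns\<close>

lemma bij_betw_PiE_comp:
  "bij_betw (\<lambda>f. \<lambda>i\<in>A. f (g i)) (g ` A \<rightarrow>\<^sub>E V) {c \<in> A \<rightarrow>\<^sub>E V. \<forall>i\<in>A. \<forall>j\<in>A. g i = g j \<longrightarrow> c i = c j}"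
proof (rule bij_betwI)
  let ?to = "\<lambda>f. \<lambda>i\<in>A. f (g i)" and ?from = "\<lambda>c. \<lambda>b\<in>g ` A. c (inv_into A g b)"
  let ?C = "{c \<in> A \<rightarrow>\<^sub>E V. \<forall>i\<in>A. \<forall>j\<in>A. g i = g j \<longrightarrow> c i = c j}"
  show "?to \<in> (g ` A \<rightarrow>\<^sub>E V) \<rightarrow> ?C"
  proof
    fix f assume f: "f \<in> g ` A \<rightarrow>\<^sub>E V"
    have "f (g i) \<in> V" if "i \<in> A" for i using PiE_mem[OF f imageI[OF that]] .
    then show "?to f \<in> ?C" by simp
  qed
  show "?from \<in> ?C \<rightarrow> (g ` A \<rightarrow>\<^sub>E V)"
  proof
    fix c assume "c \<in> ?C"
    then have c: "c \<in> A \<rightarrow>\<^sub>E V" by simp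
    show "?from c \<in> g ` A \<rightarrow>\<^sub>E V" by (simp add: restrict_PiE_iff PiE_mem[OF c] inv_into_into)
  qed
  show "?from (?to f) = f" if f: "f \<in> g ` A \<rightarrow>\<^sub>E V" for f
  proof
    fix b show "?from (?to f) b = f b"
      using PiE_arb[OF f, of b] by (cases "b \<in> g ` A") (simp_all add: inv_into_into f_inv_into_f)
  qed
  show "?to (?from c) = c" if "c \<in> ?C" for c
  proof (rule PiE_ext)
    from that show c: "c \<in> A \<rightarrow>\<^sub>E V" by simp
    show "?to (?from c) \<in> A \<rightarrow>\<^sub>E V"
      by (simp add: restrict_PiE_iff PiE_mem[OF c] inv_into_into)
    fix i assume i: "i \<in> A"
    from that have "\<forall>i\<in>A. \<forall>j\<in>A. g i = g j \<longrightarrow> c i = c j"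
      unfolding mem_Collect_eq by (rule conjunct2)
    from this[rule_format, of "inv_into A g (g i)" i] show "?to (?from c) i = c i"
      by (simp add: i inv_into_into f_inv_into_f)
  qed
qed

lemma card_PiE_reindex:
  assumes "inj_on g A"
  shows "card {T \<in> g ` A \<rightarrow>\<^sub>E UNIV. P (\<lambda>a\<in>A. T (g a))} = card {f \<in> A \<rightarrow>\<^sub>E UNIV. P f}"
proof -
  have "g i = g j \<longleftrightarrow> i = j" if "i \<in> A" "j \<in> A" for i j using inj_on_eq_iff[OF assms that] .
  then have "{c \<in> A \<rightarrow>\<^sub>E UNIV. \<forall>i\<in>A. \<forall>j\<in>A. g i = g j \<longrightarrow> c i = c j} = A \<rightarrow>\<^sub>E UNIV" by simp
  then have "bij_betw (\<lambda>T. \<lambda>a\<in>A. T (g a)) (g ` A \<rightarrow>\<^sub>E UNIV) (A \<rightarrow>\<^sub>E UNIV)"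
    by (rule subst) (rule bij_betw_PiE_comp)
  then show ?thesis by (intro bij_betw_same_card bij_betw_Collect) auto
qed

lemma mcoeff_schur_row:
  fixes z :: "nat \<Rightarrow> var"
  shows "mcoeff (schur z [k]) M = of_nat (card {f \<in> {0..<k} \<rightarrow>\<^sub>E UNIV. mono_on {0..<k} f
    \<and> image_mset (\<lambda>j. z (f j)) (mset_set {0..<k}) = M})"
proof -
  let ?P = "\<lambda>f. mono_on {0..<k} f \<and> image_mset (\<lambda>j. z (f j)) (mset_set {0..<k}) = M"
  have inj: "inj_on (Pair (0 :: nat)) A" for A :: "nat set" by (simp add: inj_on_def)
  have diagram: "young_diagram [k] = Pair 0 ` {0..<k}" by (auto simp: young_diagram_def)
  have "T \<in> ssyt [k] \<longleftrightarrow> T \<in> Pair 0 ` {0..<k} \<rightarrow>\<^sub>E UNIV \<and> mono_on {0..<k} (\<lambda>j\<in>{0..<k}. T (0, j))" for T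
    unfolding ssyt_def diagram mono_on_atLeastLessThan_iff_Suc by auto
  moreover have "image_mset (\<lambda>c. z (T c)) (mset_set (young_diagram [k]))
      = image_mset (\<lambda>j. z ((\<lambda>j\<in>{0..<k}. T (0, j)) j)) (mset_set {0..<k})" for T
    unfolding diagram image_mset_mset_set[OF inj, symmetric] image_mset.compositionality comp_def
    by (rule image_mset_cong) simp
  ultimately have "{T \<in> ssyt [k]. image_mset (\<lambda>c. z (T c)) (mset_set (young_diagram [k])) = M}
      = {T \<in> Pair 0 ` {0..<k} \<rightarrow>\<^sub>E UNIV. ?P (\<lambda>j\<in>{0..<k}. T (0, j))}" by simp
  then show ?thesis unfolding schur.rep_eq by (simp only: card_PiE_reindex[OF inj, of _ ?P])
qed

lemma mcoeff_schur_column: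
  fixes z :: "nat \<Rightarrow> var"
  shows "mcoeff (schur z (replicate k 1)) M = of_nat (card {f \<in> {0..<k} \<rightarrow>\<^sub>E UNIV.
    strict_mono_on {0..<k} f \<and> image_mset (\<lambda>i. z (f i)) (mset_set {0..<k}) = M})"
proof -
  let ?P = "\<lambda>f. strict_mono_on {0..<k} f \<and> image_mset (\<lambda>i. z (f i)) (mset_set {0..<k}) = M"
  let ?g = "\<lambda>i :: nat. (i, 0 :: nat)" and ?lam = "replicate k 1"
  have inj: "inj_on ?g A" for A by (simp add: inj_on_def)
  have diagram: "young_diagram ?lam = ?g ` {0..<k}" by (auto simp: young_diagram_def)
  have "T \<in> ssyt ?lam
      \<longleftrightarrow> T \<in> ?g ` {0..<k} \<rightarrow>\<^sub>E UNIV \<and> strict_mono_on {0..<k} (\<lambda>i\<in>{0..<k}. T (?g i))" for T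
    unfolding ssyt_def diagram strict_mono_on_atLeastLessThan_iff_Suc by auto
  moreover have "image_mset (\<lambda>c. z (T c)) (mset_set (young_diagram ?lam))
      = image_mset (\<lambda>i. z ((\<lambda>i\<in>{0..<k}. T (?g i)) i)) (mset_set {0..<k})" for T
    unfolding diagram image_mset_mset_set[OF inj, symmetric] image_mset.compositionality comp_def
    by (rule image_mset_cong) simp
  ultimately have "{T \<in> ssyt ?lam. image_mset (\<lambda>c. z (T c)) (mset_set (young_diagram ?lam)) = M}
      = {T \<in> ?g ` {0..<k} \<rightarrow>\<^sub>E UNIV. ?P (\<lambda>i\<in>{0..<k}. T (?g i))}" by simp
  then show ?thesis unfolding schur.rep_eq by (simp only: card_PiE_reindex[OF inj, of _ ?P])
qed

lemma card_incr_index_funs: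
  fixes A :: "'a :: linorder set" and z :: "nat \<Rightarrow> var"
  assumes "finite A" and z: "\<And>i. var_index (z i) = i"
  shows "card {f \<in> A \<rightarrow>\<^sub>E UNIV. mono_on A f \<and> image_mset (\<lambda>j. z (f j)) (mset_set A) = M}
    = (if size M = card A \<and> set_mset M \<subseteq> range z then 1 else 0)" (is "card ?F = _")
proof (cases "size M = card A \<and> set_mset M \<subseteq> range z")
  case True
  let ?N = "image_mset var_index M"
  have "z (var_index x) = x" if "x \<in># M" for x using that True z by auto
  then have M: "image_mset z ?N = M"
    by (simp add: image_mset.compositionality comp_def cong: image_mset_cong)
  have "image_mset (\<lambda>j. z (f j)) (mset_set A) = M \<longleftrightarrow> image_mset f (mset_set A) = ?N" for f
  proof
    assume content: "image_mset (\<lambda>j. z (f j)) (mset_set A) = M"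
    show "image_mset f (mset_set A) = ?N"
      unfolding content[symmetric] by (simp add: image_mset.compositionality comp_def z)
  next
    assume "image_mset f (mset_set A) = ?N"
    then have "image_mset z (image_mset f (mset_set A)) = M" using M by simp
    then show "image_mset (\<lambda>j. z (f j)) (mset_set A) = M"
      by (simp add: image_mset.compositionality comp_def)
  qed
  then have "?F = incr_funs A ?N" by (simp add: incr_funs_def)
  moreover obtain f where "incr_funs A ?N = {f}"
    using incr_funs_eq_singleton[OF assms(1), of ?N] True by auto
  ultimately show ?thesis using True by simp
next
  case False
  then have empty: "?F = {}" by auto
  show ?thesis unfolding empty using False by auto
qed

lemma mcoeff_schur_X_row:
  "mcoeff (schur X [k]) M = (if size M = k \<and> (\<forall>x\<in>#M. is_X x) then 1 else 0)"
proof -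
  have "set_mset M \<subseteq> range X \<longleftrightarrow> (\<forall>x\<in>#M. is_X x)" by (auto elim!: is_X.elims)
  then show ?thesis unfolding mcoeff_schur_row by (subst card_incr_index_funs) simp_all
qed

lemma mcoeff_schur_Y_column:
  "mcoeff (schur Y (replicate k 1)) M
    = (if size M = k \<and> (\<forall>x\<in>#M. \<not> is_X x) \<and> y_squarefree M then 1 else 0)"
proof -
  have range: "set_mset M \<subseteq> range Y \<longleftrightarrow> (\<forall>x\<in>#M. \<not> is_X x)" by (auto elim!: is_X.elims(3))
  have "strict_mono_on {0..<k} f \<longleftrightarrow> mono_on {0..<k} f \<and> y_squarefree M"
    if "image_mset (\<lambda>i. Y (f i)) (mset_set {0..<k}) = M" for f
    unfolding that[symmetric] y_squarefree_image_mset_iff[OF finite_atLeastLessThan]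
      strict_mono_on_iff_mono_on_inj_on by (auto simp: inj_on_def)
  then have "{f \<in> {0..<k} \<rightarrow>\<^sub>E UNIV. strict_mono_on {0..<k} f
        \<and> image_mset (\<lambda>i. Y (f i)) (mset_set {0..<k}) = M}
      = (if y_squarefree M then {f \<in> {0..<k} \<rightarrow>\<^sub>E UNIV. mono_on {0..<k} f
          \<and> image_mset (\<lambda>i. Y (f i)) (mset_set {0..<k}) = M} else {})"
    by auto
  then show ?thesis
    unfolding mcoeff_schur_column range[symmetric] by (simp add: card_incr_index_funs)
qed

lemma mcoeff_schur_row_mult_column:
  "mcoeff (schur X [k] * schur Y (replicate j 1)) M
    = (if size (filter_mset is_X M) = k \<and> size (filter_mset (\<lambda>x. \<not> is_X x) M) = j \<and> y_squarefree M
       then 1 else 0)"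
proof -
  let ?A = "filter_mset is_X M" and ?B = "filter_mset (\<lambda>x. \<not> is_X x) M"
  let ?term = "\<lambda>A. mcoeff (schur X [k]) A * mcoeff (schur Y (replicate j 1)) (M - A)"
  have B: "M - ?A = ?B" by (metis add_diff_cancel_left' multiset_partition)
  have "?term A = 0" if "A \<subseteq># M" "A \<noteq> ?A" for A
  proof (rule ccontr)
    assume "?term A \<noteq> 0"
    then have AB: "\<forall>x\<in>#A. is_X x" "\<forall>x\<in>#M - A. \<not> is_X x"
      unfolding mcoeff_schur_X_row mcoeff_schur_Y_column by (auto split: if_splits)
    have "?A = filter_mset is_X (A + (M - A))" using that(1) by simp
    also have "\<dots> = filter_mset is_X A + filter_mset is_X (M - A)" by (rule filter_union_mset)
    also have "filter_mset is_X A = A" using AB(1) by (simp add: filter_mset_eq_conv)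
    also have "filter_mset is_X (M - A) = {#}"
      using AB(2) by (simp only: filter_mset_eq_mempty_iff) blast
    finally show False using that(2) by simp
  qed
  then have "mcoeff (schur X [k] * schur Y (replicate j 1)) M = (\<Sum>A\<in>{?A}. ?term A)"
    unfolding mcoeff_mult by (intro sum.mono_neutral_right finite_submultisets) auto
  moreover have "y_squarefree ?B \<longleftrightarrow> y_squarefree M" by (simp add: y_squarefree_def)
  ultimately show ?thesis
    by (simp add: mcoeff_schur_X_row mcoeff_schur_Y_column[unfolded One_nat_def] B)
qed

lemma mcoeff_sum_schur_row_mult_column:
  "mcoeff (\<Sum>k = 0..m. schur X [k] * schur Y (replicate (m - k) 1)) M
    = (if size M = m \<and> y_squarefree M then 1 else 0)"
proof -
  let ?a = "size (filter_mset is_X M)" and ?b = "size (filter_mset (\<lambda>x. \<not> is_X x) M)"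
  have size: "size M = ?a + ?b" by (metis multiset_partition size_union)
  have "mcoeff (\<Sum>k = 0..m. schur X [k] * schur Y (replicate (m - k) 1)) M
      = (\<Sum>k = 0..m. if ?a = k then (if ?b = m - k \<and> y_squarefree M then 1 else 0) else 0)"
    unfolding mcoeff_sum mcoeff_schur_row_mult_column by (intro sum.cong refl) auto
  also have "\<dots> = (if ?a \<in> {0..m} then (if ?b = m - ?a \<and> y_squarefree M then 1 else 0) else 0)"
    by (simp add: sum.delta)
  also have "\<dots> = (if size M = m \<and> y_squarefree M then 1 else 0)"
    unfolding size by auto
  finally show ?thesis .
qed

lemma sum_F_signed_arc_perms:
  assumes n: "n \<ge> 2"
  shows "(\<Sum>w\<in>signed_arc_perms n. F_fun n (sDes n w))
    = p_plus 1 * (\<Sum>k = 0..n - 1. schur X [k] * schur Y (replicate (n - 1 - k) 1))"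
proof (rule mseries_eqI)
  fix M :: "var multiset"
  let ?H = "\<Sum>k = 0..n - 1. schur X [k] * schur Y (replicate (n - 1 - k) 1)"
  have "mcoeff (p_plus 1 * ?H) M
      = (\<Sum>x\<in>set_mset M. if size M = n \<and> y_squarefree (M - {#x#}) then 1 else 0)"
    unfolding mcoeff_p_plus_1_mult
  proof (rule sum.cong[OF refl])
    fix x assume "x \<in># M"
    then have "size (M - {#x#}) = size M - 1" "size M \<noteq> 0" by (auto simp: size_Diff_singleton)
    then show "mcoeff ?H (M - {#x#}) = (if size M = n \<and> y_squarefree (M - {#x#}) then 1 else 0)"
      unfolding mcoeff_sum_schur_row_mult_column using n by auto
  qed
  also have "\<dots> = (if size M = n
      then of_nat (card {x \<in> set_mset M. y_squarefree (M - {#x#})}) else 0)"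
    by (simp add: sum.If_cases Int_def)
  finally show "mcoeff (\<Sum>w\<in>signed_arc_perms n. F_fun n (sDes n w)) M = mcoeff (p_plus 1 * ?H) M"
    unfolding mcoeff_sum_F_signed_arc_perms[OF n] by (rule sym)
qed

section \<open>The Frobenius characteristic\<close>

definition type_series :: "nat multiset \<times> nat multiset \<Rightarrow> var mseries" where
  "type_series t = (\<Prod>r\<in>#fst t. p_plus r) * (\<Prod>r\<in>#snd t. p_minus r)"

lemma mcoeff_mconst_mult: "mcoeff (mconst a * f) M = a * mcoeff f M"
proof -
  have "mcoeff (mconst a * f) M = (\<Sum>A\<in>{{#}}. mcoeff (mconst a) A * mcoeff f (M - A))"
    unfolding mcoeff_mult
    by (rule sum.mono_neutral_right) (auto simp: finite_submultisets mconst.rep_eq)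
  then show ?thesis by (simp add: mconst.rep_eq)
qed

lemma ch_eq: "ch n f = mconst (1 / of_nat (card (signed_perms n)))
    * (\<Sum>w\<in>signed_perms n. mconst (f w) * type_series (signed_cycle_type n w))"
  unfolding ch_def type_series_def card_signed_perms by (simp add: case_prod_unfold mult.assoc)

lemma mcoeff_ch:
  "mcoeff (ch n f) M = (\<Sum>w\<in>signed_perms n. f w * mcoeff (type_series (signed_cycle_type n w)) M)
    / of_nat (card (signed_perms n))"
  unfolding ch_eq mcoeff_mconst_mult mcoeff_sum by simp

lemma type_series_stabilizer:
  assumes "n \<ge> 1" "h \<in> signed_perms (n - 1)"
  shows "type_series (signed_cycle_type n h) = p_plus 1 * type_series (signed_cycle_type (n - 1) h)"
  unfolding signed_cycle_type_stabilizer[OF assms] by (simp add: type_series_def mult_ac)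

lemma ch_induced:
  assumes n: "n \<ge> 1"
  shows "ch n (induced (signed_perms (n - 1)) (signed_perms n) f) = p_plus 1 * ch (n - 1) f"
proof -
  let ?G = "signed_perms n" and ?H = "signed_perms (n - 1)"
  have "ch n (induced ?H ?G f)
      = mconst (1 / of_nat (card ?H)) * (\<Sum>h\<in>?H. mconst (f h) * type_series (signed_cycle_type n h))"
  proof (rule mseries_eqI)
    fix M
    have "?H \<subseteq> ?G" unfolding signed_perms_stabilizer[OF n] by blast
    moreover have "class_function ?G (\<lambda>w. mcoeff (type_series (signed_cycle_type n w)) M)"
      using class_functionD[OF class_function_signed_cycle_type] by (simp add: class_function_def)
    moreover have "card ?G \<noteq> 0" by (simp add: card_signed_perms)
    ultimately show "mcoeff (ch n (induced ?H ?G f)) M = mcoeff (mconst (1 / of_nat (card ?H))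
        * (\<Sum>h\<in>?H. mconst (f h) * type_series (signed_cycle_type n h))) M"
      unfolding mcoeff_ch mcoeff_mconst_mult mcoeff_sum
      by (simp add: signed_perms.sum_induced_mult_class_function)
  qed
  also have "(\<Sum>h\<in>?H. mconst (f h) * type_series (signed_cycle_type n h))
      = p_plus 1 * (\<Sum>h\<in>?H. mconst (f h) * type_series (signed_cycle_type (n - 1) h))"
    unfolding sum_distrib_left
    by (intro sum.cong refl) (simp add: type_series_stabilizer[OF n] mult_ac del: One_nat_def)
  finally show ?thesis unfolding ch_eq[of "n - 1"] by (simp only: mult_ac)
qed

section \<open>Colourings\<close>

lift_definition mterm :: "complex \<Rightarrow> 'v multiset \<Rightarrow> 'v mseries"
  is "\<lambda>a A M. if M = A then a else 0" .

lemma mterm_mult: "mterm a A * mterm b B = mterm (a * b) (A + B)"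
proof (rule mseries_eqI)
  fix M
  have "mcoeff (mterm a A * mterm b B) M
      = (\<Sum>C | C \<subseteq># M. if C = A then a * (if M - A = B then b else 0) else 0)"
    unfolding mcoeff_mult mterm.rep_eq by (intro sum.cong refl) simp
  also have "\<dots> = (if A \<subseteq># M then a * (if M - A = B then b else 0) else 0)"
    by (simp add: sum.delta[OF finite_submultisets])
  also have "\<dots> = mcoeff (mterm (a * b) (A + B)) M"
    by (auto simp: mterm.rep_eq)
  finally show "mcoeff (mterm a A * mterm b B) M = mcoeff (mterm (a * b) (A + B)) M" .
qed

lemma prod_mterm: "(\<Prod>i\<in>I. mterm (a i) (A i)) = mterm (\<Prod>i\<in>I. a i) (\<Sum>i\<in>I. A i)"
proof (induction I rule: infinite_finite_induct)
  case (insert i I)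
  then show ?case by (simp add: mterm_mult)
qed (auto intro!: mseries_eqI simp: mcoeff_1 mterm.rep_eq)

lemma mcoeff_prod_cong:
  assumes "\<And>i A. i \<in> I \<Longrightarrow> A \<subseteq># M \<Longrightarrow> mcoeff (f i) A = mcoeff (g i) A"
  shows "mcoeff (\<Prod>i\<in>I. f i) M = mcoeff (\<Prod>i\<in>I. g i) M"
  using assms
proof (induction I arbitrary: M rule: infinite_finite_induct)
  case (insert i I)
  have "mcoeff (f i) A * mcoeff (\<Prod>i\<in>I. f i) (M - A) = mcoeff (g i) A * mcoeff (\<Prod>i\<in>I. g i) (M - A)"
    if "A \<subseteq># M" for A
  proof -
    have "mcoeff (f j) B = mcoeff (g j) B" if "j \<in> I" "B \<subseteq># M - A" for j B
      using that by (intro insert.prems) (auto intro: subset_mset.order_trans diff_subset_eq_self)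
    then have "mcoeff (\<Prod>i\<in>I. f i) (M - A) = mcoeff (\<Prod>i\<in>I. g i) (M - A)" by (rule insert.IH)
    then show ?thesis using insert.prems[OF _ that] by simp
  qed
  then show ?case using insert.hyps by (simp add: mcoeff_mult)
qed simp_all

lemma mcoeff_prod_sum_mterm:
  assumes "finite I" "finite V"
  shows "mcoeff (\<Prod>i\<in>I. \<Sum>v\<in>V. mterm (a i v) (A i v)) M
    = (\<Sum>f | f \<in> I \<rightarrow>\<^sub>E V \<and> (\<Sum>i\<in>I. A i (f i)) = M. \<Prod>i\<in>I. a i (f i))"
proof -
  have "(\<Prod>i\<in>I. \<Sum>v\<in>V. mterm (a i v) (A i v))
      = (\<Sum>f\<in>I \<rightarrow>\<^sub>E V. mterm (\<Prod>i\<in>I. a i (f i)) (\<Sum>i\<in>I. A i (f i)))"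
    using assms by (subst prod_sum_PiE) (simp_all add: prod_mterm)
  then have "mcoeff (\<Prod>i\<in>I. \<Sum>v\<in>V. mterm (a i v) (A i v)) M
      = (\<Sum>f\<in>I \<rightarrow>\<^sub>E V. if (\<Sum>i\<in>I. A i (f i)) = M then \<Prod>i\<in>I. a i (f i) else 0)"
    by (simp add: mcoeff_sum mterm.rep_eq eq_commute[of M])
  then show ?thesis
    using assms sum.inter_filter[of "I \<rightarrow>\<^sub>E V" "\<lambda>f. \<Prod>i\<in>I. a i (f i)" "\<lambda>f. (\<Sum>i\<in>I. A i (f i)) = M"]
    by (simp add: finite_PiE)
qed

lemma mcoeff_power_sums:
  assumes "r \<noteq> 0" "d = 1 \<or> d = - 1" "finite V" "set_mset A \<subseteq> V"
  shows "mcoeff (if d = 1 then p_plus r else p_minus r) A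
    = mcoeff (\<Sum>v\<in>V. mterm (of_int (if is_X v then 1 else d)) (replicate_mset r v)) A"
proof (cases "\<exists>v. A = replicate_mset r v")
  case True
  then obtain v where A: "A = replicate_mset r v" by blast
  have eq_iff: "replicate_mset r u = replicate_mset r v \<longleftrightarrow> u = v" for u v :: var
    using assms(1) by (simp add: replicate_mset_eq_iff)
  have "v \<in> V" using assms(1,4) A by simp
  moreover have "mcoeff (power_sum z r) A = (if v \<in> range z then 1 else 0)" for z
    unfolding A power_sum.rep_eq eq_iff by (simp add: image_iff)
  moreover have "v \<in> range X \<longleftrightarrow> is_X v" "v \<in> range Y \<longleftrightarrow> \<not> is_X v" by (cases v; auto)+
  ultimately show ?thesis
    using assms(2,3) unfolding mcoeff_sum mterm.rep_eq A eq_iff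
    by (auto simp: p_plus_def p_minus_def mcoeff_add mcoeff_diff)
next
  case False
  then have "mcoeff (power_sum z r) A = 0" for z by (auto simp: power_sum.rep_eq)
  then show ?thesis
    using False
    by (simp add: p_plus_def p_minus_def mcoeff_add mcoeff_diff mcoeff_sum mterm.rep_eq)
qed

lemma image_mset_eq_sum_fibers:
  fixes f :: "'b \<Rightarrow> 'c" and g :: "'a \<Rightarrow> 'b"
  assumes "finite A"
  shows "image_mset (\<lambda>i. f (g i)) (mset_set A)
    = (\<Sum>b\<in>g ` A. replicate_mset (card {i \<in> A. g i = b}) (f b))"
proof -
  have replicate: "(\<Sum>i\<in>S. {#v#}) = replicate_mset (card S) v" for S :: "'a set" and v :: 'c
    by (induction S rule: infinite_finite_induct) simp_all
  have "image_mset (\<lambda>i. f (g i)) (mset_set A) = (\<Sum>i\<in>A. {#f (g i)#})"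
    using assms by (induction A rule: finite_induct) simp_all
  also have "\<dots> = (\<Sum>b\<in>g ` A. \<Sum>i\<in>{i \<in> A. g i = b}. {#f (g i)#})"
    by (rule sum.image_gen[OF assms])
  also have "\<dots> = (\<Sum>b\<in>g ` A. \<Sum>i\<in>{i \<in> A. g i = b}. {#f b#})" by (intro sum.cong refl) simp
  finally show ?thesis by (simp only: replicate)
qed

definition colourings :: "nat \<Rightarrow> var multiset \<Rightarrow> (int \<Rightarrow> var) set" where
  "colourings n M = {c \<in> {1..int n} \<rightarrow>\<^sub>E UNIV. image_mset c (mset_set {1..int n}) = M}"

definition colour_sign :: "nat \<Rightarrow> (int \<Rightarrow> var) \<Rightarrow> (int \<Rightarrow> int) \<Rightarrow> int" where
  "colour_sign n c w = (\<Prod>i\<in>{1..int n}. if is_X (c i) then 1 else sgn (w i))"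

definition colour_transporter :: "nat \<Rightarrow> (int \<Rightarrow> var) \<Rightarrow> (int \<Rightarrow> var) \<Rightarrow> (int \<Rightarrow> int) set" where
  "colour_transporter n c c' = {w \<in> signed_perms n. \<forall>i\<in>{1..int n}. c (unsigned w i) = c' i}"

abbreviation colour_stabilizer :: "nat \<Rightarrow> (int \<Rightarrow> var) \<Rightarrow> (int \<Rightarrow> int) set" where
  "colour_stabilizer n c \<equiv> colour_transporter n c c"

lemma colourings_range: "c \<in> colourings n M \<Longrightarrow> c \<in> {1..int n} \<rightarrow>\<^sub>E set_mset M"
  by (auto simp: colourings_def)

lemma finite_colourings: "finite (colourings n M)"
proof (rule finite_subset)
  show "colourings n M \<subseteq> {1..int n} \<rightarrow>\<^sub>E set_mset M" using colourings_range by blast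
  show "finite ({1..int n} \<rightarrow>\<^sub>E set_mset M)" by (intro finite_PiE) auto
qed

lemma colour_stabilizer_iff:
  assumes w: "w \<in> signed_perms n"
  shows "w \<in> colour_stabilizer n c \<longleftrightarrow>
    (\<forall>i\<in>{1..int n}. \<forall>j\<in>{1..int n}. orbit (unsigned w) i = orbit (unsigned w) j \<longrightarrow> c i = c j)"
proof (intro iffI ballI impI)
  fix i j assume stabilizer: "w \<in> colour_stabilizer n c" and i: "i \<in> {1..int n}"
    and "orbit (unsigned w) i = orbit (unsigned w) j"
  then have "j \<in> orbit (unsigned w) i" using self_mem_orbit_unsigned[OF w] by simp
  then have "c j = c i \<and> j \<in> {1..int n}"
    by (induction rule: orbit.induct)
      (use stabilizer i unsigned_mem[OF w] in
        \<open>simp_all add: colour_transporter_def del: atLeastAtMost_iff\<close>)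
  then show "c i = c j" by simp
next
  assume const: "\<forall>i\<in>{1..int n}. \<forall>j\<in>{1..int n}.
    orbit (unsigned w) i = orbit (unsigned w) j \<longrightarrow> c i = c j"
  have "c (unsigned w i) = c i" if "i \<in> {1..int n}" for i
    using const[rule_format, OF unsigned_mem[OF w that] that]
      orbit_apply[OF unsigned_permutation[OF w]]
    by simp
  then show "w \<in> colour_stabilizer n c" using w by (simp add: colour_transporter_def)
qed

lemma abs_cycle_fiber:
  assumes w: "w \<in> signed_perms n" and b: "b \<in> abs_cycles n w"
  shows "{i \<in> {1..int n}. orbit (unsigned w) i = b} = b"
  using abs_cycle_subset[OF w b] orbit_eq_abs_cycle[OF w b] self_mem_orbit_unsigned[OF w] by blast

lemma colour_sign_abs_cycles:
  assumes w: "w \<in> signed_perms n"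
  shows "colour_sign n (\<lambda>i\<in>{1..int n}. f (orbit (unsigned w) i)) w
    = (\<Prod>b\<in>abs_cycles n w. if is_X (f b) then 1 else cycle_sign w b)"
proof -
  let ?sign = "\<lambda>i. if is_X (f (orbit (unsigned w) i)) then 1 else sgn (w i)"
  have "colour_sign n (\<lambda>i\<in>{1..int n}. f (orbit (unsigned w) i)) w = (\<Prod>i\<in>{1..int n}. ?sign i)"
    unfolding colour_sign_def by (intro prod.cong refl) simp
  also have "\<dots> = (\<Prod>b\<in>abs_cycles n w. \<Prod>i\<in>{i \<in> {1..int n}. orbit (unsigned w) i = b}. ?sign i)"
    unfolding abs_cycles_def by (rule prod.image_gen) simp
  also have "\<dots> = (\<Prod>b\<in>abs_cycles n w. \<Prod>i\<in>b. if is_X (f b) then 1 else sgn (w i))"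
    by (rule prod.cong[OF refl], unfold abs_cycle_fiber[OF w])
      (auto intro!: prod.cong simp: orbit_eq_abs_cycle[OF w])
  also have "\<dots> = (\<Prod>b\<in>abs_cycles n w. if is_X (f b) then 1 else cycle_sign w b)"
    by (intro prod.cong refl) (simp add: cycle_sign_def)
  finally show ?thesis .
qed

lemma mcoeff_type_series_abs_cycles:
  assumes w: "w \<in> signed_perms n"
  shows "mcoeff (type_series (signed_cycle_type n w)) M
    = (\<Sum>f | f \<in> abs_cycles n w \<rightarrow>\<^sub>E set_mset M
          \<and> (\<Sum>b\<in>abs_cycles n w. replicate_mset (card b) (f b)) = M.
        \<Prod>b\<in>abs_cycles n w. of_int (if is_X (f b) then 1 else cycle_sign w b))"
proof -
  let ?terms = "\<lambda>b. \<Sum>v\<in>set_mset M.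
    mterm (of_int (if is_X v then 1 else cycle_sign w b)) (replicate_mset (card b) v)"
  have "type_series (signed_cycle_type n w)
      = (\<Prod>b\<in>abs_cycles n w. if cycle_sign w b = 1 then p_plus (card b) else p_minus (card b))"
    unfolding type_series_def by (rule prod_abs_cycles_eq_prod_type[OF w, symmetric])
  also have "mcoeff \<dots> M = mcoeff (\<Prod>b\<in>abs_cycles n w. ?terms b) M"
  proof (rule mcoeff_prod_cong)
    fix b A assume b: "b \<in> abs_cycles n w" and "A \<subseteq># M"
    then have "set_mset A \<subseteq> set_mset M" by (intro set_mset_mono)
    moreover have "card b \<noteq> 0" using finite_abs_cycle[OF w b] abs_cycle_nonempty[OF w b] by simp
    ultimately show "mcoeff (if cycle_sign w b = 1 then p_plus (card b) else p_minus (card b)) A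
        = mcoeff (?terms b) A"
      by (intro mcoeff_power_sums cycle_sign_cases[OF w b]) simp_all
  qed
  finally show ?thesis by (simp only: mcoeff_prod_sum_mterm[OF finite_abs_cycles finite_set_mset])
qed

lemma mcoeff_type_series:
  assumes w: "w \<in> signed_perms n"
  shows "mcoeff (type_series (signed_cycle_type n w)) M
    = (\<Sum>c | c \<in> colourings n M \<and> w \<in> colour_stabilizer n c. of_int (colour_sign n c w))"
proof -
  let ?colouring = "\<lambda>f. \<lambda>i\<in>{1..int n}. f (orbit (unsigned w) i)"
  let ?C = "{c \<in> {1..int n} \<rightarrow>\<^sub>E set_mset M. \<forall>i\<in>{1..int n}. \<forall>j\<in>{1..int n}.
    orbit (unsigned w) i = orbit (unsigned w) j \<longrightarrow> c i = c j}"
  let ?F = "{f \<in> abs_cycles n w \<rightarrow>\<^sub>E set_mset M.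
    (\<Sum>b\<in>abs_cycles n w. replicate_mset (card b) (f b)) = M}"
  have content: "image_mset (?colouring f) (mset_set {1..int n})
      = (\<Sum>b\<in>abs_cycles n w. replicate_mset (card b) (f b))" for f
  proof -
    have "image_mset (?colouring f) (mset_set {1..int n})
        = image_mset (\<lambda>i. f (orbit (unsigned w) i)) (mset_set {1..int n})"
      by (rule image_mset_cong) simp
    also have "\<dots> = (\<Sum>b\<in>abs_cycles n w. replicate_mset (card b) (f b))"
      unfolding image_mset_eq_sum_fibers[OF finite_atLeastAtMost_int] abs_cycles_def[symmetric]
      by (intro sum.cong refl) (simp only: abs_cycle_fiber[OF w])
    finally show ?thesis .
  qed
  have range: "c \<in> {1..int n} \<rightarrow>\<^sub>E set_mset M \<and> image_mset c (mset_set {1..int n}) = M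
      \<longleftrightarrow> c \<in> colourings n M"
    for c using colourings_range[of c n M] by (auto simp: colourings_def)
  have "{c \<in> ?C. image_mset c (mset_set {1..int n}) = M}
      = {c \<in> colourings n M. w \<in> colour_stabilizer n c}"
    unfolding colour_stabilizer_iff[OF w] range[symmetric] mem_Collect_eq by (simp only: conj_ac)
  moreover have "bij_betw ?colouring (abs_cycles n w \<rightarrow>\<^sub>E set_mset M) ?C"
    unfolding abs_cycles_def by (rule bij_betw_PiE_comp)
  then have "bij_betw ?colouring ?F {c \<in> ?C. image_mset c (mset_set {1..int n}) = M}"
    by (rule bij_betw_Collect) (simp only: content)
  ultimately have bij: "bij_betw ?colouring ?F {c \<in> colourings n M. w \<in> colour_stabilizer n c}"
    by (rule subst)
  show ?thesis
    using sum.reindex_bij_betw[OF bij, of "\<lambda>c. complex_of_int (colour_sign n c w)"]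
    unfolding mcoeff_type_series_abs_cycles[OF w] colour_sign_abs_cycles[OF w] of_int_prod .
qed

lemma mcoeff_ch_colourings:
  "mcoeff (ch n f) M = (\<Sum>c\<in>colourings n M. \<Sum>w\<in>colour_stabilizer n c.
      f w * of_int (colour_sign n c w)) / of_nat (card (signed_perms n))"
proof -
  let ?G = "signed_perms n" and ?C = "colourings n M"
  let ?term = "\<lambda>c w. f w * complex_of_int (colour_sign n c w)"
  have "(\<Sum>w\<in>?G. f w * mcoeff (type_series (signed_cycle_type n w)) M)
      = (\<Sum>w\<in>?G. \<Sum>c | c \<in> ?C \<and> w \<in> colour_stabilizer n c. ?term c w)"
    by (intro sum.cong refl) (simp only: mcoeff_type_series sum_distrib_left)
  also have "\<dots> = (\<Sum>c\<in>?C. \<Sum>w | w \<in> ?G \<and> w \<in> colour_stabilizer n c. ?term c w)"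
    by (rule sum.swap_restrict[OF signed_perms.finite finite_colourings])
  also have "\<dots> = (\<Sum>c\<in>?C. \<Sum>w\<in>colour_stabilizer n c. ?term c w)"
    by (intro sum.cong refl) (simp add: colour_transporter_def)
  finally show ?thesis unfolding mcoeff_ch by (simp only:)
qed

section \<open>Recolourings\<close>

lemma colour_transporter_mem: "w \<in> colour_transporter n c c' \<Longrightarrow> w \<in> signed_perms n"
  and colour_transporter_apply:
    "w \<in> colour_transporter n c c' \<Longrightarrow> i \<in> {1..int n} \<Longrightarrow> c (unsigned w i) = c' i"
  by (simp_all add: colour_transporter_def)

lemma finite_colour_transporter: "finite (colour_transporter n c c')"
  by (simp add: colour_transporter_def signed_perms.finite)

lemma colour_transporter_comp:
  assumes u: "u \<in> colour_transporter n c c'" and v: "v \<in> colour_transporter n c' c''"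
  shows "u \<circ> v \<in> colour_transporter n c c''"
proof -
  note mem = colour_transporter_mem[OF u] colour_transporter_mem[OF v]
  have "c (unsigned (u \<circ> v) i) = c'' i" if i: "i \<in> {1..int n}" for i
    unfolding unsigned_comp[OF mem] comp_apply
    using colour_transporter_apply[OF u unsigned_mem[OF mem(2) i]] colour_transporter_apply[OF v i]
    by simp
  then show ?thesis using signed_perms.comp_mem[OF mem] by (simp add: colour_transporter_def)
qed

lemma colour_transporter_inv:
  assumes u: "u \<in> colour_transporter n c c'"
  shows "inv u \<in> colour_transporter n c' c"
proof -
  note mem = colour_transporter_mem[OF u]
  note inv_mem = signed_perms.inv_mem[OF mem]
  have "c' (unsigned (inv u) i) = c i" if i: "i \<in> {1..int n}" for i
  proof -
    have "c' (unsigned (inv u) i) = c (unsigned u (unsigned (inv u) i))"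
      using colour_transporter_apply[OF u unsigned_mem[OF inv_mem i]] by simp
    then show ?thesis
      by (simp add: unsigned_inv[OF mem]
          signed_perms.apply_inv[OF unsigned_mem_signed_perms[OF mem]])
  qed
  then show ?thesis using inv_mem by (simp add: colour_transporter_def)
qed

lemma colour_sign_id: "colour_sign n c id = 1"
  unfolding colour_sign_def by (intro prod.neutral ballI) simp

lemma colour_sign_comp:
  assumes u: "u \<in> signed_perms n" and v: "v \<in> colour_transporter n c c'"
  shows "colour_sign n c' (u \<circ> v) = colour_sign n c u * colour_sign n c' v"
proof -
  note v_mem = colour_transporter_mem[OF v]
  let ?sign = "\<lambda>i. if is_X (c i) then 1 else sgn (u i)"
  have "(if is_X (c' i) then 1 else sgn ((u \<circ> v) i))
      = ?sign (unsigned v i) * (if is_X (c' i) then 1 else sgn (v i))" if i: "i \<in> {1..int n}" for i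
  proof -
    have "0 < i" using i by simp
    then have "u (v i) = sgn (v i) * u (unsigned v i)"
      using signed_perms_sgn_mult[OF u, of "v i" "unsigned v i"] signed_perms_sgn_unsigned[of i v]
      by simp
    then show ?thesis using colour_transporter_apply[OF v i] by (simp add: sgn_mult)
  qed
  then have "colour_sign n c' (u \<circ> v) = (\<Prod>i\<in>{1..int n}. ?sign (unsigned v i)) * colour_sign n c' v"
    unfolding colour_sign_def prod.distrib[symmetric] by (intro prod.cong refl)
  also have "(\<Prod>i\<in>{1..int n}. ?sign (unsigned v i)) = (\<Prod>i\<in>unsigned v ` {1..int n}. ?sign i)"
    by (simp add: prod.reindex[OF unsigned_inj_on[OF v_mem]])
  also have "\<dots> = colour_sign n c u" unfolding unsigned_image[OF v_mem] colour_sign_def ..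
  finally show ?thesis .
qed

lemma colour_sign_conj:
  assumes u: "u \<in> colour_transporter n c c'" and v: "v \<in> colour_stabilizer n c'"
  shows "colour_sign n c (u \<circ> v \<circ> inv u) = colour_sign n c' v"
proof -
  note mem = colour_transporter_mem[OF u]
  have "colour_sign n c (u \<circ> v \<circ> inv u) = colour_sign n c' (u \<circ> v) * colour_sign n c (inv u)"
    using colour_transporter_mem[OF colour_transporter_comp[OF u v]] colour_transporter_inv[OF u]
    by (rule colour_sign_comp)
  also have "\<dots> = colour_sign n c' u * colour_sign n c (inv u) * colour_sign n c' v"
    using colour_sign_comp[OF mem v] by simp
  also have "colour_sign n c' u * colour_sign n c (inv u) = colour_sign n c (u \<circ> inv u)"
    by (rule colour_sign_comp[OF mem colour_transporter_inv[OF u], symmetric])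
  finally show ?thesis by (simp only: signed_perms.comp_inv[OF mem] colour_sign_id mult_1)
qed

lemma odd_extension_permutes_mem:
  assumes "p permutes {1..int n}" shows "odd_extension n p \<in> signed_perms n"
proof (rule odd_extension_mem_signed_perms)
  have mem: "p i \<in> {1..int n}" if "i \<in> {1..int n}" for i
    using permutes_in_image[OF assms] that by blast
  then show "\<bar>p i\<bar> \<in> {1..int n}" if "i \<in> {1..int n}" for i using that by fastforce
  show "inj_on (\<lambda>i. \<bar>p i\<bar>) {1..int n}"
  proof (rule inj_onI)
    fix x y assume "x \<in> {1..int n}" "y \<in> {1..int n}" "\<bar>p x\<bar> = \<bar>p y\<bar>"
    then have "p x = p y" using mem[of x] mem[of y] by simp
    then show "x = y" using permutes_inj[OF assms] by (simp add: inj_eq)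
  qed
qed

lemma sgn_odd_extension_permutes:
  assumes "p permutes {1..int n}" "i \<in> {1..int n}" shows "sgn (odd_extension n p i) = 1"
  using permutes_in_image[OF assms(1), of i] assms(2) by (simp add: odd_extension_apply)

lemma unsigned_odd_extension_permutes:
  assumes "p permutes {1..int n}" "i \<in> {1..int n}" shows "unsigned (odd_extension n p) i = p i"
  using permutes_in_image[OF assms(1), of i] assms(2)
  by (simp add: unsigned_def odd_extension_apply)

lemma colour_transporter_nonempty:
  assumes "c \<in> colourings n M" "c' \<in> colourings n M" obtains u where "u \<in> colour_transporter n c c'"
proof -
  have "image_mset c' (mset_set {1..int n}) = image_mset c (mset_set {1..int n})"
    using assms by (simp add: colourings_def)
  then obtain p where p: "p permutes {1..int n}" "\<forall>i\<in>{1..int n}. c' i = c (p i)"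
    using image_mset_eq_implies_permutes[of "{1..int n}" c' c] by auto
  then have "odd_extension n p \<in> colour_transporter n c c'"
    by (simp add: colour_transporter_def odd_extension_permutes_mem unsigned_odd_extension_permutes)
  then show ?thesis by (rule that)
qed

lemma card_colour_transporter:
  assumes "c \<in> colourings n M" "c' \<in> colourings n M"
  shows "card (colour_transporter n c c') = card (colour_stabilizer n c')"
proof -
  obtain u where u: "u \<in> colour_transporter n c c'" using colour_transporter_nonempty[OF assms] .
  note mem = colour_transporter_mem[OF u]
  have "c (unsigned (u \<circ> w) i) = c' (unsigned w i)" if "w \<in> signed_perms n" "i \<in> {1..int n}" for w i
    unfolding unsigned_comp[OF mem that(1)] comp_apply
    by (rule colour_transporter_apply[OF u unsigned_mem[OF that]])
  then show ?thesis
    unfolding colour_transporter_def by (intro signed_perms.card_left_translate[OF mem]) simp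
qed

lemma sum_card_colour_stabilizer:
  assumes c: "c \<in> colourings n M"
  shows "(\<Sum>c'\<in>colourings n M. card (colour_stabilizer n c')) = card (signed_perms n)"
proof -
  let ?G = "signed_perms n" and ?recolour = "\<lambda>w. \<lambda>i\<in>{1..int n}. c (unsigned w i)"
  have "?recolour w \<in> colourings n M" if w: "w \<in> ?G" for w
  proof -
    have "image_mset (?recolour w) (mset_set {1..int n})
        = image_mset c (image_mset (unsigned w) (mset_set {1..int n}))"
      unfolding image_mset.compositionality by (rule image_mset_cong) simp
    also have "\<dots> = M"
      unfolding image_mset_mset_set[OF unsigned_inj_on[OF w]] unsigned_image[OF w]
      using c by (simp add: colourings_def)
    finally show ?thesis by (simp add: colourings_def)
  qed
  then have "(\<Sum>c'\<in>colourings n M. \<Sum>w\<in>{w \<in> ?G. ?recolour w = c'}. 1) = (\<Sum>w\<in>?G. 1 :: nat)"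
    by (intro sum.group signed_perms.finite finite_colourings) blast
  moreover have "{w \<in> ?G. ?recolour w = c'} = colour_transporter n c c'"
    if "c' \<in> colourings n M" for c'
  proof -
    have ext: "c' \<in> {1..int n} \<rightarrow>\<^sub>E UNIV" using that by (simp add: colourings_def)
    have "?recolour w = c' \<longleftrightarrow> (\<forall>i\<in>{1..int n}. c (unsigned w i) = c' i)" for w
    proof
      assume eq: "?recolour w = c'"
      show "\<forall>i\<in>{1..int n}. c (unsigned w i) = c' i"
      proof
        fix i assume "i \<in> {1..int n}"
        then show "c (unsigned w i) = c' i" using fun_cong[OF eq, of i] by simp
      qed
    next
      assume "\<forall>i\<in>{1..int n}. c (unsigned w i) = c' i"
      then show "?recolour w = c'" by (intro PiE_ext[OF _ ext]) simp_all
    qed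
    then show ?thesis unfolding colour_transporter_def by (simp only:)
  qed
  ultimately show ?thesis by (simp add: card_colour_transporter[OF c])
qed

section \<open>The characteristics of the exterior powers\<close>

definition letter_subsets :: "nat \<Rightarrow> nat \<Rightarrow> int set set" where
  "letter_subsets n j = {I. I \<subseteq> {1..int n} \<and> card I = j}"

definition ext_power_char :: "nat \<Rightarrow> nat \<Rightarrow> (int \<Rightarrow> int) \<Rightarrow> complex" where
  "ext_power_char n j w = (if w \<in> signed_perms n
     then of_int (\<Sum>I | I \<in> letter_subsets n j \<and> unsigned w ` I = I. ext_sign w I) else 0)"

definition y_letters :: "nat \<Rightarrow> (int \<Rightarrow> var) \<Rightarrow> int set" where
  "y_letters n c = {i \<in> {1..int n}. \<not> is_X (c i)}"

definition sign_flip :: "nat \<Rightarrow> int \<Rightarrow> int \<Rightarrow> int" where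
  "sign_flip n k = odd_extension n (\<lambda>i. if i = k then - i else i)"

lemma finite_letter_subsets: "finite (letter_subsets n j)"
  by (rule finite_subset[of _ "Pow {1..int n}"]) (auto simp: letter_subsets_def)

lemma y_letters_subset: "y_letters n c \<subseteq> {1..int n}"
  by (auto simp: y_letters_def)

lemma colour_sign_eq_prod_y_letters: "colour_sign n c w = (\<Prod>i\<in>y_letters n c. sgn (w i))"
proof -
  have "colour_sign n c w = (\<Prod>i\<in>{1..int n}. if \<not> is_X (c i) then sgn (w i) else 1)"
    unfolding colour_sign_def by (intro prod.cong) auto
  then show ?thesis unfolding y_letters_def
    by (simp only: prod.inter_filter finite_atLeastAtMost_int)
qed

lemma sign_flip_apply: "i \<in> {1..int n} \<Longrightarrow> sign_flip n k i = (if i = k then - i else i)"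
  unfolding sign_flip_def by (rule odd_extension_apply)

lemma sign_flip_mem: "sign_flip n k \<in> signed_perms n"
  unfolding sign_flip_def
proof (rule odd_extension_mem_signed_perms)
  show "inj_on (\<lambda>i. \<bar>if i = k then - i else i\<bar>) {1..int n}"
    by (rule inj_onI) (simp split: if_splits)
qed simp

lemma sgn_sign_flip: "i \<in> {1..int n} \<Longrightarrow> sgn (sign_flip n k i) = (if i = k then - 1 else 1)"
  by (simp add: sign_flip_apply)

lemma unsigned_sign_flip: "unsigned (sign_flip n k) = id"
proof (rule signed_perms_eqI[OF unsigned_mem_signed_perms[OF sign_flip_mem] signed_perms.id_mem])
  fix i assume "i \<in> {1..int n}"
  then show "unsigned (sign_flip n k) i = id i" by (simp add: unsigned_def sign_flip_apply)
qed

lemma ext_sign_sign_flip: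
  assumes "I \<subseteq> {1..int n}" shows "ext_sign (sign_flip n k) I = (if k \<in> I then - 1 else 1)"
proof -
  have "ext_sign (sign_flip n k) I = (\<Prod>i\<in>I. sgn (sign_flip n k i))"
    by (rule ext_sign_fixed) (simp add: unsigned_sign_flip)
  also have "\<dots> = (\<Prod>i\<in>I. if i = k then - 1 else 1)"
    using assms by (intro prod.cong refl sgn_sign_flip) blast
  also have "\<dots> = (if k \<in> I then - 1 else 1)"
    using finite_subset[OF assms] by simp
  finally show ?thesis .
qed

lemma colour_sign_sign_flip:
  assumes "k \<in> {1..int n}"
  shows "colour_sign n c (sign_flip n k) = (if k \<in> y_letters n c then - 1 else 1)"
proof -
  have "colour_sign n c (sign_flip n k) = (\<Prod>i\<in>y_letters n c. if i = k then - 1 else 1)"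
    unfolding colour_sign_eq_prod_y_letters
    using y_letters_subset by (intro prod.cong refl sgn_sign_flip) blast
  then show ?thesis using finite_subset[OF y_letters_subset] by simp
qed

lemma ext_sign_odd_extension_permutes:
  assumes "p permutes {1..int n}" "I \<subseteq> {1..int n}"
  shows "ext_sign (odd_extension n p) I = inv_sign p I"
proof -
  have "inv_sign (unsigned (odd_extension n p)) I = inv_sign p I"
    using assms by (intro inv_sign_cong unsigned_odd_extension_permutes) auto
  moreover have "(\<Prod>i\<in>I. sgn (odd_extension n p i)) = 1"
    using assms by (intro prod.neutral ballI sgn_odd_extension_permutes) auto
  ultimately show ?thesis by (simp add: ext_sign_def)
qed

lemma colour_sign_odd_extension_permutes:
  "p permutes {1..int n} \<Longrightarrow> colour_sign n c (odd_extension n p) = 1"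
  unfolding colour_sign_def by (intro prod.neutral ballI) (simp add: sgn_odd_extension_permutes)

lemma sum_right_translate_eq_0:
  fixes t :: "('a \<Rightarrow> 'b) \<Rightarrow> 'c :: linordered_idom"
  assumes "finite S" "surj g" and into: "\<And>w. w \<in> S \<Longrightarrow> w \<circ> g \<in> S"
    and neg: "\<And>w. w \<in> S \<Longrightarrow> t (w \<circ> g) = - t w"
  shows "sum t S = 0"
proof -
  have inj: "inj_on (\<lambda>w. w \<circ> g) S"
  proof (rule inj_onI)
    fix v w assume "v \<circ> g = w \<circ> g"
    then have "\<forall>x\<in>UNIV. (v \<circ> g) x = (w \<circ> g) x" by simp
    then show "v = w" by (rule surj_fun_eq[OF assms(2)])
  qed
  have "(\<lambda>w. w \<circ> g) ` S = S"
    using into by (intro endo_inj_surj assms(1) inj image_subsetI)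
  then have "sum t S = sum t ((\<lambda>w. w \<circ> g) ` S)" by simp
  also have "\<dots> = (\<Sum>w\<in>S. - t w)" using neg by (simp add: sum.reindex[OF inj])
  finally show ?thesis by (simp add: sum_negf)
qed

abbreviation set_colour_stabilizer ::
    "nat \<Rightarrow> (int \<Rightarrow> var) \<Rightarrow> int set \<Rightarrow> (int \<Rightarrow> int) set" where
  "set_colour_stabilizer n c I \<equiv> {w. w \<in> colour_stabilizer n c \<and> unsigned w ` I = I}"

lemma sum_ext_sign_colour_sign_eq_0:
  assumes I: "I \<subseteq> {1..int n}"
    and g: "g \<in> colour_stabilizer n c" "unsigned g ` I = I" "ext_sign g I * colour_sign n c g = - 1"
  shows "(\<Sum>w\<in>set_colour_stabilizer n c I. ext_sign w I * colour_sign n c w) = 0"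
proof (rule sum_right_translate_eq_0)
  let ?S = "set_colour_stabilizer n c I"
  note g_mem = colour_transporter_mem[OF g(1)]
  show "finite ?S" by (rule finite_subset[OF _ finite_colour_transporter[of n c c]]) blast
  show "surj g" by (rule bij_is_surj[OF signed_perms.bij[OF g_mem]])
  fix w assume "w \<in> ?S"
  then have w: "w \<in> colour_stabilizer n c" "unsigned w ` I = I" by simp_all
  note w_mem = colour_transporter_mem[OF w(1)]
  have "unsigned (w \<circ> g) ` I = unsigned w ` (unsigned g ` I)"
    by (simp add: unsigned_comp[OF w_mem g_mem] image_image)
  then show "w \<circ> g \<in> ?S"
    using colour_transporter_comp[OF w(1) g(1)] w(2) g(2) by simp
  have "ext_sign (w \<circ> g) I * colour_sign n c (w \<circ> g)
      = (ext_sign w I * colour_sign n c w) * (ext_sign g I * colour_sign n c g)"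
    by (simp add: ext_sign_comp[OF w_mem g_mem I] g(2) colour_sign_comp[OF w_mem g(1)])
  then show "ext_sign (w \<circ> g) I * colour_sign n c (w \<circ> g) = - (ext_sign w I * colour_sign n c w)"
    by (simp add: g(3))
qed

lemma sum_ext_sign_not_y_letters:
  assumes I: "I \<subseteq> {1..int n}" and "I \<noteq> y_letters n c"
  shows "(\<Sum>w\<in>set_colour_stabilizer n c I. ext_sign w I * colour_sign n c w) = 0"
proof -
  obtain k where k: "k \<in> {1..int n}" "k \<in> I \<longleftrightarrow> k \<notin> y_letters n c"
    using assms y_letters_subset by blast
  show ?thesis
  proof (rule sum_ext_sign_colour_sign_eq_0[OF I])
    show "sign_flip n k \<in> colour_stabilizer n c"
      by (simp add: colour_transporter_def sign_flip_mem unsigned_sign_flip)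
    show "unsigned (sign_flip n k) ` I = I" by (simp add: unsigned_sign_flip)
    show "ext_sign (sign_flip n k) I * colour_sign n c (sign_flip n k) = - 1"
      using k by (simp add: ext_sign_sign_flip[OF I] colour_sign_sign_flip)
  qed
qed

lemma sum_ext_sign_not_inj_on:
  assumes I: "I \<subseteq> {1..int n}" and "\<not> inj_on c I"
  shows "(\<Sum>w\<in>set_colour_stabilizer n c I. ext_sign w I * colour_sign n c w) = 0"
proof -
  obtain p q where pq: "p \<in> I" "q \<in> I" "p \<noteq> q" "c p = c q"
    using assms(2) unfolding inj_on_def by blast
  have permutes: "transpose p q permutes {1..int n}" using pq I by (intro permutes_swap_id) blast+
  note unsigned = unsigned_odd_extension_permutes[OF permutes]
  show ?thesis
  proof (rule sum_ext_sign_colour_sign_eq_0[OF I])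
    have "c (transpose p q i) = c i" for i using pq(4) by (simp add: transpose_def)
    then show "odd_extension n (transpose p q) \<in> colour_stabilizer n c"
      by (simp add: colour_transporter_def odd_extension_permutes_mem[OF permutes] unsigned)
    have "unsigned (odd_extension n (transpose p q)) ` I = transpose p q ` I"
      using I unsigned by (intro image_cong) auto
    then show "unsigned (odd_extension n (transpose p q)) ` I = I"
      using pq by (simp add: transpose_image_eq)
    show "ext_sign (odd_extension n (transpose p q)) I
        * colour_sign n c (odd_extension n (transpose p q)) = - 1"
      using inv_sign_transpose[OF finite_subset[OF I] pq(1-3)]
      by (simp add: ext_sign_odd_extension_permutes[OF permutes I]
          colour_sign_odd_extension_permutes[OF permutes])
  qed
qed

lemma colour_stabilizer_fixes_y_letters:
  assumes inj: "inj_on c (y_letters n c)" and w: "w \<in> colour_stabilizer n c"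
    and i: "i \<in> y_letters n c"
  shows "unsigned w i = i"
proof (rule inj_onD[OF inj _ _ i])
  have i_mem: "i \<in> {1..int n}" using i y_letters_subset by blast
  show "c (unsigned w i) = c i" by (rule colour_transporter_apply[OF w i_mem])
  then show "unsigned w i \<in> y_letters n c"
    using unsigned_mem[OF colour_transporter_mem[OF w] i_mem] i by (simp add: y_letters_def)
qed

lemma sum_ext_sign_y_letters:
  assumes inj: "inj_on c (y_letters n c)"
  defines "I \<equiv> y_letters n c"
  shows "(\<Sum>w\<in>set_colour_stabilizer n c I. ext_sign w I * colour_sign n c w)
    = int (card (colour_stabilizer n c))"
proof -
  note fixed = colour_stabilizer_fixes_y_letters[OF inj, folded I_def]
  have "unsigned w ` I = I" if "w \<in> colour_stabilizer n c" for w using fixed[OF that] by simp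
  then have "set_colour_stabilizer n c I = colour_stabilizer n c" by blast
  moreover have "ext_sign w I * colour_sign n c w = 1" if w: "w \<in> colour_stabilizer n c" for w
  proof -
    have "ext_sign w I * colour_sign n c w = (\<Prod>i\<in>I. sgn (w i) * sgn (w i))"
      unfolding colour_sign_eq_prod_y_letters I_def[symmetric] prod.distrib
      by (simp add: ext_sign_fixed[OF fixed[OF w]])
    also have "\<dots> = 1"
    proof (intro prod.neutral ballI)
      fix i assume "i \<in> I"
      then have "i \<noteq> 0" using y_letters_subset[of n c] by (auto simp: I_def)
      then show "sgn (w i) * sgn (w i) = 1"
        using signed_perms_eq_0_iff[OF colour_transporter_mem[OF w]]
        by (intro sgn_mult_sgn_self) simp
    qed
    finally show ?thesis .
  qed
  ultimately show ?thesis by simp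
qed

lemma sum_stabilizer_ext_power_char:
  "(\<Sum>w\<in>colour_stabilizer n c. ext_power_char n j w * of_int (colour_sign n c w))
    = (if card (y_letters n c) = j \<and> inj_on c (y_letters n c)
       then of_nat (card (colour_stabilizer n c)) else 0)"
proof -
  let ?S = "colour_stabilizer n c" and ?J = "letter_subsets n j" and ?Y = "y_letters n c"
  let ?t = "\<lambda>w I. ext_sign w I * colour_sign n c w"
  have "(\<Sum>w\<in>?S. ext_power_char n j w * of_int (colour_sign n c w))
      = of_int (\<Sum>w\<in>?S. \<Sum>I | I \<in> ?J \<and> unsigned w ` I = I. ?t w I)"
    unfolding of_int_sum[of _ ?S]
    by (intro sum.cong refl)
      (simp add: ext_power_char_def colour_transporter_mem sum_distrib_right)
  also have "(\<Sum>w\<in>?S. \<Sum>I | I \<in> ?J \<and> unsigned w ` I = I. ?t w I)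
      = (\<Sum>I\<in>?J. \<Sum>w | w \<in> ?S \<and> unsigned w ` I = I. ?t w I)"
    by (rule sum.swap_restrict[OF finite_colour_transporter finite_letter_subsets])
  also have "\<dots> = (\<Sum>I\<in>?J. if I = ?Y then (if inj_on c ?Y then int (card ?S) else 0) else 0)"
    using sum_ext_sign_y_letters sum_ext_sign_not_inj_on sum_ext_sign_not_y_letters
    by (intro sum.cong refl) (simp only: letter_subsets_def mem_Collect_eq split: if_split, blast)
  also have "\<dots> = (if ?Y \<in> ?J then (if inj_on c ?Y then int (card ?S) else 0) else 0)"
    by (rule sum.delta[OF finite_letter_subsets])
  finally show ?thesis using y_letters_subset[of n c] by (simp add: letter_subsets_def)
qed

lemma colourings_eq_empty_iff: "colourings n M = {} \<longleftrightarrow> size M \<noteq> n"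
proof
  assume "size M \<noteq> n"
  then show "colourings n M = {}" by (auto simp: colourings_def)
next
  assume empty: "colourings n M = {}"
  have "incr_funs {1..int n} M \<subseteq> colourings n M" by (auto simp: incr_funs_def colourings_def)
  then show "size M \<noteq> n" using incr_fun_exists[of "{1..int n}" M] empty by auto
qed

lemma card_y_letters:
  assumes "c \<in> colourings n M"
  shows "card (y_letters n c) = size (filter_mset (\<lambda>x. \<not> is_X x) M)"
  using assms by (auto simp: colourings_def y_letters_def filter_mset_image_mset)

lemma inj_on_y_letters_iff:
  assumes "c \<in> colourings n M"
  shows "inj_on c (y_letters n c) \<longleftrightarrow> y_squarefree M"
proof -
  have "M = image_mset c (mset_set {1..int n})" using assms by (simp add: colourings_def)
  then show ?thesis
    by (simp only: y_squarefree_image_mset_iff[OF finite_atLeastAtMost_int] y_letters_def)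
qed

lemma ch_ext_power_char:
  assumes "k + j = n"
  shows "ch n (ext_power_char n j) = schur X [k] * schur Y (replicate j 1)"
proof (rule mseries_eqI)
  fix M
  let ?C = "colourings n M"
  let ?y = "size (filter_mset (\<lambda>x. \<not> is_X x) M) = j \<and> y_squarefree M"
  have y_iff: "card (y_letters n c) = j \<and> inj_on c (y_letters n c) \<longleftrightarrow> ?y" if "c \<in> ?C" for c
    by (simp only: card_y_letters[OF that] inj_on_y_letters_iff[OF that])
  have "mcoeff (ch n (ext_power_char n j)) M
      = (\<Sum>c\<in>?C. if ?y then of_nat (card (colour_stabilizer n c)) else 0)
        / of_nat (card (signed_perms n))"
    unfolding mcoeff_ch_colourings sum_stabilizer_ext_power_char
    using y_iff by (intro arg_cong2[of _ _ _ _ "(/)"] sum.cong refl) simp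
  also have "\<dots> = (if ?y \<and> size M = n then 1 else 0)"
  proof (cases "?y \<and> size M = n")
    case True
    then obtain c where c: "c \<in> ?C" using colourings_eq_empty_iff[of n M] by blast
    have "(\<Sum>c\<in>?C. complex_of_nat (card (colour_stabilizer n c))) = of_nat (card (signed_perms n))"
      unfolding sum_card_colour_stabilizer[OF c, symmetric] by simp
    moreover have "card (signed_perms n) \<noteq> 0" by (simp add: card_signed_perms)
    ultimately show ?thesis using True by simp
  next
    case False
    then show ?thesis using colourings_eq_empty_iff[of n M] by auto
  qed
  also have "\<dots> = mcoeff (schur X [k] * schur Y (replicate j 1)) M"
  proof -
    have "size M = size (filter_mset is_X M) + size (filter_mset (\<lambda>x. \<not> is_X x) M)"
      by (metis multiset_partition size_union)
    then show ?thesis unfolding mcoeff_schur_row_mult_column using assms by auto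
  qed
  finally show "mcoeff (ch n (ext_power_char n j)) M
      = mcoeff (schur X [k] * schur Y (replicate j 1)) M" .
qed

section \<open>Conjugacy of signed permutations\<close>

definition cycle_rep :: "(int \<Rightarrow> int) \<Rightarrow> int \<Rightarrow> int" where
  "cycle_rep w i = Min (orbit (unsigned w) i)"

definition cycle_exponent :: "(int \<Rightarrow> int) \<Rightarrow> int \<Rightarrow> nat" where
  "cycle_exponent w i = (SOME k. (unsigned w ^^ k) (cycle_rep w i) = i)"

text \<open>The conjugator sends \<open>w\<^sup>k a\<close> to \<open>v\<^sup>k a\<close> for the chosen representative \<open>a\<close> of each common
  cycle.\<close>

definition cycle_conjugator :: "nat \<Rightarrow> (int \<Rightarrow> int) \<Rightarrow> (int \<Rightarrow> int) \<Rightarrow> int \<Rightarrow> int" where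
  "cycle_conjugator n w v = odd_extension n (\<lambda>i. sgn ((w ^^ cycle_exponent w i) (cycle_rep w i))
    * (v ^^ cycle_exponent w i) (cycle_rep w i))"

context
  fixes n w
  assumes w: "w \<in> signed_perms n"
begin

lemma cycle_rep_mem: "i \<in> {1..int n} \<Longrightarrow> cycle_rep w i \<in> orbit (unsigned w) i"
  unfolding cycle_rep_def
  using finite_abs_cycle[OF w] abs_cycle_nonempty[OF w] orbit_mem_abs_cycles
  by (intro Min_in) blast+

lemma orbit_cycle_rep:
  "i \<in> {1..int n} \<Longrightarrow> orbit (unsigned w) (cycle_rep w i) = orbit (unsigned w) i"
  by (rule orbit_eq_of_mem[OF unsigned_permutation[OF w] cycle_rep_mem])

lemma cycle_rep_in: "i \<in> {1..int n} \<Longrightarrow> cycle_rep w i \<in> {1..int n}"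
  using cycle_rep_mem abs_cycle_subset[OF w orbit_mem_abs_cycles] by blast

lemma cycle_rep_eq_iff:
  assumes "i \<in> {1..int n}" "j \<in> {1..int n}"
  shows "cycle_rep w i = cycle_rep w j \<longleftrightarrow> orbit (unsigned w) i = orbit (unsigned w) j"
proof
  assume "cycle_rep w i = cycle_rep w j"
  then show "orbit (unsigned w) i = orbit (unsigned w) j"
    unfolding orbit_cycle_rep[OF assms(1), symmetric] orbit_cycle_rep[OF assms(2), symmetric]
    by (rule arg_cong)
qed (simp add: cycle_rep_def)

lemma funpow_cycle_exponent:
  assumes "i \<in> {1..int n}" shows "(unsigned w ^^ cycle_exponent w i) (cycle_rep w i) = i"
proof -
  have "i \<in> orbit (unsigned w) (cycle_rep w i)"
    unfolding orbit_cycle_rep[OF assms] by (rule self_mem_orbit_unsigned[OF w])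
  then have "\<exists>k. (unsigned w ^^ k) (cycle_rep w i) = i"
    unfolding orbit_eq_range[OF unsigned_permutation[OF w]] by (auto simp: eq_commute)
  then show ?thesis unfolding cycle_exponent_def by (rule someI_ex)
qed

lemma abs_funpow_cycle_exponent:
  assumes "i \<in> {1..int n}" shows "\<bar>(w ^^ cycle_exponent w i) (cycle_rep w i)\<bar> = i"
  using funpow_cycle_exponent[OF assms] cycle_rep_in[OF assms] by (simp add: abs_funpow[OF w])

lemma funpow_nonzero: "x \<noteq> 0 \<Longrightarrow> (w ^^ k) x \<noteq> 0"
  by (simp add: signed_perms_eq_0_iff[OF funpow_mem_signed_perms[OF w]])

lemma funpow_eq_iff:
  fixes d :: int
  assumes a: "a \<in> {1..int n}" and d: "\<bar>d\<bar> = 1"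
  defines "b \<equiv> orbit (unsigned w) a"
  shows "(w ^^ k) a = d * (w ^^ l) a \<longleftrightarrow> k mod card b = l mod card b
    \<and> cycle_sign w b ^ (k div card b) = d * cycle_sign w b ^ (l div card b)"
proof -
  note permutation = unsigned_permutation[OF w]
  let ?r = "card b" and ?s = "cycle_sign w b"
  have "b \<in> abs_cycles n w" unfolding b_def by (rule orbit_mem_abs_cycles[OF a])
  then have r: "0 < ?r"
    using finite_abs_cycle[OF w] abs_cycle_nonempty[OF w] by (simp add: card_gt_0_iff)
  have "\<bar>?s\<bar> = 1" using cycle_sign_cases[OF w \<open>b \<in> abs_cycles n w\<close>] by fastforce
  then have abs_power: "\<bar>?s ^ q\<bar> = 1" for q by (simp add: power_abs)
  have reduce: "(w ^^ k) a = ?s ^ (k div ?r) * (w ^^ (k mod ?r)) a" for k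
    using funpow_add_mult_card_orbit[OF w, of a "k mod ?r" "k div ?r"] a by (simp add: b_def)
  have mod_eq: "k mod ?r = l mod ?r" if "(w ^^ k) a = d * (w ^^ l) a"
  proof (rule inj_onD)
    show "inj_on (\<lambda>t. (unsigned w ^^ t) a) {..<?r}"
      unfolding b_def card_orbit[OF permutation] by (rule inj_on_funpow_least_power[OF permutation])
    have "\<bar>(w ^^ k) a\<bar> = \<bar>(w ^^ l) a\<bar>" using that d by (simp add: abs_mult)
    then show "(unsigned w ^^ (k mod ?r)) a = (unsigned w ^^ (l mod ?r)) a"
      unfolding reduce[of k] reduce[of l] abs_mult abs_power using a by (simp add: abs_funpow[OF w])
  qed (simp_all add: r)
  have power_eq: "(w ^^ k) a = d * (w ^^ l) a \<longleftrightarrow> ?s ^ (k div ?r) = d * ?s ^ (l div ?r)"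
    if "k mod ?r = l mod ?r"
    unfolding reduce[of k] reduce[of l] that using funpow_nonzero[of a] a by simp
  show ?thesis
  proof
    assume eq: "(w ^^ k) a = d * (w ^^ l) a"
    then show "k mod ?r = l mod ?r \<and> ?s ^ (k div ?r) = d * ?s ^ (l div ?r)"
      using power_eq[OF mod_eq[OF eq]] mod_eq[OF eq] by blast
  next
    assume "k mod ?r = l mod ?r \<and> ?s ^ (k div ?r) = d * ?s ^ (l div ?r)"
    then show "(w ^^ k) a = d * (w ^^ l) a" using power_eq by (elim conjE) (rule iffD2)
  qed
qed

end

context
  fixes n w v
  assumes w: "w \<in> signed_perms n" and v: "v \<in> signed_perms n"
    and orbit_eq: "\<And>i. i \<in> {1..int n} \<Longrightarrow> orbit (unsigned w) i = orbit (unsigned v) i"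
    and cycle_sign_eq: "\<And>b. b \<in> abs_cycles n w \<Longrightarrow> cycle_sign w b = cycle_sign v b"
begin

lemma funpow_eq_iff_same_cycles:
  assumes a: "a \<in> {1..int n}" and d: "\<bar>d\<bar> = 1"
  shows "(w ^^ k) a = d * (w ^^ l) a \<longleftrightarrow> (v ^^ k) a = d * (v ^^ l) a"
  unfolding funpow_eq_iff[OF w a d] funpow_eq_iff[OF v a d] orbit_eq[OF a, symmetric]
    cycle_sign_eq[OF orbit_mem_abs_cycles[OF a]] by (rule refl)

lemma abs_funpow_eq_iff_same_cycles:
  assumes a: "a \<in> {1..int n}"
  shows "\<bar>(w ^^ k) a\<bar> = \<bar>(w ^^ l) a\<bar> \<longleftrightarrow> \<bar>(v ^^ k) a\<bar> = \<bar>(v ^^ l) a\<bar>"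
proof -
  have "\<bar>x\<bar> = \<bar>y\<bar> \<longleftrightarrow> x = 1 * y \<or> x = (- 1) * y" for x y :: int by (simp add: abs_eq_iff)
  then show ?thesis
    using funpow_eq_iff_same_cycles[OF a, of 1 k l] funpow_eq_iff_same_cycles[OF a, of "- 1" k l]
    by (simp only: abs_one abs_neg_one simp_thms)
qed

lemma orbit_abs_funpow_cycle_exponent:
  assumes i: "i \<in> {1..int n}"
  shows "orbit (unsigned v) \<bar>(v ^^ cycle_exponent w i) (cycle_rep w i)\<bar> = orbit (unsigned w) i"
proof -
  have "\<bar>(v ^^ cycle_exponent w i) (cycle_rep w i)\<bar> \<in> orbit (unsigned v) (cycle_rep w i)"
    using cycle_rep_in[OF w i]
    by (simp add: abs_funpow[OF v] orbit_eq_range[OF unsigned_permutation[OF v]])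
  then have "orbit (unsigned v) \<bar>(v ^^ cycle_exponent w i) (cycle_rep w i)\<bar>
      = orbit (unsigned v) (cycle_rep w i)"
    by (rule orbit_eq_of_mem[OF unsigned_permutation[OF v]])
  also have "\<dots> = orbit (unsigned w) i"
    unfolding orbit_eq[OF cycle_rep_in[OF w i], symmetric] by (rule orbit_cycle_rep[OF w i])
  finally show ?thesis .
qed

lemma cycle_conjugator_mem: "cycle_conjugator n w v \<in> signed_perms n"
  unfolding cycle_conjugator_def
proof (rule odd_extension_mem_signed_perms)
  let ?k = "cycle_exponent w" and ?a = "cycle_rep w"
  let ?g = "\<lambda>i. sgn ((w ^^ ?k i) (?a i)) * (v ^^ ?k i) (?a i)"
  have abs: "\<bar>?g i\<bar> = \<bar>(v ^^ ?k i) (?a i)\<bar>" if "i \<in> {1..int n}" for i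
  proof -
    have "(w ^^ ?k i) (?a i) \<noteq> 0" using abs_funpow_cycle_exponent[OF w that] that by auto
    then show ?thesis by (simp add: abs_mult abs_sgn_eq)
  qed
  have unsigned: "\<bar>(v ^^ ?k i) (?a i)\<bar> = (unsigned v ^^ ?k i) (?a i)" if "i \<in> {1..int n}" for i
    using cycle_rep_in[OF w that] by (simp add: abs_funpow[OF v])
  show "\<bar>?g i\<bar> \<in> {1..int n}" if "i \<in> {1..int n}" for i
    unfolding abs[OF that] unsigned[OF that]
    by (rule unsigned_funpow_mem[OF v cycle_rep_in[OF w that]])
  show "inj_on (\<lambda>i. \<bar>?g i\<bar>) {1..int n}"
  proof (rule inj_onI)
    fix i j assume i: "i \<in> {1..int n}" and j: "j \<in> {1..int n}" and "\<bar>?g i\<bar> = \<bar>?g j\<bar>"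
    then have eq: "\<bar>(v ^^ ?k i) (?a i)\<bar> = \<bar>(v ^^ ?k j) (?a j)\<bar>" by (simp only: abs)
    then have "orbit (unsigned w) i = orbit (unsigned w) j"
      unfolding orbit_abs_funpow_cycle_exponent[OF i, symmetric]
        orbit_abs_funpow_cycle_exponent[OF j, symmetric] by simp
    then have rep: "?a i = ?a j" by (simp add: cycle_rep_def)
    have "\<bar>(w ^^ ?k i) (?a j)\<bar> = \<bar>(w ^^ ?k j) (?a j)\<bar>"
      using eq unfolding rep by (simp only: abs_funpow_eq_iff_same_cycles[OF cycle_rep_in[OF w j]])
    then show "i = j"
      using abs_funpow_cycle_exponent[OF w i] abs_funpow_cycle_exponent[OF w j] unfolding rep
      by simp
  qed
qed

lemma cycle_conjugator_funpow:
  assumes i: "i \<in> {1..int n}"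
  shows "cycle_conjugator n w v ((w ^^ k) (cycle_rep w i)) = (v ^^ k) (cycle_rep w i)"
proof -
  define a j l where "a = cycle_rep w i" and "j = \<bar>(w ^^ k) a\<bar>" and "l = cycle_exponent w j"
  have a: "a \<in> {1..int n}" unfolding a_def by (rule cycle_rep_in[OF w i])
  then have unsigned: "j = (unsigned w ^^ k) a" by (simp add: j_def abs_funpow[OF w])
  then have j: "j \<in> {1..int n}" using unsigned_funpow_mem[OF w a] by simp
  have "orbit (unsigned w) j = orbit (unsigned w) i"
    unfolding unsigned orbit_cycle_rep[OF w i, symmetric] a_def[symmetric]
    using orbit_eq_of_mem[OF unsigned_permutation[OF w]]
      orbit_eq_range[OF unsigned_permutation[OF w]]
    by blast
  then have rep: "cycle_rep w j = a" using cycle_rep_eq_iff[OF w j i] by (simp add: a_def)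
  define s d where "s = sgn ((w ^^ l) a)" and "d = sgn ((w ^^ k) a) * s"
  have nonzero: "(w ^^ l) a \<noteq> 0" "(w ^^ k) a \<noteq> 0" using funpow_nonzero[OF w, of a] a by auto
  then have d: "\<bar>d\<bar> = 1" "sgn ((w ^^ k) a) = d * s"
    by (simp_all add: d_def s_def abs_mult abs_sgn_eq sgn_mult_sgn_self mult.assoc)
  have "\<bar>(w ^^ l) a\<bar> = j" using abs_funpow_cycle_exponent[OF w j] by (simp add: l_def rep)
  then have "(w ^^ k) a = d * (w ^^ l) a"
    by (metis d(2) j_def mult.assoc mult_sgn_abs sgn_mult_abs s_def mult.commute)
  then have "(v ^^ k) a = d * (v ^^ l) a"
    using funpow_eq_iff_same_cycles[OF a d(1)] by simp
  moreover have "cycle_conjugator n w v j = s * (v ^^ l) a"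
    unfolding cycle_conjugator_def odd_extension_apply[OF j] by (simp add: rep s_def l_def)
  moreover have "cycle_conjugator n w v ((w ^^ k) a) = sgn ((w ^^ k) a) * cycle_conjugator n w v j"
    unfolding j_def by (rule signed_perms_sgn_abs[OF cycle_conjugator_mem])
  moreover have "s * s = 1" unfolding s_def by (rule sgn_mult_sgn_self[OF nonzero(1)])
  ultimately show ?thesis using d(2) by (simp add: a_def)
qed

lemma cycle_conjugator_comp: "cycle_conjugator n w v \<circ> w = v \<circ> cycle_conjugator n w v"
proof -
  let ?u = "cycle_conjugator n w v"
  note u = cycle_conjugator_mem
  show ?thesis
  proof (rule signed_perms_eqI[OF signed_perms.comp_mem[OF u w] signed_perms.comp_mem[OF v u]])
    fix i assume i: "i \<in> {1..int n}"
    define k a where "k = cycle_exponent w i" and "a = cycle_rep w i"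
    define s where "s = sgn ((w ^^ k) a)"
    have "\<bar>(w ^^ k) a\<bar> = i" using abs_funpow_cycle_exponent[OF w i] by (simp add: k_def a_def)
    then have i_eq: "i = s * (w ^^ k) a"
      unfolding s_def by (simp add: sgn_mult_self_eq abs_sgn mult.commute)
    have linear: "f (s * x) = s * f x" if "f \<in> signed_perms n" for f x
      unfolding s_def by (rule signed_perms_sgn_mult[OF that])
    have "?u (w i) = s * ?u ((w ^^ Suc k) a)" by (subst i_eq) (simp add: linear[OF w] linear[OF u])
    also have "\<dots> = s * v ((v ^^ k) a)"
      using cycle_conjugator_funpow[OF i, of "Suc k"] by (simp add: a_def)
    also have "\<dots> = v (s * ?u ((w ^^ k) a))"
      using cycle_conjugator_funpow[OF i, of k] by (simp add: linear[OF v] a_def)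
    also have "s * ?u ((w ^^ k) a) = ?u i" by (subst i_eq) (simp add: linear[OF u])
    finally show "(?u \<circ> w) i = (v \<circ> ?u) i" by simp
  qed
qed

lemma class_function_eq_same_cycles:
  assumes "class_function (signed_perms n) f" shows "f w = f v"
proof -
  let ?u = "cycle_conjugator n w v"
  note u = cycle_conjugator_mem
  have "?u \<circ> w \<circ> inv ?u = v"
    unfolding cycle_conjugator_comp comp_assoc signed_perms.comp_inv[OF u] by simp
  then show ?thesis using class_functionD[OF assms u w] by simp
qed

end

lemma orbit_refine_subset:
  assumes v: "v \<in> signed_perms n"
    and refine: "\<And>i. i \<in> {1..int n} \<Longrightarrow> orbit (unsigned v) (unsigned w i) = orbit (unsigned v) i"
    and i: "i \<in> {1..int n}"
  shows "orbit (unsigned w) i \<subseteq> orbit (unsigned v) i"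
proof (rule orbit_subset_of_image_subset[OF _ self_mem_orbit_unsigned[OF v]])
  show "unsigned w ` orbit (unsigned v) i \<subseteq> orbit (unsigned v) i"
  proof (rule image_subsetI)
    fix y assume y: "y \<in> orbit (unsigned v) i"
    then have "y \<in> {1..int n}"
      using abs_cycle_subset[OF v orbit_mem_abs_cycles[OF i]] by (rule rev_subsetD)
    from refine[OF this] have "orbit (unsigned v) (unsigned w y) = orbit (unsigned v) i"
      unfolding orbit_eq_of_mem[OF unsigned_permutation[OF v] y] .
    then show "unsigned w y \<in> orbit (unsigned v) i"
      using self_mem_orbit_unsigned[OF v, of "unsigned w y"] by simp
  qed
qed

lemma abs_cycles_refine_eq:
  assumes w: "w \<in> signed_perms n" and v: "v \<in> signed_perms n"
    and refine: "\<And>i. i \<in> {1..int n} \<Longrightarrow> orbit (unsigned v) (unsigned w i) = orbit (unsigned v) i"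
    and card: "card (abs_cycles n w) \<le> card (abs_cycles n v)"
    and i: "i \<in> {1..int n}"
  shows "orbit (unsigned w) i = orbit (unsigned v) i"
proof (rule equalityI[OF orbit_refine_subset[OF v refine i]], assumption)
  let ?W = "orbit (unsigned w)" and ?V = "orbit (unsigned v)"
  let ?coarsen = "\<lambda>b. ?V (Min b)"
  have coarsen: "?coarsen (?W j) = ?V j" if j: "j \<in> {1..int n}" for j
  proof (rule orbit_eq_of_mem[OF unsigned_permutation[OF v]])
    have "Min (?W j) \<in> ?W j" using cycle_rep_mem[OF w j] unfolding cycle_rep_def .
    then show "Min (?W j) \<in> ?V j" using orbit_refine_subset[OF v refine j] by blast
  qed
  have "?coarsen ` abs_cycles n w = abs_cycles n v"
    unfolding abs_cycles_def image_image by (intro image_cong refl coarsen)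
  then have inj: "inj_on ?coarsen (abs_cycles n w)"
    using card card_image_le[OF finite_abs_cycles, of ?coarsen n w]
    by (intro eq_card_imp_inj_on finite_abs_cycles) simp
  show "?V i \<subseteq> ?W i"
  proof
    fix y assume y: "y \<in> ?V i"
    then have y_mem: "y \<in> {1..int n}"
      using abs_cycle_subset[OF v orbit_mem_abs_cycles[OF i]] by (rule rev_subsetD)
    have "?coarsen (?W y) = ?coarsen (?W i)"
      unfolding coarsen[OF y_mem] coarsen[OF i]
      by (rule orbit_eq_of_mem[OF unsigned_permutation[OF v] y])
    then have "?W y = ?W i"
      by (rule inj_onD[OF inj]) (intro orbit_mem_abs_cycles y_mem i)+
    then show "y \<in> ?W i" using self_mem_orbit_unsigned[OF w, of y] by simp
  qed
qed

section \<open>The characteristic determines a class function\<close>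

lemma sum_colour_stabilizer_class_function:
  assumes f: "class_function (signed_perms n) f" and c: "c \<in> colourings n M" "c' \<in> colourings n M"
  shows "(\<Sum>w\<in>colour_stabilizer n c. f w * of_int (colour_sign n c w))
    = (\<Sum>w\<in>colour_stabilizer n c'. f w * of_int (colour_sign n c' w))"
proof -
  obtain u where u: "u \<in> colour_transporter n c c'" using colour_transporter_nonempty[OF c] .
  note mem = colour_transporter_mem[OF u] and u_inv = colour_transporter_inv[OF u]
  show ?thesis
  proof (rule sum.reindex_bij_witness[of _ "\<lambda>v. u \<circ> v \<circ> inv u" "\<lambda>w. inv u \<circ> w \<circ> u"])
    fix w assume w: "w \<in> colour_stabilizer n c"
    show "u \<circ> (inv u \<circ> w \<circ> u) \<circ> inv u = w" by (rule signed_perms.conj_inv_conj[OF mem])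
    show mem': "inv u \<circ> w \<circ> u \<in> colour_stabilizer n c'"
      by (intro colour_transporter_comp[OF _ u] colour_transporter_comp[OF u_inv w])
    show "f (inv u \<circ> w \<circ> u) * of_int (colour_sign n c' (inv u \<circ> w \<circ> u))
        = f w * of_int (colour_sign n c w)"
      using colour_sign_conj[OF u mem']
      unfolding signed_perms.conj_inv_conj[OF mem]
        signed_perms.class_function_conj_inv[OF f mem colour_transporter_mem[OF w]]
      by (simp only:)
  next
    fix w assume w: "w \<in> colour_stabilizer n c'"
    show "inv u \<circ> (u \<circ> w \<circ> inv u) \<circ> u = w" by (rule signed_perms.inv_conj_conj[OF mem])
    show "u \<circ> w \<circ> inv u \<in> colour_stabilizer n c"
      by (intro colour_transporter_comp[OF _ u_inv] colour_transporter_comp[OF u w])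
  qed
qed

lemma sum_colour_stabilizer_eq_0:
  assumes f: "class_function (signed_perms n) f" and ch: "ch n f = 0" and "c \<in> {1..int n} \<rightarrow>\<^sub>E UNIV"
  shows "(\<Sum>w\<in>colour_stabilizer n c. f w * of_int (colour_sign n c w)) = 0"
proof -
  define M where "M = image_mset c (mset_set {1..int n})"
  let ?sum = "\<lambda>c. \<Sum>w\<in>colour_stabilizer n c. f w * complex_of_int (colour_sign n c w)"
  have c: "c \<in> colourings n M" using assms(3) by (simp add: colourings_def M_def)
  have "(\<Sum>c'\<in>colourings n M. ?sum c') / of_nat (card (signed_perms n)) = 0"
    unfolding mcoeff_ch_colourings[symmetric] ch by (rule mcoeff_0)
  moreover have "card (signed_perms n) \<noteq> 0" by (simp add: card_signed_perms)
  ultimately have "(\<Sum>c'\<in>colourings n M. ?sum c') = 0" by simp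
  moreover have "(\<Sum>c'\<in>colourings n M. ?sum c') = (\<Sum>c'\<in>colourings n M. ?sum c)"
    by (intro sum.cong refl sum_colour_stabilizer_class_function[OF f _ c])
  moreover have "card (colourings n M) \<noteq> 0" using c finite_colourings[of n M] by auto
  ultimately show ?thesis by simp
qed

definition cycle_colouring :: "nat \<Rightarrow> (int \<Rightarrow> int) \<Rightarrow> int set set \<Rightarrow> int \<Rightarrow> var" where
  "cycle_colouring n v T
    = (\<lambda>i\<in>{1..int n}. (if orbit (unsigned v) i \<in> T then Y else X) (nat (cycle_rep v i)))"

definition cycle_preserving :: "nat \<Rightarrow> (int \<Rightarrow> int) \<Rightarrow> (int \<Rightarrow> int) set" where
  "cycle_preserving n v = {w \<in> signed_perms n.
     \<forall>i\<in>{1..int n}. orbit (unsigned v) (unsigned w i) = orbit (unsigned v) i}"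

lemma finite_cycle_preserving: "finite (cycle_preserving n v)"
  by (simp add: cycle_preserving_def signed_perms.finite)

lemma cycle_preserving_self: "v \<in> signed_perms n \<Longrightarrow> v \<in> cycle_preserving n v"
  using orbit_apply[OF unsigned_permutation] by (simp add: cycle_preserving_def)

context
  fixes n v
  assumes v: "v \<in> signed_perms n"
begin

lemma colour_stabilizer_cycle_colouring:
  "colour_stabilizer n (cycle_colouring n v T) = cycle_preserving n v"
proof -
  have "cycle_colouring n v T i = cycle_colouring n v T j
      \<longleftrightarrow> orbit (unsigned v) i = orbit (unsigned v) j"
    if i: "i \<in> {1..int n}" and j: "j \<in> {1..int n}" for i j
  proof -
    have "nat (cycle_rep v i) = nat (cycle_rep v j) \<longleftrightarrow> orbit (unsigned v) i = orbit (unsigned v) j"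
      using cycle_rep_in[OF v i] cycle_rep_in[OF v j] cycle_rep_eq_iff[OF v i j] by auto
    then show ?thesis using i j by (auto simp: cycle_colouring_def)
  qed
  then show ?thesis
    unfolding colour_transporter_def cycle_preserving_def using unsigned_mem
    by (intro Collect_cong) blast
qed

lemma y_letters_cycle_colouring:
  assumes "T \<subseteq> abs_cycles n v" shows "y_letters n (cycle_colouring n v T) = \<Union>T"
proof -
  have "y_letters n (cycle_colouring n v T) = {i \<in> {1..int n}. orbit (unsigned v) i \<in> T}"
    by (auto simp: y_letters_def cycle_colouring_def)
  also have "\<dots> = \<Union>T"
    using assms abs_cycle_subset[OF v] orbit_eq_abs_cycle[OF v] self_mem_orbit_unsigned[OF v]
    by blast
  finally show ?thesis .
qed

lemma colour_sign_cycle_colouring: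
  assumes "T \<subseteq> abs_cycles n v"
  shows "colour_sign n (cycle_colouring n v T) w = (\<Prod>b\<in>T. cycle_sign w b)"
  unfolding colour_sign_eq_prod_y_letters y_letters_cycle_colouring[OF assms] cycle_sign_def
  using assms finite_abs_cycle[OF v] abs_cycles_disjoint[OF v]
  by (subst prod.Union_disjoint) (auto simp: subset_iff)

end

lemma sum_sign_pattern_eq_0:
  fixes f :: "'a \<Rightarrow> 'c :: field_char_0"
  assumes "finite S" "finite P"
    and s: "\<And>w b. w \<in> S \<Longrightarrow> b \<in> P \<Longrightarrow> s w b = 1 \<or> s w b = - 1"
    and t: "\<And>b. b \<in> P \<Longrightarrow> t b = 1 \<or> t b = - 1"
    and zero: "\<And>T. T \<subseteq> P \<Longrightarrow> (\<Sum>w\<in>S. f w * (\<Prod>b\<in>T. s w b)) = 0"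
  shows "(\<Sum>w | w \<in> S \<and> (\<forall>b\<in>P. s w b = t b). f w) = 0"
proof -
  have prod: "(\<Prod>b\<in>P. t b * s w b + 1) = (if \<forall>b\<in>P. s w b = t b then 2 ^ card P else 0)"
    if w: "w \<in> S" for w
  proof (cases "\<forall>b\<in>P. s w b = t b")
    case True
    have "t b * s w b + 1 = 2" if "b \<in> P" for b using True t[OF that] that by auto
    then show ?thesis using True by simp
  next
    case False
    then obtain b where b: "b \<in> P" "s w b \<noteq> t b" by blast
    then have "t b * s w b + 1 = 0" using s[OF w b(1)] t[OF b(1)] by auto
    then have "(\<Prod>b\<in>P. t b * s w b + 1) = 0" using b(1) by (intro prod_zero assms(2)) blast
    then show ?thesis using False by simp
  qed
  have "0 = (\<Sum>T\<in>Pow P. (\<Prod>b\<in>T. t b) * (\<Sum>w\<in>S. f w * (\<Prod>b\<in>T. s w b)))"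
    using zero by (intro sum.neutral[symmetric]) simp
  also have "\<dots> = (\<Sum>T\<in>Pow P. \<Sum>w\<in>S. f w * (\<Prod>b\<in>T. t b * s w b))"
    by (simp add: sum_distrib_left prod.distrib mult_ac)
  also have "\<dots> = (\<Sum>w\<in>S. f w * (\<Prod>b\<in>P. t b * s w b + 1))"
    unfolding sum.swap[of _ S] by (simp add: prod_add[OF assms(2)] sum_distrib_left)
  also have "\<dots> = (\<Sum>w\<in>S. if \<forall>b\<in>P. s w b = t b then f w * 2 ^ card P else 0)"
    by (intro sum.cong refl) (simp add: prod)
  also have "\<dots> = (\<Sum>w | w \<in> S \<and> (\<forall>b\<in>P. s w b = t b). f w * 2 ^ card P)"
    by (rule sum.inter_filter[OF assms(1), symmetric])
  also have "\<dots> = (\<Sum>w | w \<in> S \<and> (\<forall>b\<in>P. s w b = t b). f w) * 2 ^ card P"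
    by (rule sum_distrib_right[symmetric])
  finally show ?thesis by simp
qed

lemma sum_same_cycle_signs_eq_0:
  assumes f: "class_function (signed_perms n) f" and ch: "ch n f = 0" and v: "v \<in> signed_perms n"
  shows "(\<Sum>w | w \<in> cycle_preserving n v \<and> (\<forall>b\<in>abs_cycles n v. cycle_sign w b = cycle_sign v b). f w)
    = 0"
proof -
  have cases: "complex_of_int (cycle_sign w b) = 1 \<or> complex_of_int (cycle_sign w b) = - 1"
    if "w \<in> signed_perms n" "b \<in> abs_cycles n v" for w b
    using cycle_sign_cases_subset[OF that(1) abs_cycle_subset[OF v that(2)]] by auto
  have zero: "(\<Sum>w\<in>cycle_preserving n v. f w * (\<Prod>b\<in>T. complex_of_int (cycle_sign w b))) = 0"
    if T: "T \<subseteq> abs_cycles n v" for T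
  proof -
    have "cycle_colouring n v T \<in> {1..int n} \<rightarrow>\<^sub>E UNIV" by (simp add: cycle_colouring_def)
    from sum_colour_stabilizer_eq_0[OF f ch this] show ?thesis
      by (simp add: colour_stabilizer_cycle_colouring[OF v] colour_sign_cycle_colouring[OF v T])
  qed
  have "(\<Sum>w | w \<in> cycle_preserving n v \<and> (\<forall>b\<in>abs_cycles n v.
      complex_of_int (cycle_sign w b) = of_int (cycle_sign v b)). f w) = 0"
    by (rule sum_sign_pattern_eq_0[OF finite_cycle_preserving finite_abs_cycles cases
          cases[OF v] zero])
      (auto simp: cycle_preserving_def)
  then show ?thesis by simp
qed

text \<open>Of the permutations that preserve the cycles of \<open>v\<close> and have the same signs on them, all but
  the conjugates of \<open>v\<close> have more cycles than \<open>v\<close>.\<close>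

lemma ch_eq_0_imp_eq_0:
  assumes f: "class_function (signed_perms n) f" and ch: "ch n f = 0" and "v \<in> signed_perms n"
  shows "f v = 0"
  using assms(3)
proof (induction "n - card (abs_cycles n v)" arbitrary: v rule: less_induct)
  case less
  note v = less.prems
  let ?S = "{w. w \<in> cycle_preserving n v \<and> (\<forall>b\<in>abs_cycles n v. cycle_sign w b = cycle_sign v b)}"
  let ?same = "\<lambda>w. abs_cycles n w = abs_cycles n v"
  have "f w = (if ?same w then f v else 0)" if w: "w \<in> ?S" for w
  proof -
    have mem: "w \<in> signed_perms n"
      and preserves: "\<And>i. i \<in> {1..int n} \<Longrightarrow> orbit (unsigned v) (unsigned w i) = orbit (unsigned v) i"
      using w by (simp_all add: cycle_preserving_def)
    show ?thesis
    proof (cases "card (abs_cycles n w) \<le> card (abs_cycles n v)")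
      case True
      note orbit_eq = abs_cycles_refine_eq[OF mem v preserves True]
      then have "?same w" unfolding abs_cycles_def by (intro image_cong refl) blast
      moreover from this have "f w = f v"
        using w by (intro class_function_eq_same_cycles[OF mem v orbit_eq _ f]) simp_all
      ultimately show ?thesis by simp
    next
      case False
      then have "f w = 0" using card_abs_cycles_le[of n w] by (intro less.hyps mem) simp
      then show ?thesis using False by auto
    qed
  qed
  then have "(\<Sum>w\<in>?S. f w) = (\<Sum>w\<in>?S. if ?same w then f v else 0)" by (intro sum.cong refl)
  also have "\<dots> = of_nat (card {w \<in> ?S. ?same w}) * f v"
    using finite_subset[OF _ finite_cycle_preserving[of n v]]
    by (subst sum.inter_filter[symmetric]) auto
  finally have "of_nat (card {w \<in> ?S. ?same w}) * f v = 0"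
    using sum_same_cycle_signs_eq_0[OF f ch v] by simp
  moreover have "v \<in> {w \<in> ?S. ?same w}" using cycle_preserving_self[OF v] by simp
  moreover have "finite {w \<in> ?S. ?same w}"
    by (rule finite_subset[OF _ finite_cycle_preserving[of n v]]) blast
  ultimately show ?case by auto
qed

section \<open>A criterion for irreducibility\<close>

lemma
  assumes "invariant_subspace G d \<rho> W"
  shows invariant_subspace_carrier: "x \<in> W \<Longrightarrow> x \<in> carrier_vec d"
    and invariant_subspace_zero: "0\<^sub>v d \<in> W"
    and invariant_subspace_add: "x \<in> W \<Longrightarrow> y \<in> W \<Longrightarrow> x + y \<in> W"
    and invariant_subspace_smult: "x \<in> W \<Longrightarrow> a \<cdot>\<^sub>v x \<in> W"
    and invariant_subspace_act: "u \<in> G \<Longrightarrow> x \<in> W \<Longrightarrow> \<rho> u *\<^sub>v x \<in> W"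
  using assms unfolding invariant_subspace_def by blast+

lemma invariant_subspace_eq_carrier:
  assumes W: "invariant_subspace G d \<rho> W" and unit: "\<And>q. q < d \<Longrightarrow> unit_vec d q \<in> W"
  shows "W = carrier_vec d"
proof (intro equalityI subsetI)
  fix y :: "complex vec" assume y: "y \<in> carrier_vec d"
  have "vec d (\<lambda>q. if q < k then y $ q else 0) \<in> W" if "k \<le> d" for k
    using that
  proof (induction k)
    case 0
    have "vec d (\<lambda>q. if q < 0 then y $ q else 0) = 0\<^sub>v d" by (intro eq_vecI) auto
    then show ?case using invariant_subspace_zero[OF W] by simp
  next
    case (Suc k)
    have "vec d (\<lambda>q. if q < Suc k then y $ q else 0)
        = vec d (\<lambda>q. if q < k then y $ q else 0) + y $ k \<cdot>\<^sub>v unit_vec d k"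
      using Suc.prems by (intro eq_vecI) (auto simp: less_Suc_eq)
    then show ?case
      using Suc unit by (simp add: invariant_subspace_add[OF W] invariant_subspace_smult[OF W])
  qed
  from this[OF order_refl] have "vec d (\<lambda>q. if q < d then y $ q else 0) \<in> W" .
  also have "vec d (\<lambda>q. if q < d then y $ q else 0) = y" using y by (intro eq_vecI) auto
  finally show "y \<in> W" .
qed (rule invariant_subspace_carrier[OF W])

lemma unit_vec_mem_invariant_subspace:
  assumes W: "invariant_subspace G d \<rho> W" and x: "x \<in> W" "p < d" "x $ p \<noteq> 0"
    and separated: "\<And>q. q < d \<Longrightarrow> q \<noteq> p \<Longrightarrow> \<exists>g\<in>G. \<exists>\<delta>. \<delta> p \<noteq> \<delta> q \<and>
      (\<forall>y\<in>carrier_vec d. \<forall>r<d. (\<rho> g *\<^sub>v y) $ r = \<delta> r * y $ r)"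
  shows "unit_vec d p \<in> W"
proof -
  have "\<exists>y\<in>W. y $ p \<noteq> 0 \<and> (\<forall>q\<in>Q. y $ q = 0)" if "finite Q" "Q \<subseteq> {..<d} - {p}" for Q
    using that
  proof (induction Q rule: finite_induct)
    case (insert q Q)
    then obtain y where y: "y \<in> W" "y $ p \<noteq> 0" "\<forall>r\<in>Q. y $ r = 0" by blast
    have q: "q < d" "q \<noteq> p" using insert.prems by auto
    from separated[OF this] obtain g \<delta> where g: "g \<in> G" "\<delta> p \<noteq> \<delta> q"
      and diagonal: "\<And>y r. y \<in> carrier_vec d \<Longrightarrow> r < d \<Longrightarrow> (\<rho> g *\<^sub>v y) $ r = \<delta> r * y $ r" by blast
    note carrier = invariant_subspace_carrier[OF W]
    have gy: "\<rho> g *\<^sub>v y \<in> W" by (rule invariant_subspace_act[OF W g(1) y(1)])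
    let ?z = "\<rho> g *\<^sub>v y + (- \<delta> q) \<cdot>\<^sub>v y"
    have z: "?z $ r = (\<delta> r - \<delta> q) * y $ r" if "r < d" for r
      using that carrier[OF y(1)] carrier[OF gy] diagonal[OF carrier[OF y(1)] that]
      by (simp add: left_diff_distrib)
    show ?case
    proof (intro bexI conjI ballI)
      show "?z \<in> W" by (intro invariant_subspace_add[OF W] invariant_subspace_smult[OF W] gy y(1))
      show "?z $ p \<noteq> 0" using z[OF x(2)] g(2) y(2) by simp
      show "?z $ r = 0" if "r \<in> insert q Q" for r using z[of r] that y(3) insert.prems by auto
    qed
  qed (use x in blast)
  from this[of "{..<d} - {p}"] obtain y where y: "y \<in> W" "y $ p \<noteq> 0" "\<forall>q\<in>{..<d} - {p}. y $ q = 0"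
    by auto
  have "(1 / y $ p) \<cdot>\<^sub>v y = unit_vec d p"
    using y(2,3) x(2) invariant_subspace_carrier[OF W y(1)] by (intro eq_vecI) auto
  then show ?thesis using invariant_subspace_smult[OF W y(1)] by metis
qed

lemma irreducible_representationI:
  assumes "representation G d \<rho>" "d > 0"
    and separated: "\<And>p q. p < d \<Longrightarrow> q < d \<Longrightarrow> q \<noteq> p \<Longrightarrow> \<exists>g\<in>G. \<exists>\<delta>. \<delta> p \<noteq> \<delta> q \<and>
      (\<forall>y\<in>carrier_vec d. \<forall>r<d. (\<rho> g *\<^sub>v y) $ r = \<delta> r * y $ r)"
    and transitive: "\<And>p q. p < d \<Longrightarrow> q < d \<Longrightarrow>
      \<exists>g\<in>G. \<exists>a. a \<noteq> 0 \<and> \<rho> g *\<^sub>v unit_vec d p = a \<cdot>\<^sub>v unit_vec d q"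
  shows "irreducible_representation G d \<rho>"
proof -
  have "W = carrier_vec d" if W: "invariant_subspace G d \<rho> W" and "W \<noteq> {0\<^sub>v d}" for W
  proof (rule invariant_subspace_eq_carrier[OF W])
    fix q assume q: "q < d"
    have "\<not> W \<subseteq> {0\<^sub>v d}"
      using that(2) invariant_subspace_zero[OF W] by (metis empty_iff subset_singletonD)
    then obtain x where x: "x \<in> W" "x \<noteq> 0\<^sub>v d" by (auto simp: subset_iff)
    have "\<exists>p<d. x $ p \<noteq> 0"
    proof (rule ccontr)
      assume "\<not> (\<exists>p<d. x $ p \<noteq> 0)"
      then have "x = 0\<^sub>v d" using invariant_subspace_carrier[OF W x(1)] by (intro eq_vecI) auto
      then show False using x(2) by simp
    qed
    then obtain p where p: "p < d" "x $ p \<noteq> 0" by blast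
    have unit: "unit_vec d p \<in> W"
      by (rule unit_vec_mem_invariant_subspace[OF W x(1) p]) (rule separated[OF p(1)])
    obtain g a where g: "g \<in> G" "a \<noteq> 0" "\<rho> g *\<^sub>v unit_vec d p = a \<cdot>\<^sub>v unit_vec d q"
      using transitive[OF p(1) q] by blast
    have "a \<cdot>\<^sub>v unit_vec d q \<in> W" using invariant_subspace_act[OF W g(1) unit] unfolding g(3) .
    then have "(1 / a) \<cdot>\<^sub>v (a \<cdot>\<^sub>v unit_vec d q) \<in> W" by (rule invariant_subspace_smult[OF W])
    then show "unit_vec d q \<in> W" using g(2) by (simp add: smult_smult_assoc)
  qed
  then have "\<forall>W. invariant_subspace G d \<rho> W \<longrightarrow> W = {0\<^sub>v d} \<or> W = carrier_vec d" by blast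
  then show ?thesis using assms(1,2) by (simp add: irreducible_representation_def)
qed

section \<open>Monomial matrices\<close>

definition monomial_mat :: "nat \<Rightarrow> (nat \<Rightarrow> nat) \<Rightarrow> (nat \<Rightarrow> 'a :: comm_ring_1) \<Rightarrow> 'a mat" where
  "monomial_mat d \<pi> a = mat d d (\<lambda>(p, q). if p = \<pi> q then a q else 0)"

lemma monomial_mat_carrier: "monomial_mat d \<pi> a \<in> carrier_mat d d"
  by (simp add: monomial_mat_def)

lemma monomial_mat_cong:
  "(\<And>q. q < d \<Longrightarrow> \<pi> q = \<pi>' q) \<Longrightarrow> (\<And>q. q < d \<Longrightarrow> a q = a' q) \<Longrightarrow> monomial_mat d \<pi> a = monomial_mat d \<pi>' a'"
  unfolding monomial_mat_def by (intro eq_matI) auto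

lemma monomial_mat_one: "monomial_mat d (\<lambda>q. q) (\<lambda>_. 1) = 1\<^sub>m d"
  unfolding monomial_mat_def by (intro eq_matI) auto

lemma monomial_mat_mult:
  assumes "\<And>q. q < d \<Longrightarrow> \<pi>' q < d"
  shows "monomial_mat d \<pi> a * monomial_mat d \<pi>' a'
    = monomial_mat d (\<lambda>q. \<pi> (\<pi>' q)) (\<lambda>q. a (\<pi>' q) * a' q)"
proof (rule eq_matI)
  fix p q assume "p < dim_row (monomial_mat d (\<lambda>q. \<pi> (\<pi>' q)) (\<lambda>q. a (\<pi>' q) * a' q))"
    and "q < dim_col (monomial_mat d (\<lambda>q. \<pi> (\<pi>' q)) (\<lambda>q. a (\<pi>' q) * a' q))"
  then have pq: "p < d" "q < d" by (simp_all add: monomial_mat_def)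
  then have "(monomial_mat d \<pi> a * monomial_mat d \<pi>' a') $$ (p, q)
      = (\<Sum>r = 0..<d. (if p = \<pi> r then a r else 0) * (if r = \<pi>' q then a' q else 0))"
    by (simp add: monomial_mat_def scalar_prod_def)
  also have "\<dots> = (\<Sum>r = 0..<d. if r = \<pi>' q then (if p = \<pi> r then a r else 0) * a' q else 0)"
    by (intro sum.cong refl) simp
  also have "\<dots> = (if p = \<pi> (\<pi>' q) then a (\<pi>' q) else 0) * a' q"
    using assms[OF pq(2)] by simp
  finally show "(monomial_mat d \<pi> a * monomial_mat d \<pi>' a') $$ (p, q)
      = monomial_mat d (\<lambda>q. \<pi> (\<pi>' q)) (\<lambda>q. a (\<pi>' q) * a' q) $$ (p, q)"
    using pq by (simp add: monomial_mat_def)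
qed (simp_all add: monomial_mat_def)

lemma monomial_mat_mult_unit_vec:
  fixes a :: "nat \<Rightarrow> 'a :: comm_ring_1"
  assumes "q < d" shows "monomial_mat d \<pi> a *\<^sub>v unit_vec d q = a q \<cdot>\<^sub>v unit_vec d (\<pi> q)"
proof (rule eq_vecI)
  fix r assume "r < dim_vec (a q \<cdot>\<^sub>v unit_vec d (\<pi> q))"
  then have r: "r < d" by simp
  then have "unit_vec d (\<pi> q) $ r = (if r = \<pi> q then 1 else 0 :: 'a)" by (simp add: unit_vec_def)
  then show "(monomial_mat d \<pi> a *\<^sub>v unit_vec d q) $ r = (a q \<cdot>\<^sub>v unit_vec d (\<pi> q)) $ r"
    using assms r by (simp add: monomial_mat_def)
qed (simp add: monomial_mat_def)

lemma diagonal_monomial_mat_mult_vec: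
  assumes "y \<in> carrier_vec d" "r < d" shows "(monomial_mat d (\<lambda>q. q) a *\<^sub>v y) $ r = a r * y $ r"
proof -
  have "(monomial_mat d (\<lambda>q. q) a *\<^sub>v y) $ r = (\<Sum>q = 0..<d. (if r = q then a q else 0) * y $ q)"
    using assms by (simp add: monomial_mat_def scalar_prod_def)
  also have "\<dots> = (\<Sum>q = 0..<d. if q = r then a r * y $ r else 0)" by (intro sum.cong refl) simp
  finally show ?thesis using assms by simp
qed

section \<open>The exterior powers are irreducible\<close>

text \<open>The representation on the exterior power with respect to the basis vectors of the sets
  \<open>e 0, \<dots>, e (d - 1)\<close>.\<close>

definition ext_power_rep :: "nat \<Rightarrow> (nat \<Rightarrow> int set) \<Rightarrow> (int \<Rightarrow> int) \<Rightarrow> complex mat" where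
  "ext_power_rep d e w = monomial_mat d (\<lambda>q. inv_into {..<d} e (unsigned w ` e q))
     (\<lambda>q. of_int (ext_sign w (e q)))"

lemma letter_subsets_nonempty:
  assumes "j \<le> n" shows "letter_subsets n j \<noteq> {}"
proof -
  obtain I where "I \<subseteq> {1..int n}" "card I = j"
    using obtain_subset_with_card_n[of j "{1..int n}"] assms by auto
  then show ?thesis by (auto simp: letter_subsets_def)
qed

lemma unsigned_image_mem_letter_subsets:
  assumes "w \<in> signed_perms n" "I \<in> letter_subsets n j" shows "unsigned w ` I \<in> letter_subsets n j"
  using assms unsigned_image[OF assms(1)] unsigned_inj_on[OF assms(1), of I]
  by (auto simp: letter_subsets_def card_image)

lemma signed_perms_letter_subsets_transitive:
  assumes "A \<in> letter_subsets n j" "B \<in> letter_subsets n j"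
  obtains u where "u \<in> signed_perms n" "unsigned u ` A = B"
proof -
  let ?L = "{1..int n}"
  have A: "A \<subseteq> ?L" "finite A" and B: "B \<subseteq> ?L" "finite B" and card: "card A = card B"
    using assms finite_subset[of _ ?L] by (auto simp: letter_subsets_def)
  have count: "card {i \<in> ?L. (i \<in> E) = x} = (if x then card E else n - card E)" if "E \<subseteq> ?L" for E x
  proof (cases x)
    case True
    then have "{i \<in> ?L. (i \<in> E) = x} = E" using that by auto
    then show ?thesis using True by simp
  next
    case False
    then have "{i \<in> ?L. (i \<in> E) = x} = ?L - E" by auto
    then show ?thesis using False that finite_subset[OF that] by (simp add: card_Diff_subset)
  qed
  have "image_mset (\<lambda>i. i \<in> A) (mset_set ?L) = image_mset (\<lambda>i. i \<in> B) (mset_set ?L)"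
    by (rule multiset_eqI)
      (simp only: count_image_mset_eq_card_vimage finite_atLeastAtMost_int count A(1) B(1) card)
  then obtain p where p: "p permutes ?L" "\<forall>i\<in>?L. (i \<in> A) = (p i \<in> B)"
    by (rule image_mset_eq_implies_permutes[OF finite_atLeastAtMost_int])
  have "p ` A \<subseteq> B" using p(2) A(1) by blast
  moreover have "card (p ` A) = card B"
    using card_image[OF inj_on_subset[OF permutes_inj[OF p(1)] subset_UNIV], of A] card by simp
  ultimately have "p ` A = B" by (intro card_subset_eq B(2))
  moreover have "unsigned (odd_extension n p) ` A = p ` A"
    using A(1) unsigned_odd_extension_permutes[OF p(1)] by (intro image_cong refl) blast
  ultimately show ?thesis using that[OF odd_extension_permutes_mem[OF p(1)]] by simp
qed

context
  fixes n j d :: nat and e :: "nat \<Rightarrow> int set"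
  assumes e: "bij_betw e {..<d} (letter_subsets n j)"
begin

lemma enum_mem: "q < d \<Longrightarrow> e q \<in> letter_subsets n j"
  using bij_betw_apply[OF e] by simp

lemma enum_subset: "q < d \<Longrightarrow> e q \<subseteq> {1..int n}"
  using enum_mem by (simp add: letter_subsets_def)

lemma inv_enum_enum: "q < d \<Longrightarrow> inv_into {..<d} e (e q) = q"
  using bij_betw_inv_into_left[OF e] by simp

lemma
  assumes "w \<in> signed_perms n" "q < d"
  shows inv_enum_unsigned_image_less: "inv_into {..<d} e (unsigned w ` e q) < d"
    and enum_inv_enum_unsigned_image: "e (inv_into {..<d} e (unsigned w ` e q)) = unsigned w ` e q"
proof -
  have mem: "unsigned w ` e q \<in> letter_subsets n j"
    by (rule unsigned_image_mem_letter_subsets[OF assms(1) enum_mem[OF assms(2)]])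
  then show "e (inv_into {..<d} e (unsigned w ` e q)) = unsigned w ` e q"
    by (rule bij_betw_inv_into_right[OF e])
  show "inv_into {..<d} e (unsigned w ` e q) < d"
    using bij_betw_apply[OF bij_betw_inv_into[OF e] mem] by simp
qed

lemma representation_ext_power_rep: "representation (signed_perms n) d (ext_power_rep d e)"
  unfolding representation_def
proof (intro conjI ballI)
  show "ext_power_rep d e w \<in> carrier_mat d d" for w
    unfolding ext_power_rep_def by (rule monomial_mat_carrier)
  have "ext_power_rep d e id = monomial_mat d (\<lambda>q. q) (\<lambda>_. 1)"
    unfolding ext_power_rep_def
    by (rule monomial_mat_cong)
      (simp_all add: unsigned_id inv_enum_enum ext_sign_id[OF enum_subset])
  then show "ext_power_rep d e id = 1\<^sub>m d" by (simp only: monomial_mat_one)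
  fix u v assume u: "u \<in> signed_perms n" and v: "v \<in> signed_perms n"
  let ?\<pi> = "\<lambda>w q. inv_into {..<d} e (unsigned w ` e q)"
  have "ext_power_rep d e u * ext_power_rep d e v = monomial_mat d (\<lambda>q. ?\<pi> u (?\<pi> v q))
      (\<lambda>q. of_int (ext_sign u (e (?\<pi> v q))) * of_int (ext_sign v (e q)))"
    unfolding ext_power_rep_def
    by (rule monomial_mat_mult) (rule inv_enum_unsigned_image_less[OF v])
  also have "\<dots> = ext_power_rep d e (u \<circ> v)"
    unfolding ext_power_rep_def
    by (rule monomial_mat_cong)
      (simp_all add: enum_inv_enum_unsigned_image[OF v] unsigned_comp[OF u v] image_image
        ext_sign_comp[OF u v enum_subset])
  finally show "ext_power_rep d e (u \<circ> v) = ext_power_rep d e u * ext_power_rep d e v" by (rule sym)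
qed

lemma ext_power_rep_sign_flip:
  "ext_power_rep d e (sign_flip n k) = monomial_mat d (\<lambda>q. q) (\<lambda>q. if k \<in> e q then - 1 else 1)"
  unfolding ext_power_rep_def
  by (rule monomial_mat_cong)
    (simp_all add: unsigned_sign_flip inv_enum_enum ext_sign_sign_flip[OF enum_subset])

lemma irreducible_representation_ext_power_rep:
  assumes "j \<le> n" shows "irreducible_representation (signed_perms n) d (ext_power_rep d e)"
proof (rule irreducible_representationI[OF representation_ext_power_rep])
  show "d > 0"
    using bij_betw_same_card[OF e] letter_subsets_nonempty[OF assms] finite_letter_subsets[of n j]
    by (simp add: card_gt_0_iff)
next
  fix p q assume p: "p < d" and q: "q < d" and "q \<noteq> p"
  then have "e p \<noteq> e q" using inv_enum_enum by metis
  then obtain k where "k \<in> e p \<longleftrightarrow> k \<notin> e q" by blast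
  then show "\<exists>g\<in>signed_perms n. \<exists>\<delta>. \<delta> p \<noteq> \<delta> q \<and>
      (\<forall>y\<in>carrier_vec d. \<forall>r<d. (ext_power_rep d e g *\<^sub>v y) $ r = \<delta> r * y $ r)"
    by (intro bexI[OF _ sign_flip_mem[of n k]] exI[of _ "\<lambda>q. if k \<in> e q then - 1 else 1"])
      (simp add: ext_power_rep_sign_flip diagonal_monomial_mat_mult_vec)
next
  fix p q assume p: "p < d" and q: "q < d"
  obtain u where u: "u \<in> signed_perms n" "unsigned u ` e p = e q"
    using signed_perms_letter_subsets_transitive[OF enum_mem[OF p] enum_mem[OF q]] .
  have "ext_power_rep d e u *\<^sub>v unit_vec d p = of_int (ext_sign u (e p)) \<cdot>\<^sub>v unit_vec d q"
    unfolding ext_power_rep_def monomial_mat_mult_unit_vec[OF p] u(2) inv_enum_enum[OF q] ..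
  moreover have "complex_of_int (ext_sign u (e p)) \<noteq> 0"
    using ext_sign_nonzero[OF u(1) enum_subset[OF p]] by simp
  ultimately show "\<exists>g\<in>signed_perms n. \<exists>a. a \<noteq> 0 \<and>
      ext_power_rep d e g *\<^sub>v unit_vec d p = a \<cdot>\<^sub>v unit_vec d q" using u(1) by blast
qed

lemma ext_power_char_eq_trace:
  assumes w: "w \<in> signed_perms n"
  shows "ext_power_char n j w = (\<Sum>i<d. ext_power_rep d e w $$ (i, i))"
proof -
  let ?sign = "\<lambda>I. complex_of_int (ext_sign w I)"
  have "i = inv_into {..<d} e (unsigned w ` e i) \<longleftrightarrow> unsigned w ` e i = e i" if "i < d" for i
    using inv_enum_enum[OF that] enum_inv_enum_unsigned_image[OF w that] by metis
  then have "(\<Sum>i<d. ext_power_rep d e w $$ (i, i))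
      = (\<Sum>i<d. if unsigned w ` e i = e i then ?sign (e i) else 0)"
    by (intro sum.cong refl) (simp add: ext_power_rep_def monomial_mat_def)
  also have "\<dots> = (\<Sum>I\<in>letter_subsets n j. if unsigned w ` I = I then ?sign I else 0)"
    by (rule sum.reindex_bij_betw[OF e])
  also have "\<dots> = (\<Sum>I | I \<in> letter_subsets n j \<and> unsigned w ` I = I. ?sign I)"
    by (rule sum.inter_filter[OF finite_letter_subsets, symmetric])
  finally show ?thesis using w by (simp add: ext_power_char_def)
qed

end

lemma irreducible_character_ext_power_char:
  assumes "j \<le> n" shows "irreducible_character (signed_perms n) (ext_power_char n j)"
proof -
  obtain e where e: "bij_betw e {..<card (letter_subsets n j)} (letter_subsets n j)"
    using ex_bij_betw_nat_finite[OF finite_letter_subsets] unfolding lessThan_atLeast0 by blast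
  let ?d = "card (letter_subsets n j)"
  have "ext_power_char n j = (\<lambda>w. if w \<in> signed_perms n
      then \<Sum>i<?d. ext_power_rep ?d e w $$ (i, i) else 0)"
  proof
    fix w show "ext_power_char n j w = (if w \<in> signed_perms n
      then \<Sum>i<?d. ext_power_rep ?d e w $$ (i, i) else 0)"
      using ext_power_char_eq_trace[OF e, of w]
      by (cases "w \<in> signed_perms n") (simp_all add: ext_power_char_def)
  qed
  then show ?thesis
    using irreducible_representation_ext_power_rep[OF e assms] unfolding irreducible_character_def
    by blast
qed

lemma ch_diff: "ch n (\<lambda>w. f w - g w) = ch n f - ch n g"
  by (rule mseries_eqI)
    (simp add: mcoeff_ch mcoeff_diff left_diff_distrib sum_subtractf diff_divide_distrib)

lemma ch_sum: "ch n (\<lambda>w. \<Sum>k\<in>K. f k w) = (\<Sum>k\<in>K. ch n (f k))"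
proof (rule mseries_eqI)
  fix M
  have "(\<Sum>w\<in>signed_perms n. (\<Sum>k\<in>K. f k w) * mcoeff (type_series (signed_cycle_type n w)) M)
      = (\<Sum>k\<in>K. \<Sum>w\<in>signed_perms n. f k w * mcoeff (type_series (signed_cycle_type n w)) M)"
    unfolding sum_distrib_right by (rule sum.swap)
  then show "mcoeff (ch n (\<lambda>w. \<Sum>k\<in>K. f k w)) M = mcoeff (\<Sum>k\<in>K. ch n (f k)) M"
    unfolding mcoeff_ch mcoeff_sum by (simp add: sum_divide_distrib)
qed

lemma ch_inject:
  assumes f: "class_function (signed_perms n) f" and g: "class_function (signed_perms n) g"
    and "ch n f = ch n g" and w: "w \<in> signed_perms n"
  shows "f w = g w"
proof -
  have "class_function (signed_perms n) (\<lambda>w. f w - g w)"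
    using class_functionD[OF f] class_functionD[OF g] by (simp add: class_function_def)
  moreover have "ch n (\<lambda>w. f w - g w) = 0" by (simp add: ch_diff assms(3))
  ultimately have "f w - g w = 0" using w by (rule ch_eq_0_imp_eq_0)
  then show ?thesis by simp
qed

lemma irr_char_row_column:
  assumes "k + j = n"
  shows "irr_char n [k] (replicate j 1) = ext_power_char n j"
  unfolding irr_char_def
proof (rule the_equality)
  have irreducible: "irreducible_character (signed_perms n) (ext_power_char n j)"
    using assms by (intro irreducible_character_ext_power_char) simp
  note ch = ch_ext_power_char[OF assms]
  show "irreducible_character (signed_perms n) (ext_power_char n j)
      \<and> ch n (ext_power_char n j) = schur X [k] * schur Y (replicate j 1)"
    using irreducible ch by blast
  fix \<chi>
  assume "irreducible_character (signed_perms n) \<chi> \<and> ch n \<chi> = schur X [k] * schur Y (replicate j 1)"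
  then have \<chi>: "irreducible_character (signed_perms n) \<chi>" "ch n \<chi> = ch n (ext_power_char n j)"
    by (simp_all only: ch)
  show "\<chi> = ext_power_char n j"
  proof
    fix w show "\<chi> w = ext_power_char n j w"
    proof (cases "w \<in> signed_perms n")
      case True
      show ?thesis
        by (rule ch_inject[OF _ _ \<chi>(2) True])
          (intro signed_perms.class_function_irreducible_character \<chi>(1) irreducible)+
    next
      case False
      then have "\<chi> w = 0" using \<chi>(1) by (auto simp: irreducible_character_def)
      then show ?thesis using False by (simp add: ext_power_char_def)
    qed
  qed
qed

lemma ch_induced_irr_char_row_column:
  assumes "n \<ge> 1" "k \<le> n - 1"
  shows "ch n (induced (signed_perms (n - 1)) (signed_perms n)
      (irr_char (n - 1) [k] (replicate (n - k - 1) 1)))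
    = p_plus 1 * (schur X [k] * schur Y (replicate (n - k - 1) 1))"
proof -
  have "k + (n - k - 1) = n - 1" using assms by simp
  then show ?thesis by (simp only: ch_induced[OF assms(1)] irr_char_row_column ch_ext_power_char)
qed

theorem theorem8p3:
  fixes n :: nat
  assumes "n \<ge> 2"
  shows "fine_set n (signed_arc_perms n) (sDes n)
           (induced (signed_perms (n - 1)) (signed_perms n) (ext_char (n - 1))) \<and>
         (\<Sum>w \<in> signed_arc_perms n. F_fun n (sDes n w)) =
           ch n (\<lambda>w. \<Sum>k = 0..n - 1.
             induced (signed_perms (n - 1)) (signed_perms n)
               (irr_char (n - 1) [k] (replicate (n - k - 1) 1)) w)"
proof
  show "fine_set n (signed_arc_perms n) (sDes n)
      (induced (signed_perms (n - 1)) (signed_perms n) (ext_char (n - 1)))"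
    by (rule fine_set_signed_arc_perms[OF assms])
  have "(\<Sum>w \<in> signed_arc_perms n. F_fun n (sDes n w))
      = (\<Sum>k = 0..n - 1. p_plus 1 * (schur X [k] * schur Y (replicate (n - k - 1) 1)))"
    by (simp only: sum_F_signed_arc_perms[OF assms] sum_distrib_left diff_commute[of n _ 1])
  also have "\<dots> = (\<Sum>k = 0..n - 1. ch n (induced (signed_perms (n - 1)) (signed_perms n)
      (irr_char (n - 1) [k] (replicate (n - k - 1) 1))))"
    using assms by (intro sum.cong refl ch_induced_irr_char_row_column[symmetric]) simp_all
  finally show "(\<Sum>w \<in> signed_arc_perms n. F_fun n (sDes n w)) = ch n (\<lambda>w. \<Sum>k = 0..n - 1.
        induced (signed_perms (n - 1)) (signed_perms n)
          (irr_char (n - 1) [k] (replicate (n - k - 1) 1)) w)"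
    by (simp only: ch_sum)
qed

end
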